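(* Let $\alpha,\beta_w\in(0,1)$ be constants and let $n\to\infty$ with $m=\alpha n$ and $k=\beta_w n$. Let $A$ be an $m\times n$ matrix with i.i.d. standard normal entries. Fix a set $S\subset\{1,\dots,n\}$ with $|S|=k$ and a sign pattern $\sigma\in\{-1,+1\}^S$, and consider $k$-sparse vectors $\mathbf{x}\in\mathbb{R}^n$ with $\mathbf{x}_i=0$ for $i\notin S$ and whose nonzero entries $\mathbf{x}_i$, $i\in S$, have sign $\sigma_i$. For $\mathbf{y}=A\mathbf{x}$ consider $$\min_{\mathbf{u}}\ \|\mathbf{u}\|_1\quad\text{subject to}\quad A\mathbf{u}=\mathbf{y}.\qquad(\ast)$$ Let $\epsilon_1^{(c)},\epsilon_2^{(c)},\epsilon_1^{(m)},\epsilon_1^{(g)},\epsilon_3^{(g)}>0$ be arbitrarily small constants independent of $n$. (1) Let $\hat\theta_w\in[\beta_w,1]$ be the solution of $$(1-\epsilon_1^{(c)})(1-\beta_w)\frac{\sqrt{2/\pi}\,e^{-(\operatorname{erfinv}(\frac{1-\theta_w}{1-\beta_w}))^2}}{\theta_w}-\sqrt{2}\operatorname{erfinv}\Big((1+\epsilon_1^{(c)})\frac{1-\theta_w}{1-\beta_w}\Big)=0.$$ If $$\alpha>\frac{1-\beta_w}{\sqrt{2\pi}}\left(\sqrt{2\pi}+2\frac{\sqrt{2(\operatorname{erfinv}(\frac{1-\hat\theta_w}{1-\beta_w}))^2}}{e^{(\operatorname{erfinv}(\frac{1-\hat\theta_w}{1-\beta_w}))^2}}-\sqrt{2\pi}\frac{1-\hat\theta_w}{1-\beta_w}\right)+\beta_w-\frac{\left((1-\beta_w)\sqrt{2/\pi}\,e^{-(\operatorname{erfinv}(\frac{1-\hat\theta_w}{1-\beta_w}))^2}\right)^2}{\hat\theta_w},$$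 then with overwhelming probability the solution of $(\ast)$ is the $k$-sparse $\mathbf{x}$. (2) Let $\hat\theta_w\in[\beta_w,1]$ be the solution of $$(1+\epsilon_2^{(c)})(1-\beta_w)\frac{\sqrt{2/\pi}\,e^{-(\operatorname{erfinv}(\frac{1-\theta_w}{1-\beta_w}))^2}}{\theta_w}-\sqrt{2}\operatorname{erfinv}\Big((1-\epsilon_2^{(c)})\frac{1-\theta_w}{1-\beta_w}\Big)=0.$$ If $$\alpha<\frac{1}{(1+\epsilon_1^{(m)})^2}\left((1-\epsilon_1^{(g)})\Big(\hat\theta_w+\frac{2(1-\beta_w)}{\sqrt{2\pi}}\frac{\sqrt{2(\operatorname{erfinv}(\frac{1-\hat\theta_w}{1-\beta_w}))^2}}{e^{(\operatorname{erfinv}(\frac{1-\hat\theta_w}{1-\beta_w}))^2}}\Big)-(1+\epsilon_3^{(g)})^{2}\frac{\left((1-\beta_w)\sqrt{2/\pi}\,e^{-(\operatorname{erfinv}(\frac{1-\hat\theta_w}{1-\beta_w}))^2}\right)^2}{\hat\theta_w}\right),$$ then with overwhelming probability there is a $k$-sparse $\mathbf{x}$ with support in $S$ and sign pattern $\sigma$ that satisfies $A\mathbf{x}=\mathbf{y}$ and is not the solution of $(\ast)$.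
   Context: $\operatorname{erfinv}$ is the inverse of the standard error function $\operatorname{erf}(t)=\frac{2}{\sqrt{\pi}}\int_0^t e^{-s^2}\,ds$. "With overwhelming probability" means with probability at least $1-e^{-cn}$ for some constant $c>0$ independent of $n$ (for all large $n$). "The solution of $(\ast)$ is $\mathbf{x}$" means $\mathbf{x}$ is the unique minimizer of $(\ast)$. *)

theory Defs
  imports "HOL-Probability.Probability"
begin

text \<open>Error function and its inverse (on the open interval (-1,1)).\<close>
definition erf :: "real \<Rightarrow> real" where
  "erf t = 2 / sqrt pi * (LBINT s=0..t. exp (- (s ^ 2)))"

definition erfinv :: "real \<Rightarrow> real" where
  "erfinv y = (THE t. erf t = y)"

definition gauss_mat :: "nat \<Rightarrow> nat \<Rightarrow> (nat \<times> nat \<Rightarrow> real) measure" where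
  "gauss_mat m n = PiM ({..<m} \<times> {..<n}) (\<lambda>_. std_normal_distribution)"

definition vecs :: "nat \<Rightarrow> (nat \<Rightarrow> real) set" where
  "vecs n = {u. \<forall>j. n \<le> j \<longrightarrow> u j = 0}"

definition l1norm :: "nat \<Rightarrow> (nat \<Rightarrow> real) \<Rightarrow> real" where
  "l1norm n u = (\<Sum>j<n. \<bar>u j\<bar>)"

definition matvec :: "nat \<Rightarrow> (nat \<times> nat \<Rightarrow> real) \<Rightarrow> (nat \<Rightarrow> real) \<Rightarrow> nat \<Rightarrow> real" where
  "matvec n A u = (\<lambda>i. \<Sum>j<n. A (i, j) * u j)"

definition unique_l1_min ::
  "nat \<Rightarrow> nat \<Rightarrow> (nat \<times> nat \<Rightarrow> real) \<Rightarrow> (nat \<Rightarrow> real) \<Rightarrow> bool" where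
  "unique_l1_min m n A x \<longleftrightarrow> x \<in> vecs n \<and>
     (\<forall>u \<in> vecs n. u \<noteq> x \<and> (\<forall>i<m. matvec n A u i = matvec n A x i)
        \<longrightarrow> l1norm n x < l1norm n u)"

definition sign_vecs :: "nat set \<Rightarrow> (nat \<Rightarrow> real) \<Rightarrow> (nat \<Rightarrow> real) set" where
  "sign_vecs S \<sigma> = {x. (\<forall>j. j \<notin> S \<longrightarrow> x j = 0) \<and> (\<forall>j\<in>S. sgn (x j) = \<sigma> j)}"

definition eq1 :: "real \<Rightarrow> real \<Rightarrow> real \<Rightarrow> bool" where
  "eq1 \<epsilon> \<beta> \<theta> \<longleftrightarrow>
     \<bar>(1 - \<theta>) / (1 - \<beta>)\<bar> < 1 \<and> \<bar>(1 + \<epsilon>) * ((1 - \<theta>) / (1 - \<beta>))\<bar> < 1 \<and>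
     (1 - \<epsilon>) * (1 - \<beta>) * (sqrt (2 / pi) * exp (- ((erfinv ((1 - \<theta>) / (1 - \<beta>))) ^ 2)) / \<theta>)
       - sqrt 2 * erfinv ((1 + \<epsilon>) * ((1 - \<theta>) / (1 - \<beta>))) = 0"

definition eq2 :: "real \<Rightarrow> real \<Rightarrow> real \<Rightarrow> bool" where
  "eq2 \<epsilon> \<beta> \<theta> \<longleftrightarrow>
     \<bar>(1 - \<theta>) / (1 - \<beta>)\<bar> < 1 \<and> \<bar>(1 - \<epsilon>) * ((1 - \<theta>) / (1 - \<beta>))\<bar> < 1 \<and>
     (1 + \<epsilon>) * (1 - \<beta>) * (sqrt (2 / pi) * exp (- ((erfinv ((1 - \<theta>) / (1 - \<beta>))) ^ 2)) / \<theta>)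
       - sqrt 2 * erfinv ((1 - \<epsilon>) * ((1 - \<theta>) / (1 - \<beta>))) = 0"

definition thr1 :: "real \<Rightarrow> real \<Rightarrow> real" where
  "thr1 \<beta> \<theta> = (let e = erfinv ((1 - \<theta>) / (1 - \<beta>)) in
     (1 - \<beta>) / sqrt (2 * pi) *
       (sqrt (2 * pi) + 2 * sqrt (2 * e ^ 2) / exp (e ^ 2) - sqrt (2 * pi) * ((1 - \<theta>) / (1 - \<beta>)))
     + \<beta> - ((1 - \<beta>) * sqrt (2 / pi) * exp (- (e ^ 2))) ^ 2 / \<theta>)"

definition thr2 :: "real \<Rightarrow> real \<Rightarrow> real \<Rightarrow> real \<Rightarrow> real \<Rightarrow> real" where
  "thr2 \<epsilon>m \<epsilon>g1 \<epsilon>g3 \<beta> \<theta> = (let e = erfinv ((1 - \<theta>) / (1 - \<beta>)) in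
     1 / (1 + \<epsilon>m) ^ 2 *
      ((1 - \<epsilon>g1) * (\<theta> + 2 * (1 - \<beta>) / sqrt (2 * pi) * (sqrt (2 * e ^ 2) / exp (e ^ 2)))
       - (1 + \<epsilon>g3) ^ 2 * ((1 - \<beta>) * sqrt (2 / pi) * exp (- (e ^ 2))) ^ 2 / \<theta>))"

definition overwhelming :: "(nat \<Rightarrow> (nat \<times> nat \<Rightarrow> real) measure) \<Rightarrow> (nat \<Rightarrow> (nat \<times> nat \<Rightarrow> real) \<Rightarrow> bool) \<Rightarrow> bool" where
  "overwhelming M E \<longleftrightarrow> (\<exists>c>0. \<forall>\<^sub>F n in sequentially.
      measure (M n) {A \<in> space (M n). E n A} \<ge> 1 - exp (- c * real n))"

end

theory Submission
  imports Defs
begin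

text \<open>
  Let \<open>D\<close> be the cone of all \<open>w\<close> with \<open>(\<Sum>j\<in>S. \<sigma> j * w j) + (\<Sum>j\<in>-S. \<bar>w j\<bar>) \<le> 0\<close>. Every vector with sign pattern
  \<open>\<sigma>\<close> on \<open>S\<close> is the unique minimizer if and only if the kernel of \<open>A\<close> meets \<open>D\<close> only in \<open>0\<close>, so the
  events of the two parts are complementary. If the kernel meets \<open>D\<close>, some unit vector \<open>w \<in> D\<close> has
  \<open>y \<bullet> A w \<le> 0\<close> for all \<open>y\<close>; if it does not, convex duality gives a unit vector \<open>y\<close> with \<open>y \<bullet> A w \<le> 0\<close> for
  all \<open>w \<in> D\<close>. Gordon's comparison (interpolation between two Gaussian processes and integration by
  parts) replaces the bilinear form by \<open>g \<bullet> y + h \<bullet> w\<close> with independent Gaussian vectors \<open>g\<close> and \<open>h\<close>, so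
  both questions reduce to comparing \<open>\<parallel>g\<parallel>\<close>, about \<open>sqrt (\<alpha> n)\<close>, with the largest \<open>h \<bullet> w\<close> over unit vectors
  \<open>w \<in> D\<close>. That maximum is bounded from above by the distance of \<open>h\<close> to a multiple of the
  subdifferential of the norm, and from below by an explicit thresholded \<open>w\<close>; these bounds are
  controlled by sums of independent variables, to which Chernoff's method applies. With
  \<open>\<tau> = sqrt 2 * erfinv ((1 - \<theta>) / (1 - \<beta>))\<close> as truncation level and
  \<open>\<mu> = (1 - \<beta>) * E (\<bar>g\<bar>; \<bar>g\<bar> > \<tau>) / \<theta>\<close> as multiplier, both squared bounds are about \<open>n\<close> times the
  expression of the theorem with all \<open>\<epsilon>\<close> equal to \<open>0\<close>; the equations for \<open>\<theta>\<close> only serve to order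
  \<open>\<mu>\<close> and \<open>\<tau>\<close>.
\<close>

section \<open>The error function and truncated normal moments\<close>

text \<open>Two obstacles shape the proof. The comparison wants processes with equal variances,
  finite index sets and a smooth test function. On unit vectors the bilinear form has variance 1 and
  its linear substitute variance 2, so an independent scalar is added to the form. Forcing this
  scalar below -1 costs a constant factor, which is paid for by halving the exponent. Spheres are
  replaced by finite nets whose mesh tends to 0 at fixed dimension, so no estimate on nets has to be
  uniform in n. The second obstacle is that norms and quotients are not sums of independent
  variables. Each inequality between them is broken into events saying that a sum of independent
  terms of at most quadratic growth is nonnegative; a negative mean then makes the event
  exponentially rare. Above the threshold one such event is enough. Below it there are four, and for
  the natural multiplier one of them has mean exactly 0, so the multiplier has to be raised
  slightly; the strict inequalities leave room for that. In the failing case the vector y is chosen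
  before w, and the comparison is applied to the transposed matrix.\<close>

abbreviation stdn :: "real measure" where
  "stdn \<equiv> std_normal_distribution"

abbreviation gaussian :: "'r set \<Rightarrow> ('r \<Rightarrow> real) measure" where
  "gaussian R \<equiv> PiM R (\<lambda>_. stdn)"

lemma erf_has_derivative:
  "(erf has_real_derivative 2 / sqrt pi * exp (- (x ^ 2))) (at x)"
proof -
  define b where "b = \<bar>x\<bar> + 1"
  have "((\<lambda>u. LBINT y=ereal 0..ereal u. exp (- (y ^ 2))) has_vector_derivative exp (- (x ^ 2)))
      (at x within {-b..b})"
    by (rule interval_integral_FTC2) (auto simp: b_def intro!: continuous_intros)
  hence "((\<lambda>u. LBINT y=ereal 0..ereal u. exp (- (y ^ 2))) has_real_derivative exp (- (x ^ 2)))
      (at x within {-b..b})"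
    by (simp add: has_real_derivative_iff_has_vector_derivative)
  moreover have "at x within {-b..b} = at x"
    by (rule at_within_interior) (auto simp: b_def interior_atLeastAtMost_real)
  ultimately have "((\<lambda>u. LBINT y=ereal 0..ereal u. exp (- (y ^ 2))) has_real_derivative exp (- (x ^ 2))) (at x)"
    by simp
  from DERIV_cmult[OF this, of "2 / sqrt pi"] show ?thesis
    by (simp add: erf_def[abs_def] zero_ereal_def)
qed

lemma erf_0 [simp]: "erf 0 = 0"
  by (simp add: erf_def zero_ereal_def)

lemma erf_strict_mono: "x < y \<Longrightarrow> erf x < erf y"
  by (rule DERIV_pos_imp_increasing[of x y erf]) (auto intro!: exI erf_has_derivative)

lemma erf_tendsto_1: "(erf \<longlongrightarrow> 1) at_top"
proof -
  let ?f = "\<lambda>x::real. indicator {0..} x *\<^sub>R exp (- x\<^sup>2)"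
  have "((\<lambda>y. \<integral>x. indicator {..y} x *\<^sub>R ?f x \<partial>lborel) \<longlongrightarrow> \<integral>x. ?f x \<partial>lborel) at_top"
    using gaussian_moment_0 by (intro tendsto_integral_at_top) (auto simp: has_bochner_integral_iff)
  hence *: "((\<lambda>y. \<integral>x. indicator {..y} x *\<^sub>R ?f x \<partial>lborel) \<longlongrightarrow> sqrt pi / 2) at_top"
    unfolding has_bochner_integral_integral_eq[OF gaussian_moment_0] .
  have "((\<lambda>y. 2 / sqrt pi * (\<integral>x. indicator {..y} x *\<^sub>R ?f x \<partial>lborel)) \<longlongrightarrow> 2 / sqrt pi * (sqrt pi / 2)) at_top"
    by (intro tendsto_intros *)
  moreover have "\<forall>\<^sub>F y in at_top. 2 / sqrt pi * (\<integral>x. indicator {..y} x *\<^sub>R ?f x \<partial>lborel) = erf y"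
    using eventually_ge_at_top[of 0]
  proof eventually_elim
    case (elim y)
    have "(\<integral>x. indicator {..y} x *\<^sub>R ?f x \<partial>lborel) = (LBINT s=ereal 0..ereal y. exp (- (s ^ 2)))"
      unfolding interval_integral_Icc[OF elim] set_lebesgue_integral_def
      by (intro Bochner_Integration.integral_cong) (auto simp: indicator_def)
    thus ?case by (simp add: erf_def zero_ereal_def)
  qed
  ultimately show ?thesis
    by (auto intro: Lim_transform_eventually)
qed

text \<open>\<open>erfinv\<close> is a definite description. The limit 1 at infinity and the
  intermediate value theorem give existence, strict monotonicity gives uniqueness. Arguments in
  [0,1) are the only ones that occur, since \<theta> lies between \<beta> and 1.\<close>

lemma erf_erfinv:
  assumes "0 \<le> y" "y < 1"
  shows "erf (erfinv y) = y" "0 \<le> erfinv y"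
proof -
  have "\<forall>\<^sub>F x in at_top. y < erf x"
    using erf_tendsto_1 assms(2) by (rule order_tendstoD(1))
  hence "\<forall>\<^sub>F x in at_top. y < erf x \<and> 0 \<le> x"
    using eventually_ge_at_top[of "0::real"] by eventually_elim auto
  then obtain b where b: "y < erf b" "0 \<le> b"
    by (metis (mono_tags, lifting) eventually_at_top_linorder order_refl)
  have "isCont erf x" for x
    using erf_has_derivative DERIV_isCont by blast
  then obtain t where t: "0 \<le> t" "erf t = y"
    using IVT[of erf 0 y b] b assms by auto
  have inj: "t' = t" if "erf t' = y" for t'
    using that t erf_strict_mono[of t t'] erf_strict_mono[of t' t] by (cases t t' rule: linorder_cases) auto
  have "erfinv y = t"
    unfolding erfinv_def by (rule the_equality, rule t(2), rule inj)
  thus "erf (erfinv y) = y" "0 \<le> erfinv y" using t by simp_all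
qed

section \<open>Truncated moments of the standard normal distribution\<close>

lemma std_normal_density_eq: "std_normal_density x = exp (- (x ^ 2) / 2) / sqrt (2 * pi)"
  by (simp add: normal_density_def)

lemma std_normal_density_deriv:
  "(std_normal_density has_real_derivative - (x * std_normal_density x)) (at x)"
proof -
  have "((\<lambda>x. exp (- (x ^ 2) / 2) / sqrt (2 * pi)) has_real_derivative exp (- (x ^ 2) / 2) * (- (2 * x) / 2) / sqrt (2 * pi)) (at x)"
    by (rule DERIV_cdivide) (auto intro!: derivative_eq_intros)
  thus ?thesis unfolding std_normal_density_eq[abs_def] by (simp add: mult_ac)
qed

lemma erf_scaled_deriv:
  "((\<lambda>x. erf (x / sqrt 2) / 2) has_real_derivative std_normal_density x) (at x)"
proof -
  have "((\<lambda>x. erf (x / sqrt 2) / 2) has_real_derivative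
      (2 / sqrt pi * exp (- ((x / sqrt 2) ^ 2))) * (1 / sqrt 2) / 2) (at x)"
    by (rule DERIV_cdivide[OF DERIV_chain2[OF erf_has_derivative DERIV_cdivide[OF DERIV_ident]]])
  also have "(2 / sqrt pi * exp (- ((x / sqrt 2) ^ 2))) * (1 / sqrt 2) / 2 = std_normal_density x"
    by (simp add: std_normal_density_eq power_divide real_sqrt_mult)
  finally show ?thesis .
qed

lemma std_normal_tendsto_0:
  "((\<lambda>x. x ^ k * std_normal_density x) \<longlongrightarrow> 0) at_top"
proof (rule Lim_null_comparison)
  show "((\<lambda>x::real. x ^ k / exp x) \<longlongrightarrow> 0) at_top"
    by (rule tendsto_power_div_exp_0)
  show "\<forall>\<^sub>F x in at_top. norm (x ^ k * std_normal_density x) \<le> x ^ k / exp x"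
    \<comment> \<open>From 2 on, x^2/2 is at least x, so the density is dominated by
      \<open>exp (- x)\<close>.\<close>
    using eventually_ge_at_top[of 2]
  proof eventually_elim
    case (elim x)
    have "exp (- (x ^ 2) / 2) \<le> exp (- x)"
      using elim mult_right_mono[of 2 x x] by (simp add: power2_eq_square)
    moreover have "1 \<le> sqrt (2 * pi)"
      using pi_gt3 by simp
    ultimately have "exp (- (x ^ 2) / 2) / sqrt (2 * pi) \<le> exp (- x) / 1"
      by (intro frac_le) auto
    hence "x ^ k * std_normal_density x \<le> x ^ k * exp (- x)"
      unfolding std_normal_density_eq div_by_1 using elim by (intro mult_left_mono) auto
    moreover have "norm (x ^ k * std_normal_density x) = x ^ k * std_normal_density x"
      using elim by (simp only: real_norm_def) (rule abs_of_nonneg, simp)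
    moreover have "x ^ k * exp (- x) = x ^ k / exp x"
      by (simp add: exp_minus divide_inverse)
    ultimately show ?case by linarith
  qed
qed

lemma erf_scaled_tendsto: "((\<lambda>x. erf (x / sqrt 2) / 2) \<longlongrightarrow> 1 / 2) at_top"
proof -
  have "filterlim (\<lambda>x::real. (1 / sqrt 2) * x) at_top at_top"
    by (rule filterlim_tendsto_pos_mult_at_top[OF tendsto_const]) (auto intro: filterlim_ident)
  hence "filterlim (\<lambda>x::real. x / sqrt 2) at_top at_top" by simp
  from filterlim_compose[OF erf_tendsto_1 this] show ?thesis
    by (intro tendsto_divide) auto
qed

lemma has_bochner_integral_atLeast_FTC:
  fixes f F :: "real \<Rightarrow> real"
  assumes "f \<in> borel_measurable borel" "\<And>x. a \<le> x \<Longrightarrow> (F has_real_derivative f x) (at x)"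
    "\<And>x. a \<le> x \<Longrightarrow> 0 \<le> f x" "(F \<longlongrightarrow> T) at_top"
  shows "has_bochner_integral lborel (\<lambda>x. indicator {a..} x * f x) (T - F a)"
proof (rule has_bochner_integral_nn_integral)
  have *: "(\<integral>\<^sup>+x. ennreal (f x) * indicator {a ..} x \<partial>lborel) = T - F a"
    by (rule nn_integral_FTC_atLeast) (use assms in auto)
  show "(\<integral>\<^sup>+x. ennreal (indicator {a..} x * f x) \<partial>lborel) = ennreal (T - F a)"
    unfolding *[symmetric] by (intro nn_integral_cong) (auto simp: indicator_def)
  have "F a \<le> T"
  proof (rule tendsto_lowerbound[OF assms(4)])
    have "F a \<le> F x" if "a \<le> x" for x
      using that assms by (intro DERIV_nonneg_imp_nondecreasing[of a x F]) auto
    with eventually_ge_at_top[of a] show "\<forall>\<^sub>F x in at_top. F a \<le> F x"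
      by (rule eventually_mono)
  qed auto
  thus "0 \<le> T - F a" by simp
  show "AE x in lborel. 0 \<le> indicator {a..} x * f x"
    using assms(3) by (intro AE_I2) (simp add: indicator_def)
  show "(\<lambda>x. indicator {a..} x * f x) \<in> borel_measurable lborel"
    using assms(1) by simp
qed

text \<open>Evenness halves the work: the two-sided tail is twice a half-line integral. The half
  line is closed at \<tau> while the tail is strict, which changes only a null set.\<close>

lemma even_tail_integral:
  fixes f :: "real \<Rightarrow> real"
  assumes "0 \<le> \<tau>" "f \<in> borel_measurable borel"
    "has_bochner_integral lborel (\<lambda>x. indicator {\<tau>..} x * (std_normal_density x * f x)) I"
    "\<And>x. f (- x) = f x"
  shows "has_bochner_integral stdn (\<lambda>x. f x * indicator {x. \<tau> < \<bar>x\<bar>} x) (2 * I)"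
proof -
  let ?g = "\<lambda>x. indicator {x. \<tau> < \<bar>x\<bar>} x * (std_normal_density x * f x)"
  have "has_bochner_integral lborel (\<lambda>x. indicator {0..} x *\<^sub>R ?g x) I"
  proof (rule has_bochner_integralI_AE[OF assms(3)])
    show "AE x in lborel. indicator {\<tau>..} x * (std_normal_density x * f x) = indicator {0..} x *\<^sub>R ?g x"
      using AE_lborel_singleton[of \<tau>] by eventually_elim (use assms(1) in \<open>auto simp: indicator_def\<close>)
  qed (use assms(2) in measurable)
  from has_bochner_integral_even_function[OF this]
  have "has_bochner_integral lborel ?g (2 * I)"
    using assms(4) by (simp add: std_normal_density_eq indicator_def)
  hence "has_bochner_integral lborel (\<lambda>x. std_normal_density x *\<^sub>R (f x * indicator {x. \<tau> < \<bar>x\<bar>} x)) (2 * I)"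
    by (simp add: mult_ac)
  thus ?thesis
    using assms(2) by (intro has_bochner_integral_density) auto
qed

text \<open>The densities 1, x and x^2 times the normal density have the antiderivatives
  \<open>erf (x / sqrt 2) / 2\<close>, minus the density, and their combination
  \<open>erf (x / sqrt 2) / 2 - x * std_normal_density x\<close>.\<close>

lemma normal_tail_moments:
  assumes "0 \<le> \<tau>"
  shows "has_bochner_integral stdn (\<lambda>x. indicator {x. \<tau> < \<bar>x\<bar>} x) (1 - erf (\<tau> / sqrt 2))"
    and "has_bochner_integral stdn (\<lambda>x. \<bar>x\<bar> * indicator {x. \<tau> < \<bar>x\<bar>} x) (2 * std_normal_density \<tau>)"
    and "has_bochner_integral stdn (\<lambda>x. x\<^sup>2 * indicator {x. \<tau> < \<bar>x\<bar>} x)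
      (1 - erf (\<tau> / sqrt 2) + 2 * \<tau> * std_normal_density \<tau>)"
proof -
  have "has_bochner_integral lborel (\<lambda>x. indicator {\<tau>..} x * std_normal_density x) (1/2 - erf (\<tau> / sqrt 2) / 2)"
    by (rule has_bochner_integral_atLeast_FTC[where F = "\<lambda>x. erf (x / sqrt 2) / 2"])
       (auto intro!: erf_scaled_deriv erf_scaled_tendsto)
  with even_tail_integral[OF assms, of "\<lambda>_. 1" "1/2 - erf (\<tau> / sqrt 2) / 2"]
  show "has_bochner_integral stdn (\<lambda>x. indicator {x. \<tau> < \<bar>x\<bar>} x) (1 - erf (\<tau> / sqrt 2))"
    by (simp add: algebra_simps)
  have d0: "((\<lambda>x. - std_normal_density x) has_real_derivative std_normal_density x * x) (at x)" for x
    using DERIV_minus[OF std_normal_density_deriv] by (simp add: mult_ac)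
  have l0: "((\<lambda>x. - std_normal_density x) \<longlongrightarrow> 0) at_top"
    using tendsto_minus[OF std_normal_tendsto_0[of 0]] by simp
  have "has_bochner_integral lborel (\<lambda>x. indicator {\<tau>..} x * (std_normal_density x * x)) (0 - (- std_normal_density \<tau>))"
    by (rule has_bochner_integral_atLeast_FTC[where F = "\<lambda>x. - std_normal_density x"])
       (use assms d0 l0 in auto)
  also have "(\<lambda>x. indicator {\<tau>..} x * (std_normal_density x * x)) = (\<lambda>x. indicator {\<tau>..} x * (std_normal_density x * \<bar>x\<bar>))"
    using assms by (auto simp: indicator_def)
  finally show "has_bochner_integral stdn (\<lambda>x. \<bar>x\<bar> * indicator {x. \<tau> < \<bar>x\<bar>} x) (2 * std_normal_density \<tau>)"
    using even_tail_integral[OF assms, of "\<lambda>x. \<bar>x\<bar>"] by simp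
  have d: "((\<lambda>x. erf (x / sqrt 2) / 2 - x * std_normal_density x) has_real_derivative
      std_normal_density x * x\<^sup>2) (at x)" for x
    using DERIV_diff[OF erf_scaled_deriv DERIV_mult[OF DERIV_ident std_normal_density_deriv]]
    by (simp add: power2_eq_square mult_ac)
  have l: "((\<lambda>x. erf (x / sqrt 2) / 2 - x * std_normal_density x) \<longlongrightarrow> 1 / 2) at_top"
    using tendsto_diff[OF erf_scaled_tendsto std_normal_tendsto_0[of 1]] by simp
  have "has_bochner_integral lborel (\<lambda>x. indicator {\<tau>..} x * (std_normal_density x * x\<^sup>2))
    (1/2 - (erf (\<tau> / sqrt 2) / 2 - \<tau> * std_normal_density \<tau>))"
    by (rule has_bochner_integral_atLeast_FTC[where F = "\<lambda>x. erf (x / sqrt 2) / 2 - x * std_normal_density x"])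
       (auto intro!: d l)
  from even_tail_integral[OF assms _ this]
  show "has_bochner_integral stdn (\<lambda>x. x\<^sup>2 * indicator {x. \<tau> < \<bar>x\<bar>} x)
      (1 - erf (\<tau> / sqrt 2) + 2 * \<tau> * std_normal_density \<tau>)"
    by (simp add: algebra_simps)
qed

section \<open>Exponential tail bounds\<close>

lemma prob_space_stdn: "prob_space stdn"
  by (rule prob_space_normal_density) simp

lemma product_prob_space_stdn: "product_prob_space (\<lambda>_. stdn)"
  by (simp add: product_prob_space_def product_prob_space_axioms_def product_sigma_finite_def
      prob_space_stdn prob_space_imp_sigma_finite)

lemma stdn_integrable_abs_power: "integrable stdn (\<lambda>x. \<bar>x\<bar> ^ k)"
  using integrable_std_normal_moment_abs[of k]
  by (subst integrable_density) (auto simp: integrable_density)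

lemma stdn_integrable_exp_square:
  assumes "b < 1 / 2"
  shows "integrable stdn (\<lambda>x. exp (b * x\<^sup>2))"
proof -
  define \<sigma> where "\<sigma> = 1 / sqrt (1 - 2 * b)"
  have \<sigma>: "\<sigma> > 0" "\<sigma>\<^sup>2 = 1 / (1 - 2 * b)" using assms by (auto simp: \<sigma>_def power_divide)
  have "integrable lborel (\<lambda>x. \<sigma> * normal_density 0 \<sigma> x)"
    using \<sigma>(1) by (intro integrable_mult_right) (rule integrable_normal_density)
  also have "(\<lambda>x. \<sigma> * normal_density 0 \<sigma> x) = (\<lambda>x. std_normal_density x * exp (b * x\<^sup>2))"
  proof
    fix x
    have "- x\<^sup>2 / 2 + b * x\<^sup>2 = - x\<^sup>2 / (2 * \<sigma>\<^sup>2)"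
      using assms by (simp add: \<sigma>(2) field_simps)
    hence "exp (- x\<^sup>2 / 2) * exp (b * x\<^sup>2) = exp (- x\<^sup>2 / (2 * \<sigma>\<^sup>2))"
      by (simp only: exp_add[symmetric])
    thus "\<sigma> * normal_density 0 \<sigma> x = std_normal_density x * exp (b * x\<^sup>2)"
      using \<sigma>(1) by (simp add: normal_density_def real_sqrt_mult)
  qed
  finally show ?thesis by (subst integrable_density) auto
qed

text \<open>Taylor's formula with Lagrange remainder. Leaving the linear term exact is what makes
  the mean appear in the moment generating function.\<close>

lemma exp_le_quadratic: "exp (x::real) \<le> 1 + x + x\<^sup>2 * exp \<bar>x\<bar>"
proof -
  obtain t where t: "\<bar>t\<bar> \<le> \<bar>x\<bar>" "exp x = (\<Sum>m<2. x ^ m / fact m) + (exp t / fact 2) * x ^ 2"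
    using Maclaurin_exp_le[of x 2] by blast
  have "exp t / 2 * x\<^sup>2 \<le> exp \<bar>x\<bar> * x\<^sup>2"
  proof (intro mult_right_mono)
    have "exp t \<le> exp \<bar>x\<bar>" using t(1) by simp
    moreover have "0 < exp \<bar>x\<bar>" by simp
    ultimately show "exp t / 2 \<le> exp \<bar>x\<bar>" by linarith
  qed simp
  thus ?thesis using t(2) by (simp add: numeral_2_eq_2 mult_ac)
qed

text \<open>\<open>K\<close> and \<open>s0\<close> depend on the growth constant \<open>a\<close>
  alone, so one choice serves every summand of every sum to which Chernoff's method is
  applied.\<close>

lemma stdn_mgf_bound:
  assumes "0 < a"
  obtains K s0 where "0 < K" "0 < s0"
    "\<And>q s. q \<in> borel_measurable borel \<Longrightarrow> (\<And>x. \<bar>q x\<bar> \<le> a * (1 + x\<^sup>2)) \<Longrightarrow> 0 \<le> s \<Longrightarrow> s \<le> s0 \<Longrightarrow>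
       integrable stdn (\<lambda>x. exp (s * q x)) \<and>
       (\<integral>x. exp (s * q x) \<partial>stdn) \<le> exp (s * (\<integral>x. q x \<partial>stdn) + K * s\<^sup>2)"
proof -
  interpret prob_space stdn by (rule prob_space_stdn)
  \<comment> \<open>Chosen so that \<open>\<bar>s * q x\<bar>\<close> is at most (1 +
    x^2)/8.\<close>
  define s0 where "s0 = 1 / (8 * a)"
  \<comment> \<open>A common bound for \<open>(q x)\<^sup>2 * exp \<bar>s * q x\<bar>\<close>. By
    y^2 \<le> 4 exp y each of the two factors contributes the rate 1/8; the total 1/4 stays below
    the integrability limit 1/2.\<close>
  define W where "W = (\<lambda>x::real. (16 * a)\<^sup>2 * exp (1 / 4) * exp ((1/4) * x\<^sup>2))"
  have s0: "0 < s0" "s0 * a = 1 / 8" using assms by (auto simp: s0_def)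
  have W: "integrable stdn W"
    unfolding W_def by (intro integrable_mult_right stdn_integrable_exp_square) simp
  define K where "K = (\<integral>x. W x \<partial>stdn) + 1"
  have "0 \<le> (\<integral>x. W x \<partial>stdn)" by (intro integral_nonneg_AE) (simp add: W_def)
  hence K: "0 < K" by (simp add: K_def)
  have main: "integrable stdn (\<lambda>x. exp (s * q x)) \<and>
       (\<integral>x. exp (s * q x) \<partial>stdn) \<le> exp (s * (\<integral>x. q x \<partial>stdn) + K * s\<^sup>2)"
    if q: "q \<in> borel_measurable borel" "\<And>x. \<bar>q x\<bar> \<le> a * (1 + x\<^sup>2)" "0 \<le> s" "s \<le> s0" for q s
  proof
    note [measurable] = q(1)
    have b1: "\<bar>s * q x\<bar> \<le> (1 + x\<^sup>2) / 8" for x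
    proof -
      have "\<bar>s * q x\<bar> \<le> s0 * (a * (1 + x\<^sup>2))"
        unfolding abs_mult using q by (intro mult_mono) auto
      thus ?thesis using s0(2) by (simp add: mult.assoc[symmetric])
    qed
    have iq: "integrable stdn q"
    proof (rule Bochner_Integration.integrable_bound)
      show "integrable stdn (\<lambda>x. a * (1 + \<bar>x\<bar> ^ 2))"
        using stdn_integrable_abs_power[of 2] by (intro integrable_mult_right Bochner_Integration.integrable_add) auto
    qed (use q(2) in \<open>auto intro!: AE_I2 order_trans[OF q(2)]\<close>)
    have pw: "exp (s * q x) \<le> 1 + s * q x + s\<^sup>2 * W x" for x
    proof -
      have "(q x)\<^sup>2 \<le> (a * (1 + x\<^sup>2))\<^sup>2" using q(2)[of x] by (rule abs_le_square_iff[THEN iffD1, OF order_trans]) simp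
      also have "\<dots> = (8 * a)\<^sup>2 * ((1 + x\<^sup>2) / 8)\<^sup>2" by (simp add: power_mult_distrib power_divide)
      also have "\<dots> \<le> (8 * a)\<^sup>2 * (4 * exp ((1 + x\<^sup>2) / 8))"
      proof (intro mult_left_mono)
        define y where "y = (1 + x\<^sup>2) / 8"
        have "0 \<le> y" by (simp add: y_def)
        have "(1 + y/2)\<^sup>2 \<le> exp (y/2) ^ 2" using \<open>0 \<le> y\<close> by (intro power_mono exp_ge_add_one_self) auto
        also have "\<dots> = exp y" by (simp add: exp_double[symmetric])
        finally have "(1 + y/2)\<^sup>2 \<le> exp y" .
        moreover have "y\<^sup>2 \<le> 4 * (1 + y/2)\<^sup>2" using \<open>0 \<le> y\<close> by (simp add: power2_eq_square algebra_simps)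
        ultimately have "y\<^sup>2 \<le> 4 * exp y" by linarith
        thus "((1 + x\<^sup>2) / 8)\<^sup>2 \<le> 4 * exp ((1 + x\<^sup>2) / 8)" by (simp only: y_def)
      qed auto
      finally have "(q x)\<^sup>2 * exp \<bar>s * q x\<bar> \<le> ((8 * a)\<^sup>2 * (4 * exp ((1 + x\<^sup>2) / 8))) * exp ((1 + x\<^sup>2) / 8)"
        using b1[of x] by (intro mult_mono) auto
      also have "\<dots> = (16 * a)\<^sup>2 * exp (1/4 + (1/4) * x\<^sup>2)"
        unfolding mult.assoc exp_add[symmetric] by (simp add: power2_eq_square add_divide_distrib)
      also have "\<dots> = W x" unfolding W_def exp_add by simp
      finally have "s\<^sup>2 * ((q x)\<^sup>2 * exp \<bar>s * q x\<bar>) \<le> s\<^sup>2 * W x" by (intro mult_left_mono) auto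
      with exp_le_quadratic[of "s * q x"] show ?thesis by (simp add: power_mult_distrib mult_ac)
    qed
    show i: "integrable stdn (\<lambda>x. exp (s * q x))"
    proof (rule Bochner_Integration.integrable_bound)
      show "integrable stdn (\<lambda>x. 1 + s * q x + s\<^sup>2 * W x)" using iq W by simp
    qed (use pw in \<open>auto intro!: AE_I2 intro: order_trans[OF _ abs_ge_self]\<close>)
    have "(\<integral>x. exp (s * q x) \<partial>stdn) \<le> (\<integral>x. 1 + s * q x + s\<^sup>2 * W x \<partial>stdn)"
      using i iq W pw by (intro integral_mono) auto
    also have "\<dots> = 1 + s * (\<integral>x. q x \<partial>stdn) + s\<^sup>2 * (\<integral>x. W x \<partial>stdn)"
      using iq W prob_space by simp
    also have "\<dots> \<le> 1 + (s * (\<integral>x. q x \<partial>stdn) + K * s\<^sup>2)"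
      by (simp add: K_def algebra_simps)
    also have "\<dots> \<le> exp (s * (\<integral>x. q x \<partial>stdn) + K * s\<^sup>2)"
      by (rule exp_ge_add_one_self)
    finally show "(\<integral>x. exp (s * q x) \<partial>stdn) \<le> exp (s * (\<integral>x. q x \<partial>stdn) + K * s\<^sup>2)" .
  qed
  show ?thesis by (rule that[OF K s0(1)]) (use main in blast)+
qed

text \<open>Markov's inequality for the exponential of \<open>s\<close> times the sum. The rate
  \<open>c\<close> is fixed before the index set, the summands and \<open>N\<close>, which is what
  later yields one exponent for all dimensions.\<close>

lemma stdn_chernoff:
  assumes "0 < a" "0 < \<delta>" "0 < L"
  obtains c where "0 < c"
    "\<And>(R :: 'r set) q N. finite R \<Longrightarrow> (\<And>r. r \<in> R \<Longrightarrow> q r \<in> borel_measurable borel) \<Longrightarrow>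
      (\<And>r x. r \<in> R \<Longrightarrow> \<bar>q r x\<bar> \<le> a * (1 + x\<^sup>2)) \<Longrightarrow> real (card R) \<le> L * N \<Longrightarrow>
      (\<Sum>r\<in>R. \<integral>x. q r x \<partial>stdn) \<le> - \<delta> * N \<Longrightarrow>
      measure (gaussian R)
        {\<omega> \<in> space (gaussian R). 0 \<le> (\<Sum>r\<in>R. q r (\<omega> r))} \<le> exp (- c * N)"
proof -
  obtain K s0 where K: "0 < K" "0 < s0"
    "\<And>q s. q \<in> borel_measurable borel \<Longrightarrow> (\<And>x. \<bar>q x\<bar> \<le> a * (1 + x\<^sup>2)) \<Longrightarrow> 0 \<le> s \<Longrightarrow> s \<le> s0 \<Longrightarrow>
       integrable stdn (\<lambda>x. exp (s * q x)) \<and>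
       (\<integral>x. exp (s * q x) \<partial>stdn) \<le> exp (s * (\<integral>x. q x \<partial>stdn) + K * s\<^sup>2)"
    using stdn_mgf_bound[OF assms(1)] by blast
  \<comment> \<open>Small enough that the second order term \<open>K * s\<^sup>2 * L * N\<close>
    uses up at most half of the drift \<open>s * \<delta> * N\<close>.\<close>
  define s where "s = min s0 (\<delta> / (2 * K * L))"
  have s: "0 < s" "s \<le> s0" using assms K by (auto simp: s_def)
  have "s * (K * L) \<le> (\<delta> / (2 * K * L)) * (K * L)"
    using assms K by (intro mult_right_mono) (auto simp: s_def)
  hence s2: "s * (K * L) \<le> \<delta> / 2" using assms K by (simp add: field_simps)
  have main: "measure (gaussian R)
        {\<omega> \<in> space (gaussian R). 0 \<le> (\<Sum>r\<in>R. q r (\<omega> r))} \<le> exp (- (s * \<delta> / 2) * N)"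
    if R: "finite R" "\<And>r. r \<in> R \<Longrightarrow> q r \<in> borel_measurable borel"
      "\<And>r x. r \<in> R \<Longrightarrow> \<bar>q r x\<bar> \<le> a * (1 + x\<^sup>2)" "real (card R) \<le> L * N"
      "(\<Sum>r\<in>R. \<integral>x. q r x \<partial>stdn) \<le> - \<delta> * N" for R :: "'r set" and q N
  proof -
    interpret product_prob_space "\<lambda>_. stdn" R by (rule product_prob_space_stdn)
    let ?M = "gaussian R"
    have N: "0 \<le> N" using R(4) assms(3) by (metis of_nat_0_le_iff order_trans zero_le_mult_iff not_less)
    have int: "integrable ?M (\<lambda>\<omega>. \<Prod>r\<in>R. exp (s * q r (\<omega> r)))"
      using K(3)[OF R(2,3), of _ s] s R(1) by (intro product_integrable_prod) auto
    have "measure ?M {\<omega> \<in> space ?M. 0 \<le> (\<Sum>r\<in>R. q r (\<omega> r))}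
        \<le> measure ?M {\<omega> \<in> space ?M. 1 \<le> (\<Prod>r\<in>R. exp (s * q r (\<omega> r)))}"
    proof (rule finite_measure_mono)
      show "{\<omega> \<in> space ?M. 0 \<le> (\<Sum>r\<in>R. q r (\<omega> r))} \<subseteq> {\<omega> \<in> space ?M. 1 \<le> (\<Prod>r\<in>R. exp (s * q r (\<omega> r)))}"
        using s(1) R(1) by (auto simp: exp_sum[symmetric] sum_distrib_left[symmetric])
    qed (use int in measurable)
    also have "\<dots> \<le> (\<integral>\<omega>. (\<Prod>r\<in>R. exp (s * q r (\<omega> r))) \<partial>?M) / 1"
      using int by (intro integral_Markov_inequality_measure[where A = "{}"]) (auto intro!: prod_nonneg)
    also have "\<dots> = (\<Prod>r\<in>R. \<integral>x. exp (s * q r x) \<partial>stdn)"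
      using K(3)[OF R(2,3), of _ s] s R(1) by (subst product_integral_prod) auto
    also have "\<dots> \<le> (\<Prod>r\<in>R. exp (s * (\<integral>x. q r x \<partial>stdn) + K * s\<^sup>2))"
      using K(3)[OF R(2,3), of _ s] s by (intro prod_mono) (auto intro!: integral_nonneg_AE)
    also have "\<dots> = exp (s * (\<Sum>r\<in>R. \<integral>x. q r x \<partial>stdn) + K * s\<^sup>2 * card R)"
      using R(1) by (simp add: exp_sum[symmetric] sum.distrib sum_distrib_left)
    also have "\<dots> \<le> exp (s * (- \<delta> * N) + K * s\<^sup>2 * (L * N))"
      unfolding exp_le_cancel_iff using s(1) K(1) R(4,5) by (intro add_mono mult_left_mono) auto
    also have "\<dots> \<le> exp (- (s * \<delta> / 2) * N)"
    proof -
      have "(s * N) * (s * (K * L)) \<le> (s * N) * (\<delta> / 2)" using s2 s N by (intro mult_left_mono) auto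
      thus ?thesis by (simp add: power2_eq_square algebra_simps)
    qed
    finally show ?thesis .
  qed
  show ?thesis by (rule that[of "s * \<delta> / 2"]) (use s assms main in auto)
qed

section \<open>Gaussian integration by parts\<close>

text \<open>The density has derivative -x times itself, so h times the density is an antiderivative
  of the difference of the two integrands. It vanishes at both ends because h is bounded.\<close>

lemma stein_identity:
  fixes h h' :: "real \<Rightarrow> real"
  assumes h: "\<And>x. (h has_real_derivative h' x) (at x)"
    and bound: "\<And>x. \<bar>h x\<bar> \<le> B" "\<And>x. \<bar>h' x\<bar> \<le> B"
    and cont: "\<And>x. isCont h' x"
  shows "(\<integral>x. x * h x \<partial>stdn) = (\<integral>x. h' x \<partial>stdn)"
proof -
  interpret prob_space stdn by (rule prob_space_stdn)
  have conth: "isCont h x" for x using h DERIV_isCont by blast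
  have [measurable]: "h \<in> borel_measurable borel" "h' \<in> borel_measurable borel"
    using conth cont by (auto intro!: borel_measurable_continuous_onI continuous_at_imp_continuous_on)
  have B: "0 \<le> B" using bound(1)[of 0] by linarith
  have i1: "integrable lborel (\<lambda>x. std_normal_density x * h' x)"
  proof (rule Bochner_Integration.integrable_bound)
    show "integrable lborel (\<lambda>x. B * std_normal_density x)" by (simp add: integrable_normal_density)
  qed (use bound B in \<open>auto intro!: AE_I2 mult_left_mono simp: abs_mult mult.commute[of B]\<close>)
  have i2: "integrable lborel (\<lambda>x. std_normal_density x * (x * h x))"
  proof (rule Bochner_Integration.integrable_bound)
    show "integrable lborel (\<lambda>x. B * (std_normal_density x * \<bar>x\<bar> ^ 1))"
      by (intro integrable_mult_right integrable_std_normal_moment_abs)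
    show "AE x in lborel. norm (std_normal_density x * (x * h x)) \<le> norm (B * (std_normal_density x * \<bar>x\<bar> ^ 1))"
    proof (rule AE_I2)
      fix x :: real
      have "std_normal_density x * \<bar>x\<bar> * \<bar>h x\<bar> \<le> std_normal_density x * \<bar>x\<bar> * B"
        using bound by (intro mult_left_mono) auto
      thus "norm (std_normal_density x * (x * h x)) \<le> norm (B * (std_normal_density x * \<bar>x\<bar> ^ 1))"
        using B by (simp add: abs_mult mult_ac)
    qed
  qed measurable
  let ?F = "\<lambda>x. h x * std_normal_density x"
  have lim0: "(std_normal_density \<longlongrightarrow> 0) at_top"
    using std_normal_tendsto_0[of 0] by simp
  have lim0': "(std_normal_density \<longlongrightarrow> 0) at_bot"
    using lim0 by (subst filterlim_at_bot_mirror) (simp add: std_normal_density_eq[abs_def])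
  have limF: "(?F \<longlongrightarrow> 0) G" if "(std_normal_density \<longlongrightarrow> 0) G" for G
  proof (rule Lim_null_comparison)
    show "((\<lambda>x. B * std_normal_density x) \<longlongrightarrow> 0) G" using tendsto_mult_right_zero[OF that] by simp
  qed (use bound in \<open>auto intro!: always_eventually mult_right_mono simp: abs_mult\<close>)
  have "(LBINT x=-\<infinity>..\<infinity>. std_normal_density x * h' x - std_normal_density x * (x * h x)) = 0 - 0"
  proof (rule interval_integral_FTC_integrable)
    show "(?F has_vector_derivative std_normal_density x * h' x - std_normal_density x * (x * h x)) (at x)" for x
      using DERIV_mult[OF h std_normal_density_deriv]
      by (simp add: has_real_derivative_iff_has_vector_derivative[symmetric] algebra_simps)
    show "isCont (\<lambda>x. std_normal_density x * h' x - std_normal_density x * (x * h x)) x" for x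
      using conth cont DERIV_isCont[OF std_normal_density_deriv] by (intro continuous_intros) auto
    show "set_integrable lborel (einterval (- \<infinity>) \<infinity>) (\<lambda>x. std_normal_density x * h' x - std_normal_density x * (x * h x))"
      using i1 i2 by (simp add: set_integrable_def einterval_def)
  qed (auto simp: ereal_tendsto_simps intro: limF lim0 lim0')
  hence "(\<integral>x. std_normal_density x * h' x - std_normal_density x * (x * h x) \<partial>lborel) = 0"
    by (simp add: interval_lebesgue_integral_def set_lebesgue_integral_def einterval_def)
  hence "(\<integral>x. std_normal_density x * h' x \<partial>lborel) = (\<integral>x. std_normal_density x * (x * h x) \<partial>lborel)"
    using i1 i2 by simp
  thus ?thesis by (simp add: integral_density)
qed

lemma integrable_PiM_stdn_component:
  assumes "r \<in> R"
  shows "integrable (gaussian R) (\<lambda>\<omega>. \<bar>\<omega> r\<bar>)"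
proof -
  interpret product_prob_space "\<lambda>_. stdn" R by (rule product_prob_space_stdn)
  have "integrable (distr (gaussian R) stdn (\<lambda>\<omega>. \<omega> r)) (\<lambda>x. \<bar>x\<bar> ^ 1)"
    using assms stdn_integrable_abs_power[of 1] by (subst PiM_component) auto
  thus ?thesis using assms by (subst (asm) integrable_distr_eq) auto
qed

text \<open>Fubini freezes all coordinates except \<open>r\<close>, and the one-dimensional identity
  applies to the remaining variable.\<close>

lemma stein_identity_PiM:
  fixes H H' :: "('r \<Rightarrow> real) \<Rightarrow> real"
  assumes R: "finite R" "r \<in> R"
    and meas: "H \<in> borel_measurable (gaussian R)"
      "H' \<in> borel_measurable (gaussian R)"
    and deriv: "\<And>x y. ((\<lambda>y. H (x(r := y))) has_real_derivative H' (x(r := y))) (at y)"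
    and cont: "\<And>x y. isCont (\<lambda>y. H' (x(r := y))) y"
    and bound: "\<And>x. \<bar>H x\<bar> \<le> B" "\<And>x. \<bar>H' x\<bar> \<le> B"
  shows "(\<integral>\<omega>. \<omega> r * H \<omega> \<partial>gaussian R) = (\<integral>\<omega>. H' \<omega> \<partial>gaussian R)"
proof -
  interpret product_prob_space "\<lambda>_. stdn" R by (rule product_prob_space_stdn)
  define I where "I = R - {r}"
  have I: "finite I" "r \<notin> I" and RI: "R = insert r I" using R by (auto simp: I_def)
  note [measurable] = meas
  have B: "0 \<le> B" using bound(1)[of undefined] by linarith
  have iH': "integrable (gaussian R) H'"
    by (rule P.integrable_const_bound[where B = B]) (use bound in auto)
  have iH: "integrable (gaussian R) (\<lambda>\<omega>. \<omega> r * H \<omega>)"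
  proof (rule Bochner_Integration.integrable_bound)
    show "integrable (gaussian R) (\<lambda>\<omega>. B * \<bar>\<omega> r\<bar>)"
      by (intro integrable_mult_right integrable_PiM_stdn_component R)
    have [measurable]: "(\<lambda>\<omega>. \<omega> r) \<in> borel_measurable (gaussian R)"
      using measurable_component_singleton[OF R(2), of "\<lambda>_. stdn"] by simp
    show "(\<lambda>\<omega>. \<omega> r * H \<omega>) \<in> borel_measurable (gaussian R)" by measurable
  qed (use bound B in \<open>auto intro!: AE_I2 mult_left_mono simp: abs_mult mult.commute[of B]\<close>)
  have "(\<integral>\<omega>. \<omega> r * H \<omega> \<partial>gaussian R) =
     (\<integral>x. (\<integral>y. y * H (x(r := y)) \<partial>stdn) \<partial>gaussian I)"
    unfolding RI using product_integral_insert[OF I, of "\<lambda>\<omega>. \<omega> r * H \<omega>"] iH RI by simp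
  also have "\<dots> = (\<integral>x. (\<integral>y. H' (x(r := y)) \<partial>stdn) \<partial>gaussian I)"
    by (intro Bochner_Integration.integral_cong refl stein_identity[where B = B])
       (use deriv cont bound in auto)
  also have "\<dots> = (\<integral>\<omega>. H' \<omega> \<partial>gaussian R)"
    unfolding RI using product_integral_insert[OF I, of H'] iH' RI by simp
  finally show ?thesis .
qed

section \<open>Interpolation between two Gaussian processes\<close>

lemma DERIV_integral_dominated:
  fixes f f' :: "real \<Rightarrow> 'a \<Rightarrow> real"
  assumes f: "\<And>t. integrable M (f t)"
    and f': "\<And>t. f' t \<in> borel_measurable M"
    and deriv: "\<And>t \<omega>. \<omega> \<in> space M \<Longrightarrow> ((\<lambda>t. f t \<omega>) has_real_derivative f' t \<omega>) (at t)"
    and g: "\<And>t \<omega>. \<omega> \<in> space M \<Longrightarrow> \<bar>f' t \<omega>\<bar> \<le> g \<omega>" "integrable M g"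
  shows "((\<lambda>t. \<integral>\<omega>. f t \<omega> \<partial>M) has_real_derivative (\<integral>\<omega>. f' t \<omega> \<partial>M)) (at t)"
  unfolding DERIV_def tendsto_at_iff_sequentially
proof (intro allI impI)
  fix X :: "nat \<Rightarrow> real"
  assume X: "\<forall>i. X i \<in> UNIV - {0}" "X \<longlonglongrightarrow> 0"
  have "(\<lambda>i. \<integral>\<omega>. (f (t + X i) \<omega> - f t \<omega>) / X i \<partial>M) \<longlonglongrightarrow> (\<integral>\<omega>. f' t \<omega> \<partial>M)"
  proof (rule integral_dominated_convergence)
    show "(\<lambda>\<omega>. (f (t + X i) \<omega> - f t \<omega>) / X i) \<in> borel_measurable M" for i
      using f by (intro borel_measurable_divide borel_measurable_diff) auto
    show "AE \<omega> in M. (\<lambda>i. (f (t + X i) \<omega> - f t \<omega>) / X i) \<longlonglongrightarrow> f' t \<omega>"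
    proof (rule AE_I2)
      fix \<omega> assume "\<omega> \<in> space M"
      from deriv[OF this, of t] show "(\<lambda>i. (f (t + X i) \<omega> - f t \<omega>) / X i) \<longlonglongrightarrow> f' t \<omega>"
        unfolding DERIV_def tendsto_at_iff_sequentially using X by (simp add: o_def)
    qed
    show "AE \<omega> in M. norm ((f (t + X i) \<omega> - f t \<omega>) / X i) \<le> g \<omega>" for i
    proof (rule AE_I2)
      fix \<omega> assume \<omega>: "\<omega> \<in> space M"
      have "norm (f (t + X i) \<omega> - f t \<omega>) \<le> g \<omega> * norm (t + X i - t)"
        by (rule field_differentiable_bound[of UNIV "\<lambda>t. f t \<omega>" "\<lambda>t. f' t \<omega>"])
           (use deriv[OF \<omega>] g(1)[OF \<omega>] in auto)
      thus "norm ((f (t + X i) \<omega> - f t \<omega>) / X i) \<le> g \<omega>"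
        using X(1) by (simp add: abs_divide divide_le_eq)
    qed
  qed (use f' g in auto)
  thus "((\<lambda>h. ((\<integral>\<omega>. f (t + h) \<omega> \<partial>M) - (\<integral>\<omega>. f t \<omega> \<partial>M)) / h) \<circ> X) \<longlonglongrightarrow> (\<integral>\<omega>. f' t \<omega> \<partial>M)"
    using f by (simp add: o_def)
qed

text \<open>Along the rotation from one process to the other, integration by parts turns the
  derivative of the expectation into a sum of mixed second derivatives weighted by covariance
  differences, and \<open>sign\<close> makes each summand nonpositive. The gradient
  \<open>F1\<close> and the Hessian \<open>F2\<close> enter only through chain rules along curves,
  so no multivariate calculus is needed.\<close>

lemma gaussian_interpolation:
  fixes T :: "'p set" and R :: "'r set" and c d :: "'p \<Rightarrow> 'r \<Rightarrow> real" and F :: "('p \<Rightarrow> real) \<Rightarrow> real"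
    and F1 :: "'p \<Rightarrow> ('p \<Rightarrow> real) \<Rightarrow> real" and F2 :: "'p \<Rightarrow> 'p \<Rightarrow> ('p \<Rightarrow> real) \<Rightarrow> real"
  defines "M \<equiv> gaussian R"
  assumes fin: "finite T" "finite R"
    and orth: "\<And>p q. p \<in> T \<Longrightarrow> q \<in> T \<Longrightarrow> (\<Sum>r\<in>R. c p r * d q r) = 0"
    and chain: "\<And>Z Z' t. (\<And>p. p \<in> T \<Longrightarrow> (Z p has_real_derivative Z' p) (at t)) \<Longrightarrow>
        ((\<lambda>t. F (\<lambda>p. Z p t)) has_real_derivative (\<Sum>p\<in>T. F1 p (\<lambda>p. Z p t) * Z' p)) (at t)"
    and chain1: "\<And>q Z Z' t. q \<in> T \<Longrightarrow> (\<And>p. p \<in> T \<Longrightarrow> (Z p has_real_derivative Z' p) (at t)) \<Longrightarrow>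
        ((\<lambda>t. F1 q (\<lambda>p. Z p t)) has_real_derivative (\<Sum>p\<in>T. F2 q p (\<lambda>p. Z p t) * Z' p)) (at t)"
    and cont: "\<And>p q Z t. p \<in> T \<Longrightarrow> q \<in> T \<Longrightarrow> (\<And>p. p \<in> T \<Longrightarrow> isCont (Z p) t) \<Longrightarrow>
        isCont (\<lambda>t. F2 p q (\<lambda>p. Z p t)) (t::real)"
    and meas: "\<And>Z. (\<And>p. p \<in> T \<Longrightarrow> Z p \<in> borel_measurable M) \<Longrightarrow> (\<lambda>\<omega>. F (\<lambda>p. Z p \<omega>)) \<in> borel_measurable M"
      "\<And>q Z. q \<in> T \<Longrightarrow> (\<And>p. p \<in> T \<Longrightarrow> Z p \<in> borel_measurable M) \<Longrightarrow> (\<lambda>\<omega>. F1 q (\<lambda>p. Z p \<omega>)) \<in> borel_measurable M"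
      "\<And>q q' Z. q \<in> T \<Longrightarrow> q' \<in> T \<Longrightarrow> (\<And>p. p \<in> T \<Longrightarrow> Z p \<in> borel_measurable M) \<Longrightarrow>
          (\<lambda>\<omega>. F2 q q' (\<lambda>p. Z p \<omega>)) \<in> borel_measurable M"
    and bound: "\<And>z. \<bar>F z\<bar> \<le> B" "\<And>p z. p \<in> T \<Longrightarrow> \<bar>F1 p z\<bar> \<le> B"
      "\<And>p q z. p \<in> T \<Longrightarrow> q \<in> T \<Longrightarrow> \<bar>F2 p q z\<bar> \<le> B"
    and sign: "\<And>p q z. p \<in> T \<Longrightarrow> q \<in> T \<Longrightarrow>
        F2 p q z * ((\<Sum>r\<in>R. d p r * d q r) - (\<Sum>r\<in>R. c p r * c q r)) \<le> 0"
  shows "(\<integral>\<omega>. F (\<lambda>p. \<Sum>r\<in>R. d p r * \<omega> r) \<partial>M) \<le> (\<integral>\<omega>. F (\<lambda>p. \<Sum>r\<in>R. c p r * \<omega> r) \<partial>M)"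
proof -
  interpret product_prob_space "\<lambda>_. stdn" R by (rule product_prob_space_stdn)
  interpret PM: prob_space M unfolding M_def by (rule P.prob_space_axioms)
  \<comment> \<open>A rotation from \<open>c\<close> at time 0 to \<open>d\<close> at time pi/2.
    Orthogonality of the coefficients takes the place of independence, so a single Gaussian vector
    carries both processes.\<close>
  define e where "e = (\<lambda>t p r. cos t * c p r + sin t * d p r)"
  define e' where "e' = (\<lambda>t p r. - sin t * c p r + cos t * d p r)"
  define L where "L = (\<lambda>t p \<omega>. \<Sum>r\<in>R. e t p r * \<omega> r)"
  define L' where "L' = (\<lambda>t p \<omega>. \<Sum>r\<in>R. e' t p r * \<omega> r)"
  have comp[measurable]: "(\<lambda>\<omega>. \<omega> r) \<in> borel_measurable M" if "r \<in> R" for r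
    using measurable_component_singleton[OF that, of "\<lambda>_. stdn"] by (simp add: M_def)
  have Lm[measurable]: "L t p \<in> borel_measurable M" for t p
    unfolding L_def by (intro borel_measurable_sum borel_measurable_times) auto
  have L'm[measurable]: "L' t p \<in> borel_measurable M" for t p
    unfolding L'_def by (intro borel_measurable_sum borel_measurable_times) auto
  have B: "0 \<le> B" using bound(1)[of undefined] by linarith
  define \<psi> where "\<psi> = (\<lambda>t. \<integral>\<omega>. F (\<lambda>p. L t p \<omega>) \<partial>M)"
  define I where "I = (\<lambda>t p q. \<integral>\<omega>. F2 p q (\<lambda>p. L t p \<omega>) \<partial>M)"
  have intF1: "integrable M (\<lambda>\<omega>. \<omega> r * F1 p (\<lambda>p. L t p \<omega>))" if "p \<in> T" "r \<in> R" for p r t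
  proof (rule Bochner_Integration.integrable_bound)
    show "integrable M (\<lambda>\<omega>. B * \<bar>\<omega> r\<bar>)"
      unfolding M_def by (intro integrable_mult_right integrable_PiM_stdn_component that)
    show "(\<lambda>\<omega>. \<omega> r * F1 p (\<lambda>p. L t p \<omega>)) \<in> borel_measurable M"
      using that by (intro borel_measurable_times meas(2)) auto
    show "AE \<omega> in M. norm (\<omega> r * F1 p (\<lambda>p. L t p \<omega>)) \<le> norm (B * \<bar>\<omega> r\<bar>)"
      using bound(2)[OF that(1)] B by (auto intro!: AE_I2 mult_left_mono simp: abs_mult mult.commute[of B])
  qed
  have intF2: "integrable M (\<lambda>\<omega>. F2 p q (\<lambda>p. L t p \<omega>))" if "p \<in> T" "q \<in> T" for p q t
    by (rule PM.integrable_const_bound[where B = B]) (use that bound in \<open>auto intro!: meas\<close>)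
  have stein: "(\<integral>\<omega>. \<omega> r * F1 p (\<lambda>p. L t p \<omega>) \<partial>M) = (\<Sum>q\<in>T. I t p q * e t q r)" if "p \<in> T" "r \<in> R" for p r t
  proof -
    have Ld: "((\<lambda>y. L t q (x(r := y))) has_real_derivative e t q r) (at y)" for q x y
    proof -
      have "((\<lambda>y. L t q (x(r := y))) has_real_derivative (\<Sum>s\<in>R. if s = r then e t q s else 0)) (at y)"
        unfolding L_def by (rule DERIV_sum) (auto intro!: derivative_eq_intros)
      thus ?thesis using that(2) fin by simp
    qed
    have "(\<integral>\<omega>. \<omega> r * F1 p (\<lambda>p. L t p \<omega>) \<partial>M) = (\<integral>\<omega>. (\<Sum>q\<in>T. F2 p q (\<lambda>p. L t p \<omega>) * e t q r) \<partial>M)"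
      unfolding M_def
    proof (rule stein_identity_PiM[OF fin(2) that(2), where B = "B + (\<Sum>q\<in>T. B * \<bar>e t q r\<bar>)"])
      show "((\<lambda>y. F1 p (\<lambda>q. L t q (x(r := y)))) has_real_derivative
          (\<Sum>q\<in>T. F2 p q (\<lambda>q. L t q (x(r := y))) * e t q r)) (at y)" for x y
        by (rule chain1[OF that(1)]) (rule Ld)
      show "isCont (\<lambda>y. \<Sum>q\<in>T. F2 p q (\<lambda>q. L t q (x(r := y))) * e t q r) y" for x y
        using that by (intro continuous_intros cont DERIV_isCont[OF Ld]) auto
      have nn: "0 \<le> (\<Sum>q\<in>T. B * \<bar>e t q r\<bar>)" using B by (intro sum_nonneg) auto
      show "\<bar>F1 p (\<lambda>q. L t q x)\<bar> \<le> B + (\<Sum>q\<in>T. B * \<bar>e t q r\<bar>)" for x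
        using bound(2)[OF that(1), of "\<lambda>q. L t q x"] nn by linarith
      show "\<bar>\<Sum>q\<in>T. F2 p q (\<lambda>q. L t q x) * e t q r\<bar> \<le> B + (\<Sum>q\<in>T. B * \<bar>e t q r\<bar>)" for x
      proof -
        have "\<bar>\<Sum>q\<in>T. F2 p q (\<lambda>q. L t q x) * e t q r\<bar> \<le> (\<Sum>q\<in>T. B * \<bar>e t q r\<bar>)"
          by (rule order_trans[OF sum_abs sum_mono]) (use bound(3)[OF that(1)] in \<open>auto simp: abs_mult intro!: mult_right_mono\<close>)
        thus ?thesis using B by linarith
      qed
      show "(\<lambda>x. F1 p (\<lambda>q. L t q x)) \<in> borel_measurable (gaussian R)"
        unfolding M_def[symmetric] using that by (intro meas) auto
      show "(\<lambda>x. \<Sum>q\<in>T. F2 p q (\<lambda>q. L t q x) * e t q r) \<in> borel_measurable (gaussian R)"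
        unfolding M_def[symmetric] using that by (intro borel_measurable_sum borel_measurable_times meas) auto
    qed
    also have "\<dots> = (\<Sum>q\<in>T. I t p q * e t q r)"
      unfolding I_def using intF2[OF that(1)] by (subst Bochner_Integration.integral_sum) auto
    finally show ?thesis .
  qed
  have \<psi>': "(\<psi> has_real_derivative (\<Sum>p\<in>T. \<Sum>q\<in>T. I t p q * (\<Sum>r\<in>R. e' t p r * e t q r))) (at t)" for t
  proof -
    have "(\<psi> has_real_derivative (\<integral>\<omega>. (\<Sum>p\<in>T. F1 p (\<lambda>p. L t p \<omega>) * L' t p \<omega>) \<partial>M)) (at t)"
      unfolding \<psi>_def
    \<comment> \<open>The dominating function bounds sine and cosine by 1 and is therefore free of
      \<open>t\<close>.\<close>
    proof (rule DERIV_integral_dominated[where g = "\<lambda>\<omega>. \<Sum>p\<in>T. B * (\<Sum>r\<in>R. (\<bar>c p r\<bar> + \<bar>d p r\<bar>) * \<bar>\<omega> r\<bar>)"])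
      show "integrable M (\<lambda>\<omega>. F (\<lambda>p. L t p \<omega>))" for t
        by (rule PM.integrable_const_bound[where B = B]) (use bound in \<open>auto intro!: meas\<close>)
      show "(\<lambda>\<omega>. \<Sum>p\<in>T. F1 p (\<lambda>p. L t p \<omega>) * L' t p \<omega>) \<in> borel_measurable M" for t
        by (intro borel_measurable_sum borel_measurable_times meas) auto
      show "((\<lambda>t. F (\<lambda>p. L t p \<omega>)) has_real_derivative (\<Sum>p\<in>T. F1 p (\<lambda>p. L t p \<omega>) * L' t p \<omega>)) (at t)" for t \<omega>
      proof (rule chain)
        show "((\<lambda>t. L t p \<omega>) has_real_derivative L' t p \<omega>) (at t)" for p
          unfolding L_def L'_def e_def e'_def
          by (rule DERIV_sum) (auto intro!: derivative_eq_intros simp: algebra_simps)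
      qed
      show "\<bar>\<Sum>p\<in>T. F1 p (\<lambda>p. L t p \<omega>) * L' t p \<omega>\<bar> \<le> (\<Sum>p\<in>T. B * (\<Sum>r\<in>R. (\<bar>c p r\<bar> + \<bar>d p r\<bar>) * \<bar>\<omega> r\<bar>))" for t \<omega>
      proof (rule order_trans[OF sum_abs sum_mono])
        fix p assume p: "p \<in> T"
        have "\<bar>L' t p \<omega>\<bar> \<le> (\<Sum>r\<in>R. (\<bar>c p r\<bar> + \<bar>d p r\<bar>) * \<bar>\<omega> r\<bar>)"
          unfolding L'_def
        proof (rule order_trans[OF sum_abs sum_mono])
          fix r
          have "\<bar>e' t p r\<bar> \<le> \<bar>sin t\<bar> * \<bar>c p r\<bar> + \<bar>cos t\<bar> * \<bar>d p r\<bar>"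
            unfolding e'_def abs_mult[symmetric] by (rule order_trans[OF abs_triangle_ineq]) simp
          also have "\<dots> \<le> 1 * \<bar>c p r\<bar> + 1 * \<bar>d p r\<bar>"
            by (intro add_mono mult_right_mono) auto
          finally show "\<bar>e' t p r * \<omega> r\<bar> \<le> (\<bar>c p r\<bar> + \<bar>d p r\<bar>) * \<bar>\<omega> r\<bar>"
            unfolding abs_mult by (intro mult_right_mono) auto
        qed
        thus "\<bar>F1 p (\<lambda>p. L t p \<omega>) * L' t p \<omega>\<bar> \<le> B * (\<Sum>r\<in>R. (\<bar>c p r\<bar> + \<bar>d p r\<bar>) * \<bar>\<omega> r\<bar>)"
          unfolding abs_mult using bound(2)[OF p] B by (intro mult_mono) auto
      qed
      show "integrable M (\<lambda>\<omega>. \<Sum>p\<in>T. B * (\<Sum>r\<in>R. (\<bar>c p r\<bar> + \<bar>d p r\<bar>) * \<bar>\<omega> r\<bar>))"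
        unfolding M_def by (intro Bochner_Integration.integrable_sum integrable_mult_right integrable_PiM_stdn_component)
    qed
    also have "(\<integral>\<omega>. (\<Sum>p\<in>T. F1 p (\<lambda>p. L t p \<omega>) * L' t p \<omega>) \<partial>M)
        = (\<integral>\<omega>. (\<Sum>p\<in>T. \<Sum>r\<in>R. e' t p r * (\<omega> r * F1 p (\<lambda>p. L t p \<omega>))) \<partial>M)"
      unfolding L'_def by (simp add: sum_distrib_left sum_distrib_right mult_ac)
    also have "\<dots> = (\<Sum>p\<in>T. \<Sum>r\<in>R. e' t p r * (\<Sum>q\<in>T. I t p q * e t q r))"
      using intF1 by (simp add: Bochner_Integration.integral_sum Bochner_Integration.integrable_sum stein)
    also have "\<dots> = (\<Sum>p\<in>T. \<Sum>q\<in>T. I t p q * (\<Sum>r\<in>R. e' t p r * e t q r))"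
    proof (rule sum.cong[OF refl])
      fix p
      have "(\<Sum>r\<in>R. e' t p r * (\<Sum>q\<in>T. I t p q * e t q r)) = (\<Sum>r\<in>R. \<Sum>q\<in>T. I t p q * (e' t p r * e t q r))"
        by (simp add: sum_distrib_left mult_ac)
      also have "\<dots> = (\<Sum>q\<in>T. I t p q * (\<Sum>r\<in>R. e' t p r * e t q r))"
        by (subst sum.swap) (simp add: sum_distrib_left)
      finally show "(\<Sum>r\<in>R. e' t p r * (\<Sum>q\<in>T. I t p q * e t q r)) = (\<Sum>q\<in>T. I t p q * (\<Sum>r\<in>R. e' t p r * e t q r))" .
    qed
    finally show ?thesis .
  qed
  have "\<psi> (pi / 2) \<le> \<psi> 0"
  proof (rule DERIV_nonpos_imp_nonincreasing[of 0 "pi / 2" \<psi>])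
    fix t :: real assume t: "0 \<le> t" "t \<le> pi / 2"
    have sc: "0 \<le> sin t * cos t"
      using t by (intro mult_nonneg_nonneg sin_ge_zero cos_ge_zero) auto
    have "(\<Sum>p\<in>T. \<Sum>q\<in>T. I t p q * (\<Sum>r\<in>R. e' t p r * e t q r)) \<le> 0"
    proof (intro sum_nonpos)
      fix p q assume pq: "p \<in> T" "q \<in> T"
      let ?K = "(\<Sum>r\<in>R. d p r * d q r) - (\<Sum>r\<in>R. c p r * c q r)"
      have o2: "(\<Sum>r\<in>R. d p r * c q r) = 0" using orth[OF pq(2,1)] by (simp add: mult.commute)
      \<comment> \<open>The sin^2 and cos^2 terms pair \<open>c\<close> with \<open>d\<close> and
        vanish by orthogonality. What survives is the covariance difference with weight
        \<open>sin t * cos t\<close>, which is nonnegative on this quarter turn.\<close>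
      have "(\<Sum>r\<in>R. e' t p r * e t q r) = (\<Sum>r\<in>R. sin t * cos t * (d p r * d q r) - sin t * cos t * (c p r * c q r)
          - (sin t)\<^sup>2 * (c p r * d q r) + (cos t)\<^sup>2 * (d p r * c q r))"
        by (intro sum.cong refl) (simp add: e_def e'_def power2_eq_square algebra_simps)
      also have "\<dots> = sin t * cos t * ?K"
        by (simp add: sum.distrib sum_subtractf sum_distrib_left[symmetric] orth[OF pq] o2 right_diff_distrib)
      finally have eq: "(\<Sum>r\<in>R. e' t p r * e t q r) = sin t * cos t * ?K" .
      have "I t p q * ?K = (\<integral>\<omega>. F2 p q (\<lambda>p. L t p \<omega>) * ?K \<partial>M)"
        by (simp add: I_def)
      also have "\<dots> \<le> 0"
        using Bochner_Integration.integral_nonneg[of M "\<lambda>\<omega>. - (F2 p q (\<lambda>p. L t p \<omega>) * ?K)"] sign[OF pq] by simp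
      finally have "(sin t * cos t) * (I t p q * ?K) \<le> 0"
        using sc by (rule mult_nonneg_nonpos[rotated])
      thus "I t p q * (\<Sum>r\<in>R. e' t p r * e t q r) \<le> 0" unfolding eq by (simp only: mult_ac)
    qed
    thus "\<exists>y. (\<psi> has_real_derivative y) (at t) \<and> y \<le> 0" using \<psi>' by blast
  qed auto
  thus ?thesis by (simp add: \<psi>_def L_def e_def)
qed

section \<open>Comparison of Gaussian min-max functionals\<close>

context
  fixes P :: "'a set" and Q :: "'b set" and L s :: real
begin

text \<open>For large \<open>L\<close> the function \<open>soft_minmax\<close> approximates the indicator of the event that every row
  \<open>a \<in> P\<close> has an entry \<open>z (a, b)\<close> above \<open>- s\<close>. Its mixed second derivatives across different rows
  are nonnegative, which is all the comparison needs.\<close>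

definition soft_row :: "('a \<times> 'b \<Rightarrow> real) \<Rightarrow> 'a \<Rightarrow> real" where
  "soft_row z a = exp (- (\<Sum>b\<in>Q. L * exp (L\<^sup>2 * (z (a, b) + s))))"

definition soft_minmax :: "('a \<times> 'b \<Rightarrow> real) \<Rightarrow> real" where
  "soft_minmax z = exp (- (\<Sum>a\<in>P. L * soft_row z a))"

text \<open>The derivative in \<open>z p\<close> of the sum in the exponent of
  \<open>soft_row\<close>. In terms of it, \<open>soft_minmax1\<close> and
  \<open>soft_minmax2\<close> are the first and second partial derivatives of
  \<open>soft_minmax\<close>; the two \<open>of_bool\<close> terms come from differentiating the row
  factor and the entry itself.\<close>

definition soft_entry :: "'a \<times> 'b \<Rightarrow> ('a \<times> 'b \<Rightarrow> real) \<Rightarrow> real" where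
  "soft_entry p z = L\<^sup>2 * (L * exp (L\<^sup>2 * (z p + s)))"

definition soft_minmax1 :: "'a \<times> 'b \<Rightarrow> ('a \<times> 'b \<Rightarrow> real) \<Rightarrow> real" where
  "soft_minmax1 p z = soft_minmax z * (L * soft_row z (fst p) * soft_entry p z)"

definition soft_minmax2 :: "'a \<times> 'b \<Rightarrow> 'a \<times> 'b \<Rightarrow> ('a \<times> 'b \<Rightarrow> real) \<Rightarrow> real" where
  "soft_minmax2 p q z = soft_minmax1 p z * (L * soft_row z (fst q) * soft_entry q z
     - of_bool (fst p = fst q) * soft_entry q z + of_bool (p = q) * L\<^sup>2)"

context
  assumes fin: "finite P" "finite Q" and L: "L \<ge> 1"
begin

lemma soft_entry_deriv:
  assumes "(Z p has_real_derivative Z' p) (at t)"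
  shows "((\<lambda>t. soft_entry p (\<lambda>p. Z p t)) has_real_derivative L\<^sup>2 * soft_entry p (\<lambda>p. Z p t) * Z' p) (at t)"
  unfolding soft_entry_def using assms
  by (auto intro!: derivative_eq_intros simp: algebra_simps)

lemma soft_row_deriv:
  assumes "\<And>b. b \<in> Q \<Longrightarrow> (Z (a, b) has_real_derivative Z' (a, b)) (at t)"
  shows "((\<lambda>t. soft_row (\<lambda>p. Z p t) a) has_real_derivative
    - (soft_row (\<lambda>p. Z p t) a * (\<Sum>b\<in>Q. soft_entry (a, b) (\<lambda>p. Z p t) * Z' (a, b)))) (at t)"
proof -
  have "((\<lambda>t. \<Sum>b\<in>Q. L * exp (L\<^sup>2 * (Z (a, b) t + s))) has_real_derivative
      (\<Sum>b\<in>Q. soft_entry (a, b) (\<lambda>p. Z p t) * Z' (a, b))) (at t)"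
    by (rule DERIV_sum) (use assms in \<open>auto intro!: derivative_eq_intros simp: soft_entry_def algebra_simps\<close>)
  from DERIV_fun_exp[OF DERIV_minus[OF this]] show ?thesis
    unfolding soft_row_def by simp
qed

lemma soft_minmax_deriv:
  assumes "\<And>p. p \<in> P \<times> Q \<Longrightarrow> (Z p has_real_derivative Z' p) (at t)"
  shows "((\<lambda>t. soft_minmax (\<lambda>p. Z p t)) has_real_derivative
    (\<Sum>p\<in>P \<times> Q. soft_minmax1 p (\<lambda>p. Z p t) * Z' p)) (at t)"
proof -
  have "((\<lambda>t. \<Sum>a\<in>P. L * soft_row (\<lambda>p. Z p t) a) has_real_derivative
      (\<Sum>a\<in>P. L * - (soft_row (\<lambda>p. Z p t) a * (\<Sum>b\<in>Q. soft_entry (a, b) (\<lambda>p. Z p t) * Z' (a, b))))) (at t)"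
    using assms by (intro DERIV_sum DERIV_cmult soft_row_deriv) auto
  note d = DERIV_fun_exp[OF DERIV_minus[OF this]]
  have eq: "(\<Sum>p\<in>P \<times> Q. soft_minmax1 p (\<lambda>p. Z p t) * Z' p) =
      soft_minmax (\<lambda>p. Z p t) * - (\<Sum>a\<in>P. L * - (soft_row (\<lambda>p. Z p t) a * (\<Sum>b\<in>Q. soft_entry (a, b) (\<lambda>p. Z p t) * Z' (a, b))))"
    unfolding sum.cartesian_product[symmetric, of "\<lambda>a b. soft_minmax1 (a, b) (\<lambda>p. Z p t) * Z' (a, b)", simplified]
    by (simp add: soft_minmax1_def sum_distrib_left sum_negf mult_ac)
  show ?thesis unfolding eq using d unfolding soft_minmax_def .
qed

lemma sum_cartesian_fst:
  fixes f :: "'a \<times> 'b \<Rightarrow> real"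
  assumes "a \<in> P"
  shows "(\<Sum>p\<in>P \<times> Q. of_bool (a = fst p) * f p) = (\<Sum>b\<in>Q. f (a, b))"
proof -
  have "(\<Sum>p\<in>P \<times> Q. of_bool (a = fst p) * f p) = (\<Sum>x\<in>P. \<Sum>b\<in>Q. of_bool (a = x) * f (x, b))"
    by (simp add: sum.cartesian_product case_prod_beta)
  also have "\<dots> = (\<Sum>x\<in>P. if a = x then \<Sum>b\<in>Q. f (x, b) else 0)"
    by (intro sum.cong refl) auto
  finally show ?thesis using assms fin by simp
qed

lemma soft_minmax1_deriv:
  assumes "q \<in> P \<times> Q" "\<And>p. p \<in> P \<times> Q \<Longrightarrow> (Z p has_real_derivative Z' p) (at t)"
  shows "((\<lambda>t. soft_minmax1 q (\<lambda>p. Z p t)) has_real_derivative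
    (\<Sum>p\<in>P \<times> Q. soft_minmax2 q p (\<lambda>p. Z p t) * Z' p)) (at t)"
proof -
  obtain a b where q: "q = (a, b)" "a \<in> P" "b \<in> Q" using assms(1) by auto
  define z where "z = (\<lambda>p. Z p t)"
  have d1: "((\<lambda>t. soft_minmax (\<lambda>p. Z p t)) has_real_derivative (\<Sum>p\<in>P \<times> Q. soft_minmax1 p z * Z' p)) (at t)"
    unfolding z_def by (rule soft_minmax_deriv) (rule assms)
  have d2: "((\<lambda>t. soft_row (\<lambda>p. Z p t) a) has_real_derivative - (soft_row z a * (\<Sum>b\<in>Q. soft_entry (a, b) z * Z' (a, b)))) (at t)"
    unfolding z_def by (rule soft_row_deriv) (use assms q in auto)
  have d3: "((\<lambda>t. soft_entry q (\<lambda>p. Z p t)) has_real_derivative L\<^sup>2 * soft_entry q z * Z' q) (at t)"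
    unfolding z_def by (rule soft_entry_deriv) (use assms in auto)
  define f where "f = soft_minmax z" define r where "r = soft_row z a" define v where "v = soft_entry q z"
  have s1: "(\<Sum>p\<in>P \<times> Q. soft_minmax1 p z * Z' p) = f * (\<Sum>p\<in>P \<times> Q. L * soft_row z (fst p) * soft_entry p z * Z' p)"
    by (simp add: soft_minmax1_def f_def sum_distrib_left mult_ac)
  have s2: "(\<Sum>p\<in>P \<times> Q. of_bool (fst q = fst p) * (soft_entry p z * Z' p)) = (\<Sum>b\<in>Q. soft_entry (a, b) z * Z' (a, b))"
    using sum_cartesian_fst[OF q(2), of "\<lambda>p. soft_entry p z * Z' p"] by (simp add: q(1))
  have s3: "(\<Sum>p\<in>P \<times> Q. of_bool (q = p) * L\<^sup>2 * Z' p) = L\<^sup>2 * Z' q"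
  proof -
    have "(\<Sum>p\<in>P \<times> Q. of_bool (q = p) * L\<^sup>2 * Z' p) = (\<Sum>p\<in>P \<times> Q. if q = p then L\<^sup>2 * Z' p else 0)"
      by (intro sum.cong refl) auto
    thus ?thesis using fin assms(1) by simp
  qed
  have "(\<Sum>p\<in>P \<times> Q. soft_minmax2 q p z * Z' p) = (\<Sum>p\<in>P \<times> Q. f * (L * r * v) *
     (L * soft_row z (fst p) * soft_entry p z * Z' p
     - of_bool (fst q = fst p) * (soft_entry p z * Z' p) + of_bool (q = p) * L\<^sup>2 * Z' p))"
    by (intro sum.cong refl) (simp add: soft_minmax2_def soft_minmax1_def f_def r_def v_def q algebra_simps)
  also have "\<dots> = f * (L * r * v) * ((\<Sum>p\<in>P \<times> Q. L * soft_row z (fst p) * soft_entry p z * Z' p)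
     - (\<Sum>b\<in>Q. soft_entry (a, b) z * Z' (a, b)) + L\<^sup>2 * Z' q)"
    by (simp only: sum_distrib_left[symmetric] sum.distrib sum_subtractf s2 s3)
  finally have eq: "(\<Sum>p\<in>P \<times> Q. soft_minmax2 q p z * Z' p) = \<dots>" .
  have "((\<lambda>t. soft_minmax (\<lambda>p. Z p t) * (L * soft_row (\<lambda>p. Z p t) a * soft_entry q (\<lambda>p. Z p t))) has_real_derivative
     (\<Sum>p\<in>P \<times> Q. soft_minmax2 q p z * Z' p)) (at t)"
    unfolding eq
    by (rule derivative_eq_intros d1[unfolded s1] d2 d3 refl)+
       (simp add: z_def[symmetric] f_def[symmetric] r_def[symmetric] v_def[symmetric] algebra_simps)
  thus ?thesis by (simp add: soft_minmax1_def q z_def)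
qed

lemma soft_minmax_bounds: "0 < soft_minmax z" "soft_minmax z \<le> 1"
  using L by (auto simp: soft_minmax_def soft_row_def intro!: sum_nonneg)

lemma soft_entry_pos: "0 < soft_entry p z"
  using L by (simp add: soft_entry_def)

text \<open>An entry is at most \<open>L\<^sup>2\<close> times the row sum S, and S \<le> 2 exp
  (S/2). Half of the decay of the row thus absorbs one entry, and the other half is kept for a
  second one.\<close>

lemma soft_row_entry_half:
  assumes "p \<in> P \<times> Q"
  shows "exp (- (\<Sum>b\<in>Q. L * exp (L\<^sup>2 * (z (fst p, b) + s))) / 2) * soft_entry p z \<le> 2 * L\<^sup>2"
proof -
  define S where "S = (\<Sum>b\<in>Q. L * exp (L\<^sup>2 * (z (fst p, b) + s)))"
  define u where "u = L * exp (L\<^sup>2 * (z p + s))"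
  have "u \<le> S"
    unfolding u_def S_def using member_le_sum[of "snd p" Q "\<lambda>b. L * exp (L\<^sup>2 * (z (fst p, b) + s))"] assms fin L
    by auto
  moreover have "1 + S / 2 \<le> exp (S / 2)" by (rule exp_ge_add_one_self)
  ultimately have "u \<le> 2 * exp (S / 2)" by linarith
  hence "L\<^sup>2 * (exp (- S / 2) * u) \<le> L\<^sup>2 * (exp (- S / 2) * (2 * exp (S / 2)))"
    by (intro mult_left_mono) auto
  also have "\<dots> = 2 * L\<^sup>2" by (simp add: exp_minus)
  finally show ?thesis by (simp add: S_def[symmetric] soft_entry_def u_def mult_ac)
qed

lemma soft_row_bounds: "0 < soft_row z a" "soft_row z a \<le> 1"
  using L by (auto simp: soft_row_def intro!: sum_nonneg)

lemma soft_row_entry2: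
  assumes "p \<in> P \<times> Q" "q \<in> P \<times> Q" "fst p = fst q"
  shows "soft_row z (fst p) * soft_entry p z * soft_entry q z \<le> (2 * L\<^sup>2) * (2 * L\<^sup>2)"
proof -
  define S where "S = (\<Sum>b\<in>Q. L * exp (L\<^sup>2 * (z (fst p, b) + s)))"
  have "soft_row z (fst p) = exp (- S / 2) * exp (- S / 2)"
    by (simp add: soft_row_def S_def exp_add[symmetric])
  hence "soft_row z (fst p) * soft_entry p z * soft_entry q z = (exp (- S / 2) * soft_entry p z) * (exp (- S / 2) * soft_entry q z)"
    by simp
  also have "\<dots> \<le> (2 * L\<^sup>2) * (2 * L\<^sup>2)"
    using soft_row_entry_half[OF assms(1), of z] soft_row_entry_half[OF assms(2), of z, folded assms(3)]
      less_imp_le[OF soft_entry_pos, of p z] less_imp_le[OF soft_entry_pos, of q z]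
    unfolding S_def[symmetric] by (intro mult_mono[of "exp (- S / 2) * soft_entry p z"]) simp_all
  finally show ?thesis .
qed

lemma soft_row_entry:
  assumes "p \<in> P \<times> Q"
  shows "soft_row z (fst p) * soft_entry p z \<le> 2 * L\<^sup>2"
proof -
  define S where "S = (\<Sum>b\<in>Q. L * exp (L\<^sup>2 * (z (fst p, b) + s)))"
  have "0 \<le> S" using L by (auto simp: S_def intro!: sum_nonneg)
  hence "soft_row z (fst p) * soft_entry p z \<le> exp (- S / 2) * soft_entry p z"
    using soft_entry_pos[of p z] by (intro mult_right_mono) (auto simp: soft_row_def S_def)
  also have "\<dots> \<le> 2 * L\<^sup>2" using soft_row_entry_half[OF assms, of z] by (simp add: S_def)
  finally show ?thesis .
qed

lemma soft_minmax1_bounds: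
  assumes "p \<in> P \<times> Q"
  shows "0 \<le> soft_minmax1 p z" "soft_minmax1 p z \<le> L * (2 * L\<^sup>2)"
proof -
  note [simp] = less_imp_le[OF soft_minmax_bounds(1)] less_imp_le[OF soft_row_bounds(1)] less_imp_le[OF soft_entry_pos]
  show "0 \<le> soft_minmax1 p z" using L by (simp add: soft_minmax1_def)
  have "soft_minmax1 p z \<le> 1 * (L * (soft_row z (fst p) * soft_entry p z))"
    unfolding soft_minmax1_def mult.assoc using L soft_minmax_bounds by (intro mult_right_mono) auto
  also have "\<dots> \<le> L * (2 * L\<^sup>2)"
    using L soft_row_entry[OF assms] by simp
  finally show "soft_minmax1 p z \<le> L * (2 * L\<^sup>2)" .
qed

text \<open>The three summands are bounded separately. The critical one has two entries of the same
  row against one row factor, which is where the decay of the row has to be split in halves.\<close>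

lemma soft_minmax2_bound:
  assumes "p \<in> P \<times> Q" "q \<in> P \<times> Q"
  shows "\<bar>soft_minmax2 p q z\<bar> \<le> (L * (2 * L\<^sup>2)) * (L * (2 * L\<^sup>2)) + L * ((2 * L\<^sup>2) * (2 * L\<^sup>2)) + (L * (2 * L\<^sup>2)) * L\<^sup>2"
proof -
  note [simp] = less_imp_le[OF soft_minmax_bounds(1)] less_imp_le[OF soft_row_bounds(1)] less_imp_le[OF soft_entry_pos]
  note b = soft_minmax1_bounds[OF assms(1), of z]
  have t1: "0 \<le> soft_minmax1 p z * (L * soft_row z (fst q) * soft_entry q z)"
    "soft_minmax1 p z * (L * soft_row z (fst q) * soft_entry q z) \<le> (L * (2 * L\<^sup>2)) * (L * (2 * L\<^sup>2))"
  proof -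
    show "0 \<le> soft_minmax1 p z * (L * soft_row z (fst q) * soft_entry q z)" using b L by simp
    show "soft_minmax1 p z * (L * soft_row z (fst q) * soft_entry q z) \<le> (L * (2 * L\<^sup>2)) * (L * (2 * L\<^sup>2))"
      unfolding mult.assoc[of L "soft_row z (fst q)"] using b L soft_row_entry[OF assms(2), of z]
      by (intro mult_mono[of "soft_minmax1 p z"] mult_left_mono) simp_all
  qed
  have t2: "0 \<le> soft_minmax1 p z * (of_bool (fst p = fst q) * soft_entry q z)" using b by auto
  have t2': "soft_minmax1 p z * (of_bool (fst p = fst q) * soft_entry q z) \<le> L * ((2 * L\<^sup>2) * (2 * L\<^sup>2))"
  proof (cases "fst p = fst q")
    case True
    have "soft_minmax1 p z * soft_entry q z = soft_minmax z * (L * (soft_row z (fst p) * soft_entry p z * soft_entry q z))"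
      by (simp add: soft_minmax1_def mult_ac)
    also have "\<dots> \<le> 1 * (L * ((2 * L\<^sup>2) * (2 * L\<^sup>2)))"
      using soft_row_entry2[OF assms True, of z] L soft_minmax_bounds[of z]
      by (intro mult_mono[of "soft_minmax z"] mult_left_mono[of "_ * _ * _"]) simp_all
    finally show ?thesis using True by simp
  qed (use L in auto)
  have t3: "0 \<le> soft_minmax1 p z * (of_bool (p = q) * L\<^sup>2)" "soft_minmax1 p z * (of_bool (p = q) * L\<^sup>2) \<le> (L * (2 * L\<^sup>2)) * L\<^sup>2"
    using b L by (auto intro!: mult_mono)
  show ?thesis unfolding soft_minmax2_def ring_distribs using t1 t2 t2' t3 by linarith
qed

lemma soft_minmax2_nonneg:
  assumes "p \<in> P \<times> Q" "q \<in> P \<times> Q" "fst p \<noteq> fst q"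
  shows "0 \<le> soft_minmax2 p q z"
  using soft_minmax1_bounds(1)[OF assms(1), of z] assms(3) L soft_row_bounds(1)[of z "fst q"] soft_entry_pos[of q z]
  by (auto simp: soft_minmax2_def)

text \<open>Within a row the covariances agree, so the sign of the second derivative is irrelevant
  there. Across rows it is nonnegative and the covariance of \<open>d\<close> is the smaller
  one.\<close>

lemma soft_minmax_compare:
  fixes R :: "'r set" and c d :: "'a \<times> 'b \<Rightarrow> 'r \<Rightarrow> real"
  defines "M \<equiv> gaussian R"
  assumes R: "finite R"
    and orth: "\<And>p q. p \<in> P \<times> Q \<Longrightarrow> q \<in> P \<times> Q \<Longrightarrow> (\<Sum>r\<in>R. c p r * d q r) = 0"
    and cov: "\<And>p q. p \<in> P \<times> Q \<Longrightarrow> q \<in> P \<times> Q \<Longrightarrow> (\<Sum>r\<in>R. d p r * d q r) \<le> (\<Sum>r\<in>R. c p r * c q r)"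
    and cov_eq: "\<And>p q. p \<in> P \<times> Q \<Longrightarrow> q \<in> P \<times> Q \<Longrightarrow> fst p = fst q \<Longrightarrow>
       (\<Sum>r\<in>R. d p r * d q r) = (\<Sum>r\<in>R. c p r * c q r)"
  shows "(\<integral>\<omega>. soft_minmax (\<lambda>p. \<Sum>r\<in>R. d p r * \<omega> r) \<partial>M) \<le> (\<integral>\<omega>. soft_minmax (\<lambda>p. \<Sum>r\<in>R. c p r * \<omega> r) \<partial>M)"
  unfolding M_def
proof (rule gaussian_interpolation[where T = "P \<times> Q" and ?F1.0 = soft_minmax1 and ?F2.0 = soft_minmax2 and
      B = "1 + L * (2 * L\<^sup>2) + ((L * (2 * L\<^sup>2)) * (L * (2 * L\<^sup>2)) + L * ((2 * L\<^sup>2) * (2 * L\<^sup>2)) + (L * (2 * L\<^sup>2)) * L\<^sup>2)"])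
  have nn: "0 \<le> L * (2 * L\<^sup>2)" "0 \<le> (L * (2 * L\<^sup>2)) * (L * (2 * L\<^sup>2)) + L * ((2 * L\<^sup>2) * (2 * L\<^sup>2)) + (L * (2 * L\<^sup>2)) * L\<^sup>2"
    using L by auto
  let ?B = "1 + L * (2 * L\<^sup>2) + ((L * (2 * L\<^sup>2)) * (L * (2 * L\<^sup>2)) + L * ((2 * L\<^sup>2) * (2 * L\<^sup>2)) + (L * (2 * L\<^sup>2)) * L\<^sup>2)"
  show "\<bar>soft_minmax z\<bar> \<le> ?B" for z
    using soft_minmax_bounds[of z] nn by linarith
  show "\<bar>soft_minmax1 p z\<bar> \<le> ?B" if "p \<in> P \<times> Q" for p z
    using soft_minmax1_bounds[OF that, of z] nn by linarith
  show "\<bar>soft_minmax2 p q z\<bar> \<le> ?B" if "p \<in> P \<times> Q" "q \<in> P \<times> Q" for p q z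
    using soft_minmax2_bound[OF that, of z] nn by linarith
  show "soft_minmax2 p q z * ((\<Sum>r\<in>R. d p r * d q r) - (\<Sum>r\<in>R. c p r * c q r)) \<le> 0"
    if "p \<in> P \<times> Q" "q \<in> P \<times> Q" for p q z
    using soft_minmax2_nonneg[OF that, of z] cov[OF that] cov_eq[OF that]
    by (cases "fst p = fst q") (auto intro!: mult_nonneg_nonpos)
  show "isCont (\<lambda>t. soft_minmax2 p q (\<lambda>p. Z p t)) t"
    if "p \<in> P \<times> Q" "q \<in> P \<times> Q" "\<And>p. p \<in> P \<times> Q \<Longrightarrow> isCont (Z p) t" for p q and Z :: "'a \<times> 'b \<Rightarrow> real \<Rightarrow> real" and t
    using that unfolding soft_minmax2_def soft_minmax1_def soft_minmax_def soft_entry_def soft_row_def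
    by (intro continuous_intros) auto
  fix Z :: "'a \<times> 'b \<Rightarrow> ('r \<Rightarrow> real) \<Rightarrow> real"
  assume Z: "\<And>p. p \<in> P \<times> Q \<Longrightarrow> Z p \<in> borel_measurable (gaussian R)"
  let ?b = "borel_measurable (gaussian R)"
  have row: "(\<lambda>\<omega>. soft_row (\<lambda>p. Z p \<omega>) a) \<in> ?b" if "a \<in> P" for a
    unfolding soft_row_def using Z that
    by (intro measurable_compose[OF _ borel_measurable_exp] borel_measurable_uminus borel_measurable_sum borel_measurable_times
        borel_measurable_add borel_measurable_const) auto
  have entry: "(\<lambda>\<omega>. soft_entry p (\<lambda>p. Z p \<omega>)) \<in> ?b" if "p \<in> P \<times> Q" for p
    unfolding soft_entry_def using Z that by measurable
  show sm: "(\<lambda>\<omega>. soft_minmax (\<lambda>p. Z p \<omega>)) \<in> ?b"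
    unfolding soft_minmax_def using row
    by (intro measurable_compose[OF _ borel_measurable_exp] borel_measurable_uminus borel_measurable_sum borel_measurable_times
        borel_measurable_const) auto
  show sm1: "(\<lambda>\<omega>. soft_minmax1 p (\<lambda>p. Z p \<omega>)) \<in> ?b" if "p \<in> P \<times> Q" for p
    unfolding soft_minmax1_def using sm row[of "fst p"] entry[OF that] that
    by (intro borel_measurable_times borel_measurable_const) auto
  show "(\<lambda>\<omega>. soft_minmax2 p q (\<lambda>p. Z p \<omega>)) \<in> ?b" if "p \<in> P \<times> Q" "q \<in> P \<times> Q" for p q
    unfolding soft_minmax2_def using sm1[OF that(1)] row[of "fst q"] entry[OF that(2)] that
    by (intro borel_measurable_times borel_measurable_const borel_measurable_add borel_measurable_diff) auto
qed (use fin R orth soft_minmax_deriv soft_minmax1_deriv in auto)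

end
end

section \<open>From the soft function to probabilities\<close>

lemma soft_minmax_le:
  assumes fin: "finite P" "finite Q" and L: "L \<ge> 1" and \<delta>: "0 < \<delta>" "1 / \<delta> \<le> L"
    and a: "a \<in> P" "\<And>b. b \<in> Q \<Longrightarrow> z (a, b) \<le> - s - \<delta>"
  shows "soft_minmax P Q L s z \<le> exp (- (L * exp (- real (card Q))))"
proof -
  have small: "L * exp (L\<^sup>2 * (z (a, b) + s)) \<le> 1" if "b \<in> Q" for b
  proof -
    have "L\<^sup>2 * (z (a, b) + s) \<le> - (L\<^sup>2 * \<delta>)"
      using mult_left_mono[of "z (a, b) + s" "- \<delta>" "L\<^sup>2"] a(2)[OF that] by simp
    hence "L * exp (L\<^sup>2 * (z (a, b) + s)) \<le> L * exp (- (L\<^sup>2 * \<delta>))" using L by simp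
    \<comment> \<open>This is why the exponent carries \<open>L\<^sup>2\<close>: even a margin as
      small as \<open>1 / L\<close> leaves a decay of order \<open>exp (- L)\<close>, which beats
      the prefactor \<open>L\<close>.\<close>
    also have "\<dots> \<le> L * exp (- L)"
    proof -
      have "1 \<le> L * \<delta>" using \<delta> by (simp add: field_simps)
      hence "L * 1 \<le> L * (L * \<delta>)" using L by (intro mult_left_mono) auto
      thus ?thesis using L by (simp add: power2_eq_square mult.assoc)
    qed
    also have "\<dots> \<le> 1"
    proof -
      have "L \<le> exp L" using exp_ge_add_one_self[of L] by linarith
      thus ?thesis by (simp add: exp_minus divide_simps)
    qed
    finally show ?thesis .
  qed
  have "(\<Sum>b\<in>Q. L * exp (L\<^sup>2 * (z (a, b) + s))) \<le> (\<Sum>b\<in>Q. 1)"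
    by (rule sum_mono) (rule small)
  hence "exp (- real (card Q)) \<le> soft_row Q L s z a"
    by (simp add: soft_row_def)
  hence "L * exp (- real (card Q)) \<le> L * soft_row Q L s z a" using L by simp
  also have "\<dots> \<le> (\<Sum>a\<in>P. L * soft_row Q L s z a)"
    using L by (intro member_le_sum[OF a(1)]) (auto simp: soft_row_def fin)
  finally show ?thesis by (simp add: soft_minmax_def)
qed

text \<open>A single entry above the level pushes the factor of its row below
  \<open>exp (- L)\<close>. Summing over the rows costs the factor \<open>card P\<close>, harmless
  for large \<open>L\<close>.\<close>

lemma soft_minmax_ge:
  assumes fin: "finite P" "finite Q" and L: "L \<ge> 1" and \<delta>: "0 < \<delta>"
    and ex: "\<And>a. a \<in> P \<Longrightarrow> \<exists>b\<in>Q. - s + \<delta> \<le> z (a, b)"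
  shows "1 - real (card P) * (L * exp (- L)) \<le> soft_minmax P Q L s z"
proof -
  have "L * soft_row Q L s z a \<le> L * exp (- L)" if a: "a \<in> P" for a
  proof -
    obtain b where b: "b \<in> Q" "- s + \<delta> \<le> z (a, b)" using ex[OF a] by blast
    have "0 \<le> L\<^sup>2 * (z (a, b) + s)" using b \<delta> by (intro mult_nonneg_nonneg) auto
    hence "L * 1 \<le> L * exp (L\<^sup>2 * (z (a, b) + s))" using L by (intro mult_left_mono) auto
    also have "\<dots> \<le> (\<Sum>b\<in>Q. L * exp (L\<^sup>2 * (z (a, b) + s)))"
      using L fin by (intro member_le_sum[OF b(1)]) auto
    finally show ?thesis using L by (simp add: soft_row_def)
  qed
  hence "(\<Sum>a\<in>P. L * soft_row Q L s z a) \<le> (\<Sum>a\<in>P. L * exp (- L))" by (rule sum_mono)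
  moreover have "1 + - (\<Sum>a\<in>P. L * soft_row Q L s z a) \<le> soft_minmax P Q L s z"
    unfolding soft_minmax_def by (rule exp_ge_add_one_self)
  ultimately show ?thesis by simp
qed

text \<open>The soft function is close to 0 on the event for \<open>c\<close> and close to 1 off the
  event for \<open>d\<close>; the gap between the two levels is where it is undecided. Comparing
  expectations and letting \<open>L\<close> tend to infinity compares the probabilities.\<close>

lemma gaussian_minmax_finite:
  fixes P :: "'a set" and Q :: "'b set" and R :: "'r set" and c d :: "'a \<times> 'b \<Rightarrow> 'r \<Rightarrow> real" and s \<delta> :: real
  defines "M \<equiv> gaussian R"
  assumes fin: "finite P" "finite Q" "finite R" and \<delta>: "0 < \<delta>"
    and orth: "\<And>p q. p \<in> P \<times> Q \<Longrightarrow> q \<in> P \<times> Q \<Longrightarrow> (\<Sum>r\<in>R. c p r * d q r) = 0"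
    and cov: "\<And>p q. p \<in> P \<times> Q \<Longrightarrow> q \<in> P \<times> Q \<Longrightarrow> (\<Sum>r\<in>R. d p r * d q r) \<le> (\<Sum>r\<in>R. c p r * c q r)"
    and cov_eq: "\<And>p q. p \<in> P \<times> Q \<Longrightarrow> q \<in> P \<times> Q \<Longrightarrow> fst p = fst q \<Longrightarrow>
       (\<Sum>r\<in>R. d p r * d q r) = (\<Sum>r\<in>R. c p r * c q r)"
  shows "measure M {\<omega> \<in> space M. \<exists>a\<in>P. \<forall>b\<in>Q. (\<Sum>r\<in>R. c (a, b) r * \<omega> r) \<le> - s - \<delta>}
    \<le> measure M {\<omega> \<in> space M. \<exists>a\<in>P. \<forall>b\<in>Q. (\<Sum>r\<in>R. d (a, b) r * \<omega> r) \<le> - s + \<delta>}" (is "measure M ?E \<le> measure M ?U")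
proof -
  interpret product_prob_space "\<lambda>_. stdn" R by (rule product_prob_space_stdn)
  interpret PM: prob_space M unfolding M_def by (rule P.prob_space_axioms)
  have comp[measurable]: "(\<lambda>\<omega>. \<omega> r) \<in> borel_measurable M" if "r \<in> R" for r
    using measurable_component_singleton[OF that, of "\<lambda>_. stdn"] by (simp add: M_def)
  have [measurable]: "(\<lambda>\<omega>. \<Sum>r\<in>R. f r * \<omega> r) \<in> borel_measurable M" for f :: "'r \<Rightarrow> real"
    by (intro borel_measurable_sum borel_measurable_times) auto
  have E[measurable]: "?E \<in> sets M" using fin by measurable
  have U[measurable]: "?U \<in> sets M" using fin by measurable
  have smm: "(\<lambda>\<omega>. soft_minmax P Q L s (\<lambda>p. \<Sum>r\<in>R. f p r * \<omega> r)) \<in> borel_measurable M" for L and f :: "'a \<times> 'b \<Rightarrow> 'r \<Rightarrow> real"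
    unfolding soft_minmax_def soft_row_def by measurable
  have smi: "integrable M (\<lambda>\<omega>. soft_minmax P Q L s (\<lambda>p. \<Sum>r\<in>R. f p r * \<omega> r))" if "1 \<le> L" for L and f :: "'a \<times> 'b \<Rightarrow> 'r \<Rightarrow> real"
    by (rule PM.integrable_const_bound[where B = 1])
       (use smm soft_minmax_bounds[OF fin(1,2) that] in \<open>auto simp: abs_of_pos\<close>)
  have main: "measure M ?E * (1 - exp (- (L * exp (- real (card Q))))) \<le> measure M ?U + real (card P) * (L * exp (- L))"
    if L: "1 \<le> L" "1 / \<delta> \<le> L" for L
  proof -
    let ?X = "\<lambda>\<omega>. soft_minmax P Q L s (\<lambda>p. \<Sum>r\<in>R. c p r * \<omega> r)"
    let ?Y = "\<lambda>\<omega>. soft_minmax P Q L s (\<lambda>p. \<Sum>r\<in>R. d p r * \<omega> r)"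
    note b = soft_minmax_bounds[OF fin(1,2) L(1)]
    have "measure M ?E * (1 - exp (- (L * exp (- real (card Q))))) = (\<integral>\<omega>. indicator ?E \<omega> * (1 - exp (- (L * exp (- real (card Q))))) \<partial>M)"
      by simp
    also have "\<dots> \<le> (\<integral>\<omega>. 1 - ?X \<omega> \<partial>M)"
    proof (rule integral_mono)
      show "indicator ?E \<omega> * (1 - exp (- (L * exp (- real (card Q))))) \<le> 1 - ?X \<omega>" if "\<omega> \<in> space M" for \<omega>
      proof (cases "\<omega> \<in> ?E")
        case True
        then obtain a where "a \<in> P" "\<And>b. b \<in> Q \<Longrightarrow> (\<Sum>r\<in>R. c (a, b) r * \<omega> r) \<le> - s - \<delta>" by blast
        from soft_minmax_le[OF fin(1,2) L(1) \<delta> L(2) this(1), where z = "\<lambda>p. \<Sum>r\<in>R. c p r * \<omega> r"] this(2) True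
        show ?thesis by simp
      next
        case False thus ?thesis using b(2)[where s = s and z = "\<lambda>p. \<Sum>r\<in>R. c p r * \<omega> r"] by simp
      qed
    qed (use smi[OF L(1)] E in \<open>auto simp: PM.emeasure_finite less_top[symmetric]\<close>)
    also have "\<dots> \<le> (\<integral>\<omega>. 1 - ?Y \<omega> \<partial>M)"
      using soft_minmax_compare[OF fin(1,2) L(1) fin(3) orth cov cov_eq, where s = s] smi[OF L(1)]
      by (simp add: M_def[symmetric] PM.prob_space)
    also have "\<dots> \<le> (\<integral>\<omega>. indicator ?U \<omega> + real (card P) * (L * exp (- L)) \<partial>M)"
    proof (rule integral_mono)
      show "1 - ?Y \<omega> \<le> indicator ?U \<omega> + real (card P) * (L * exp (- L))" if "\<omega> \<in> space M" for \<omega>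
      proof (cases "\<omega> \<in> ?U")
        case True
        have "0 \<le> real (card P) * (L * exp (- L))" using L by simp
        thus ?thesis using True b(1)[where s = s and z = "\<lambda>p. \<Sum>r\<in>R. d p r * \<omega> r"] by simp
      next
        case False
        have "\<exists>b\<in>Q. - s + \<delta> \<le> (\<Sum>r\<in>R. d (a, b) r * \<omega> r)" if "a \<in> P" for a
          using False \<open>\<omega> \<in> space M\<close> that by (force simp: not_le)
        from soft_minmax_ge[OF fin(1,2) L(1) \<delta>, where s = s and z = "\<lambda>p. \<Sum>r\<in>R. d p r * \<omega> r", OF this] False
        show ?thesis by simp
      qed
    qed (use smi[OF L(1)] U in \<open>auto simp: PM.emeasure_finite less_top[symmetric]\<close>)
    also have "\<dots> = measure M ?U + real (card P) * (L * exp (- L))"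
      using U by (simp add: PM.emeasure_finite less_top[symmetric] PM.prob_space)
    finally show ?thesis .
  qed
  have l0: "((\<lambda>L::real. exp (- (L * C))) \<longlongrightarrow> 0) at_top" if "0 < C" for C :: real
  proof -
    have "filterlim (\<lambda>L::real. - (L * C)) at_bot at_top"
      using that by (intro filterlim_uminus_at_bot_at_top[THEN filterlim_compose]
        filterlim_at_top_mult_tendsto_pos[OF tendsto_const] filterlim_ident)
    thus ?thesis by (rule filterlim_compose[OF exp_at_bot])
  qed
  have l1: "((\<lambda>L::real. L * exp (- L)) \<longlongrightarrow> 0) at_top"
    using tendsto_power_div_exp_0[of 1] by (simp add: exp_minus divide_inverse)
  show ?thesis
  proof (rule tendsto_le[where F = at_top])
    show "((\<lambda>L. measure M ?U + real (card P) * (L * exp (- L))) \<longlongrightarrow> measure M ?U) at_top"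
      using tendsto_add[OF tendsto_const tendsto_mult_right_zero[OF l1, of "real (card P)"], of "measure M ?U"] by simp
    show "((\<lambda>L. measure M ?E * (1 - exp (- (L * exp (- real (card Q)))))) \<longlongrightarrow> measure M ?E) at_top"
      using tendsto_mult[OF tendsto_const tendsto_diff[OF tendsto_const l0[of "exp (- real (card Q))"]], of "measure M ?E" 1] by simp
    show "\<forall>\<^sub>F L in at_top. measure M ?E * (1 - exp (- (L * exp (- real (card Q))))) \<le> measure M ?U + real (card P) * (L * exp (- L))"
      using eventually_ge_at_top[of 1] eventually_ge_at_top[of "1 / \<delta>"] by eventually_elim (rule main)
  qed simp
qed

section \<open>Unit vectors and finite nets\<close>

definition unit_vecs :: "nat \<Rightarrow> (nat \<Rightarrow> real) set" where
  "unit_vecs n = {u \<in> vecs n. (\<Sum>j<n. (u j)\<^sup>2) = 1}"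

lemma unit_vecs_abs_le: "u \<in> unit_vecs n \<Longrightarrow> \<bar>u j\<bar> \<le> 1"
proof (cases "j < n")
  case True
  assume "u \<in> unit_vecs n"
  hence "(u j)\<^sup>2 \<le> 1" using member_le_sum[of j "{..<n}" "\<lambda>j. (u j)\<^sup>2"] True by (simp add: unit_vecs_def)
  thus ?thesis by (simp add: abs_square_le_1)
qed (auto simp: unit_vecs_def vecs_def)

lemma unit_vecs_inner_le: "u \<in> unit_vecs n \<Longrightarrow> v \<in> unit_vecs n \<Longrightarrow> (\<Sum>j<n. u j * v j) \<le> 1"
proof -
  assume uv: "u \<in> unit_vecs n" "v \<in> unit_vecs n"
  have "(\<Sum>j<n. u j * v j) \<le> (\<Sum>j<n. ((u j)\<^sup>2 + (v j)\<^sup>2) / 2)"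
    using sum_squares_bound by (intro sum_mono) (simp add: field_simps)
  also have "\<dots> = 1" using uv by (simp add: sum_divide_distrib[symmetric] sum.distrib unit_vecs_def)
  finally show ?thesis .
qed

text \<open>Rounding \<open>N * a j\<close> down sorts \<open>P\<close> into finitely many classes.
  Representatives are taken from \<open>P\<close> itself, so statements about all of
  \<open>P\<close>, or about existence in \<open>P\<close>, pass to or from the net without a second
  approximation.\<close>

lemma unit_vecs_finite_net:
  assumes P: "P \<subseteq> unit_vecs n" and N: "0 < (N::real)"
  obtains P' where "P' \<subseteq> P" "finite P'" "\<And>a. a \<in> P \<Longrightarrow> \<exists>a'\<in>P'. \<forall>j. \<bar>a' j - a j\<bar> \<le> 1 / N"
proof -
  define f where "f = (\<lambda>a :: nat \<Rightarrow> real. \<lambda>j\<in>{..<n}. \<lfloor>N * a j\<rfloor>)"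
  have "f ` P \<subseteq> PiE {..<n} (\<lambda>_. {\<lfloor>-N\<rfloor>..\<lfloor>N\<rfloor>})"
  proof
    fix x assume "x \<in> f ` P"
    then obtain a where a: "a \<in> P" "x = f a" by blast
    have "\<lfloor>N * a j\<rfloor> \<in> {\<lfloor>-N\<rfloor>..\<lfloor>N\<rfloor>}" for j
    proof -
      have "\<bar>a j\<bar> \<le> 1" using a P unit_vecs_abs_le by blast
      hence "-N \<le> N * a j" "N * a j \<le> N"
        using N mult_left_mono[of "-1" "a j" N] mult_left_mono[of "a j" 1 N] by auto
      thus ?thesis by (auto intro: floor_mono)
    qed
    thus "x \<in> PiE {..<n} (\<lambda>_. {\<lfloor>-N\<rfloor>..\<lfloor>N\<rfloor>})" using a by (auto simp: f_def)
  qed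
  hence "finite (f ` P)" by (rule finite_subset) (auto intro: finite_PiE)
  from finite_subset_image[OF this order_refl] obtain P' where P': "P' \<subseteq> P" "finite P'" "f ` P = f ` P'" by blast
  show ?thesis
  proof (rule that[OF P'(1,2)])
    fix a assume a: "a \<in> P"
    then obtain a' where a': "a' \<in> P'" "f a' = f a" using P'(3) by (metis imageE imageI)
    have "\<bar>a' j - a j\<bar> \<le> 1 / N" for j
    proof (cases "j < n")
      case True
      have "\<lfloor>N * a' j\<rfloor> = \<lfloor>N * a j\<rfloor>" using fun_cong[OF a'(2), of j] True by (simp add: f_def)
      hence "\<bar>N * a' j - N * a j\<bar> \<le> 1" by linarith
      thus ?thesis using N by (simp add: right_diff_distrib[symmetric] abs_mult pos_le_divide_eq mult.commute)
    next
      case False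
      have "a \<in> vecs n" "a' \<in> vecs n" using a a'(1) P P'(1) by (auto simp: unit_vecs_def)
      thus ?thesis using False N by (simp add: vecs_def)
    qed
    thus "\<exists>a'\<in>P'. \<forall>j. \<bar>a' j - a j\<bar> \<le> 1 / N" using a'(1) by blast
  qed
qed

section \<open>Gordon's inequality for unit vectors\<close>

lemma measure_PiM_stdn_reindex:
  assumes f: "inj_on f L" "f \<in> L \<rightarrow> R" and E: "E \<in> sets (gaussian L)"
  defines "E' \<equiv> {\<omega> \<in> space (gaussian R). (\<lambda>r\<in>L. \<omega> (f r)) \<in> E}"
  shows "E' \<in> sets (gaussian R)"
    and "measure (gaussian R) E' = measure (gaussian L) E"
proof -
  let ?R = "gaussian R" and ?L = "gaussian L"
  let ?g = "\<lambda>\<omega>. \<lambda>r\<in>L. \<omega> (f r)"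
  have g: "?g \<in> measurable ?R ?L"
    using f(2) by (intro measurable_restrict measurable_component_singleton) auto
  have E': "E' = ?g -` E \<inter> space ?R" by (auto simp: E'_def)
  show "E' \<in> sets ?R" unfolding E' using g E by (rule measurable_sets)
  have "distr ?R ?L ?g = ?L"
    by (rule distr_PiM_reindex[of R "\<lambda>_. stdn" f L, OF prob_space_stdn f])
  hence "measure ?L E = measure (distr ?R ?L ?g) E" by simp
  also have "\<dots> = measure ?R E'" unfolding E' by (rule measure_distr[OF g E])
  finally show "measure ?R E' = measure ?L E" by simp
qed

text \<open>Independence of one coordinate from the others; it gives the price of conditioning on
  the added scalar.\<close>

lemma measure_PiM_stdn_insert:
  assumes K: "finite K" "r \<notin> K" and B: "B \<in> sets (gaussian K)" and D: "D \<in> sets borel"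
  defines "E \<equiv> {\<omega> \<in> space (gaussian (insert r K)). restrict \<omega> K \<in> B \<and> \<omega> r \<in> D}"
  shows "E \<in> sets (gaussian (insert r K))"
    and "measure (gaussian (insert r K)) E
      = measure (gaussian K) B * measure stdn D"
proof -
  let ?R = "gaussian (insert r K)" and ?K = "gaussian K"
  interpret product_prob_space "\<lambda>_. stdn" "insert r K" by (rule product_prob_space_stdn)
  have g: "(\<lambda>\<omega>. restrict \<omega> K) \<in> measurable ?R ?K"
    by (intro measurable_restrict_subset) auto
  have r: "(\<lambda>\<omega>. \<omega> r) \<in> measurable ?R borel"
    using measurable_component_singleton[of r "insert r K" "\<lambda>_. stdn"] by simp
  have "E = ((\<lambda>\<omega>. restrict \<omega> K) -` B \<inter> space ?R) \<inter> ((\<lambda>\<omega>. \<omega> r) -` D \<inter> space ?R)" by (auto simp: E_def)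
  also have "\<dots> \<in> sets ?R" using measurable_sets[OF g B] measurable_sets[OF r D] by blast
  finally show E: "E \<in> sets ?R" .
  have "measure ?R E = (\<integral>\<omega>. indicator E \<omega> \<partial>?R)" using E by simp
  also have "\<dots> = (\<integral>x. (\<integral>y. indicator E (x(r := y)) \<partial>stdn) \<partial>?K)"
    using E by (intro product_integral_insert K) (auto simp: less_top[symmetric])
  also have "\<dots> = (\<integral>x. indicator B x * measure stdn D \<partial>?K)"
  proof (intro Bochner_Integration.integral_cong refl)
    fix x assume x: "x \<in> space ?K"
    have "restrict (x(r := y)) K = x" for y
      using x K(2) by (auto simp: space_PiM fun_eq_iff PiE_def extensional_def)
    moreover have "x(r := y) \<in> space ?R" for y
      using x by (auto simp: space_PiM PiE_def extensional_def)
    ultimately have "(\<integral>y. indicator E (x(r := y)) \<partial>stdn) = (\<integral>y. indicat_real B x * indicator D y \<partial>stdn)"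
      by (intro Bochner_Integration.integral_cong refl) (auto simp: E_def indicator_def)
    thus "(\<integral>y. indicator E (x(r := y)) \<partial>stdn) = indicator B x * measure stdn D"
      using D by simp
  qed
  also have "\<dots> = measure ?K B * measure stdn D" using B by simp
  finally show "measure ?R E = measure ?K B * measure stdn D" .
qed

section \<open>The two processes on a bordered matrix\<close>

lemma sum_bordered_matrix:
  fixes f :: "nat \<times> nat \<Rightarrow> real"
  shows "(\<Sum>r\<in>{..<Suc m} \<times> {..<Suc n}. f r) =
    (\<Sum>i<m. \<Sum>j<n. f (i, j)) + (\<Sum>i<m. f (i, n)) + (\<Sum>j<n. f (m, j)) + f (m, n)"
proof -
  have "(\<Sum>r\<in>{..<Suc m} \<times> {..<Suc n}. f r) = (\<Sum>i<Suc m. \<Sum>j<Suc n. f (i, j))"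
    by (simp add: sum.cartesian_product del: sum.lessThan_Suc)
  thus ?thesis by (simp add: sum.distrib)
qed

text \<open>Coefficients on a matrix with one extra row and column. Here the inner block carries the
  bilinear form and the corner the added scalar; \<open>bord_add\<close> places one linear form in
  the last column and the other in the last row. Disjoint supports give orthogonality at no
  cost.\<close>

definition bord_mult :: "nat \<Rightarrow> nat \<Rightarrow> (nat \<Rightarrow> real) \<times> (nat \<Rightarrow> real) \<Rightarrow> nat \<times> nat \<Rightarrow> real" where
  "bord_mult m n = (\<lambda>(a, b) (i, j). if i < m \<and> j < n then b i * a j else if i = m \<and> j = n then 1 else 0)"

definition bord_add :: "nat \<Rightarrow> nat \<Rightarrow> (nat \<Rightarrow> real) \<times> (nat \<Rightarrow> real) \<Rightarrow> nat \<times> nat \<Rightarrow> real" where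
  "bord_add m n = (\<lambda>(a, b) (i, j). if i < m \<and> j = n then b i else if i = m \<and> j < n then a j else 0)"

lemma sum_bord_mult:
  "(\<Sum>r\<in>{..<Suc m} \<times> {..<Suc n}. bord_mult m n (a, b) r * \<omega> r) = (\<Sum>i<m. \<Sum>j<n. b i * a j * \<omega> (i, j)) + \<omega> (m, n)"
  unfolding sum_bordered_matrix by (simp add: bord_mult_def)

lemma sum_bord_add:
  "(\<Sum>r\<in>{..<Suc m} \<times> {..<Suc n}. bord_add m n (a, b) r * \<omega> r) = (\<Sum>i<m. b i * \<omega> (i, n)) + (\<Sum>j<n. a j * \<omega> (m, j))"
  unfolding sum_bordered_matrix by (simp add: bord_add_def)

text \<open>The summand 1 is the contribution of the corner. Minus the covariance of
  \<open>bord_add\<close> this is the product of 1 - <b,b'> and 1 - <a,a'>, which is nonnegative on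
  unit vectors and 0 for a = a': exactly the covariance hypotheses of the comparison.\<close>

lemma cov_bord_mult:
  "(\<Sum>r\<in>{..<Suc m} \<times> {..<Suc n}. bord_mult m n (a, b) r * bord_mult m n (a', b') r) =
    (\<Sum>i<m. b i * b' i) * (\<Sum>j<n. a j * a' j) + 1"
  unfolding sum_bord_mult sum_product by (auto simp: bord_mult_def intro!: sum.cong)

lemma cov_bord_add:
  "(\<Sum>r\<in>{..<Suc m} \<times> {..<Suc n}. bord_add m n (a, b) r * bord_add m n (a', b') r) =
    (\<Sum>i<m. b i * b' i) + (\<Sum>j<n. a j * a' j)"
  unfolding sum_bord_add by (simp add: bord_add_def)

lemma bord_orth:
  "(\<Sum>r\<in>{..<Suc m} \<times> {..<Suc n}. bord_mult m n (a, b) r * bord_add m n (a', b') r) = 0"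
  unfolding sum_bord_mult by (simp add: bord_add_def)

text \<open>The corner is independent of the block, so asking it to be below -1 multiplies the
  probability of \<open>B\<close> by \<open>measure stdn {..<-1}\<close> and creates a margin for
  the net errors. \<open>U\<close> only has to contain the event of the linear process, so that
  event itself need not be measurable.\<close>

lemma gordon_comparison:
  assumes PU: "P \<subseteq> unit_vecs n" and QU: "Q \<subseteq> unit_vecs m"
    and B: "B \<in> sets (gauss_mat m n)"
      "\<And>A. A \<in> B \<Longrightarrow> \<exists>a\<in>P. \<forall>b\<in>Q. (\<Sum>i<m. \<Sum>j<n. b i * a j * A (i, j)) \<le> 0"
    and U: "U \<in> sets (gauss_mat (Suc m) (Suc n))"
      "\<And>\<omega> a. \<omega> \<in> space (gauss_mat (Suc m) (Suc n)) \<Longrightarrow> a \<in> P \<Longrightarrow>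
        (\<And>b. b \<in> Q \<Longrightarrow> (\<Sum>i<m. b i * \<omega> (i, n)) + (\<Sum>j<n. a j * \<omega> (m, j)) \<le> 0) \<Longrightarrow> \<omega> \<in> U"
  shows "measure (gauss_mat m n) B * measure stdn {..<-1} \<le> measure (gauss_mat (Suc m) (Suc n)) U"
proof -
  define R where "R = {..<Suc m} \<times> {..<Suc n}"
  define K where "K = {..<m} \<times> {..<n}"
  define M where "M = gaussian R"
  have fin: "finite R" "finite K" "(m, n) \<notin> K" "insert (m, n) K \<subseteq> R" by (auto simp: R_def K_def)
  interpret product_prob_space "\<lambda>_. stdn" R by (rule product_prob_space_stdn)
  interpret PM: prob_space M unfolding M_def by (rule P.prob_space_axioms)
  have gM: "gauss_mat (Suc m) (Suc n) = M" and gK: "gauss_mat m n = gaussian K"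
    by (simp_all add: gauss_mat_def M_def R_def K_def)
  have comp[measurable]: "(\<lambda>\<omega>. \<omega> r) \<in> borel_measurable M" if "r \<in> R" for r
    using measurable_component_singleton[OF that, of "\<lambda>_. stdn"] by (simp add: M_def)
  define B' where "B' = {\<omega> \<in> space M. restrict \<omega> K \<in> B \<and> \<omega> (m, n) < -1}"
  define E where "E = {\<omega> \<in> space (PiM (insert (m, n) K) (\<lambda>_. stdn)). restrict \<omega> K \<in> B \<and> \<omega> (m, n) \<in> {..<-1}}"
  note E = measure_PiM_stdn_insert[OF fin(2,3) B(1)[unfolded gK], of "{..<-1}", folded E_def]
  have "B' = {\<omega> \<in> space (gaussian R). (\<lambda>r\<in>insert (m, n) K. \<omega> (id r)) \<in> E}"
    using fin(3,4) by (auto simp: B'_def E_def M_def space_PiM PiE_def extensional_def restrict_def fun_eq_iff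
        cong: if_cong)
  moreover have "id \<in> insert (m, n) K \<rightarrow> R" using fin(4) by auto
  ultimately
  have B': "B' \<in> sets M" "measure M B' = measure (gauss_mat m n) B * measure stdn {..<-1}"
    using measure_PiM_stdn_reindex[of id "insert (m, n) K" R E] E by (simp_all add: M_def gK)
  define C where "C = (\<integral>\<omega>. (\<Sum>r\<in>R. \<bar>\<omega> r\<bar>) \<partial>M)"
  have intS: "integrable M (\<lambda>\<omega>. \<Sum>r\<in>R. \<bar>\<omega> r\<bar>)"
    unfolding M_def by (intro Bochner_Integration.integrable_sum integrable_PiM_stdn_component)
  have main: "measure M B' \<le> measure M U + 2 * (C / (real N / 4))" if N: "0 < N" for N :: nat
  proof -
    \<comment> \<open>Off \<open>T\<close>, moving a unit vector to its neighbour in the net changes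
      either process by at most 1/N times N/4, that is 1/4. By Markov's inequality \<open>T\<close>
      has probability of order 1/N.\<close>
    define T where "T = {\<omega> \<in> space M. real N / 4 \<le> (\<Sum>r\<in>R. \<bar>\<omega> r\<bar>)}"
    have T: "T \<in> sets M" unfolding T_def using borel_measurable_integrable[OF intS] by measurable
    have mT: "measure M T \<le> C / (real N / 4)"
      unfolding T_def C_def using N intS
      by (intro integral_Markov_inequality_measure[where A = "{}"]) (auto intro!: sum_nonneg)
    obtain P' where P': "P' \<subseteq> P" "finite P'" "\<And>a. a \<in> P \<Longrightarrow> \<exists>a'\<in>P'. \<forall>j. \<bar>a' j - a j\<bar> \<le> 1 / real N"
      using unit_vecs_finite_net[OF PU, of "real N"] N by auto
    obtain Q' where Q': "Q' \<subseteq> Q" "finite Q'" "\<And>b. b \<in> Q \<Longrightarrow> \<exists>b'\<in>Q'. \<forall>j. \<bar>b' j - b j\<bar> \<le> 1 / real N"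
      using unit_vecs_finite_net[OF QU, of "real N"] N by auto
    \<comment> \<open>The levels are -1/2 and -1/4. Before the comparison -1 + 1/4 lies below -1/2;
      after it -1/4 plus the net error 1/4 is still at most 0.\<close>
    let ?X = "{\<omega> \<in> space M. \<exists>a\<in>P'. \<forall>b\<in>Q'. (\<Sum>r\<in>R. bord_mult m n (a, b) r * \<omega> r) \<le> - (3/8) - 1/8}"
    let ?Y = "{\<omega> \<in> space M. \<exists>a\<in>P'. \<forall>b\<in>Q'. (\<Sum>r\<in>R. bord_add m n (a, b) r * \<omega> r) \<le> - (3/8) + 1/8}"
    have [measurable]: "(\<lambda>\<omega>. \<Sum>r\<in>R. f r * \<omega> r) \<in> borel_measurable M" for f :: "nat \<times> nat \<Rightarrow> real"
      by (intro borel_measurable_sum borel_measurable_times) auto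
    have XY: "?X \<in> sets M" "?Y \<in> sets M" using P'(2) Q'(2) by measurable
    have "measure M ?X \<le> measure M ?Y"
      unfolding M_def
    proof (rule gaussian_minmax_finite[OF P'(2) Q'(2) fin(1)])
      fix p q :: "(nat \<Rightarrow> real) \<times> (nat \<Rightarrow> real)"
      assume pq: "p \<in> P' \<times> Q'" "q \<in> P' \<times> Q'"
      obtain a b a' b' where e: "p = (a, b)" "q = (a', b')" by (cases p, cases q)
      have u: "a \<in> unit_vecs n" "a' \<in> unit_vecs n" "b \<in> unit_vecs m" "b' \<in> unit_vecs m"
        using pq P'(1) Q'(1) PU QU unfolding e by auto
      show "(\<Sum>r\<in>R. bord_mult m n p r * bord_add m n q r) = 0" unfolding e R_def by (rule bord_orth)
      have "0 \<le> (1 - (\<Sum>i<m. b i * b' i)) * (1 - (\<Sum>j<n. a j * a' j))"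
        using unit_vecs_inner_le u by (intro mult_nonneg_nonneg) auto
      thus "(\<Sum>r\<in>R. bord_add m n p r * bord_add m n q r) \<le> (\<Sum>r\<in>R. bord_mult m n p r * bord_mult m n q r)"
        unfolding e R_def cov_bord_mult cov_bord_add by (simp add: algebra_simps)
      assume "fst p = fst q"
      hence "(\<Sum>j<n. a j * a' j) = 1" using u unfolding e by (simp add: unit_vecs_def power2_eq_square)
      thus "(\<Sum>r\<in>R. bord_add m n p r * bord_add m n q r) = (\<Sum>r\<in>R. bord_mult m n p r * bord_mult m n q r)"
        unfolding e R_def cov_bord_mult cov_bord_add by simp
    qed simp
    \<comment> \<open>Only \<open>a\<close> is moved to the net; the points of \<open>Q'\<close>
      already belong to \<open>Q\<close>.\<close>
    have sub1: "B' \<subseteq> ?X \<union> T"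
    proof
      fix \<omega> assume \<omega>: "\<omega> \<in> B'"
      show "\<omega> \<in> ?X \<union> T"
      proof (cases "\<omega> \<in> T")
        case False
        hence S: "(\<Sum>r\<in>R. \<bar>\<omega> r\<bar>) < real N / 4" using \<omega> by (auto simp: T_def B'_def)
        obtain a where a: "a \<in> P" "\<And>b. b \<in> Q \<Longrightarrow> (\<Sum>i<m. \<Sum>j<n. b i * a j * restrict \<omega> K (i, j)) \<le> 0"
          using B(2)[of "restrict \<omega> K"] \<omega> by (auto simp: B'_def)
        obtain a' where a': "a' \<in> P'" "\<And>j. \<bar>a' j - a j\<bar> \<le> 1 / real N" using P'(3)[OF a(1)] by blast
        have "(\<Sum>r\<in>R. bord_mult m n (a', b) r * \<omega> r) \<le> - (3/8) - 1/8" if b: "b \<in> Q'" for b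
        proof -
          have bu: "\<bar>b i\<bar> \<le> 1" for i using b Q'(1) QU unit_vecs_abs_le by blast
          have "(\<Sum>i<m. \<Sum>j<n. b i * a' j * \<omega> (i, j)) \<le> (\<Sum>i<m. \<Sum>j<n. b i * a j * \<omega> (i, j) + 1 / real N * \<bar>\<omega> (i, j)\<bar>)"
          proof (intro sum_mono)
            fix i j
            have "\<bar>b i * ((a' j - a j) * \<omega> (i, j))\<bar> \<le> 1 * (1 / real N * \<bar>\<omega> (i, j)\<bar>)"
              unfolding abs_mult using bu a'(2) by (intro mult_mono) auto
            thus "b i * a' j * \<omega> (i, j) \<le> b i * a j * \<omega> (i, j) + 1 / real N * \<bar>\<omega> (i, j)\<bar>"
              by (simp add: algebra_simps)
          qed
          also have "\<dots> = (\<Sum>i<m. \<Sum>j<n. b i * a j * \<omega> (i, j)) + 1 / real N * (\<Sum>i<m. \<Sum>j<n. \<bar>\<omega> (i, j)\<bar>)"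
            by (simp add: sum.distrib sum_distrib_left)
          also have "\<dots> \<le> 0 + 1 / real N * (real N / 4)"
          proof (intro add_mono mult_left_mono)
            have "(\<Sum>i<m. \<Sum>j<n. b i * a j * \<omega> (i, j)) = (\<Sum>i<m. \<Sum>j<n. b i * a j * restrict \<omega> K (i, j))"
              by (intro sum.cong refl) (auto simp: K_def)
            also have "\<dots> \<le> 0" using a(2) b Q'(1) by blast
            finally show "(\<Sum>i<m. \<Sum>j<n. b i * a j * \<omega> (i, j)) \<le> 0" .
            have "(\<Sum>i<m. \<Sum>j<n. \<bar>\<omega> (i, j)\<bar>) \<le> (\<Sum>r\<in>R. \<bar>\<omega> r\<bar>)"
              unfolding R_def sum_bordered_matrix by (simp add: sum_nonneg add_nonneg_nonneg)
            thus "(\<Sum>i<m. \<Sum>j<n. \<bar>\<omega> (i, j)\<bar>) \<le> real N / 4" using S by simp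
          qed simp
          finally have "(\<Sum>i<m. \<Sum>j<n. b i * a' j * \<omega> (i, j)) \<le> 1 / 4"
            using N by simp
          moreover have "\<omega> (m, n) < -1" using \<omega> by (simp add: B'_def)
          ultimately show ?thesis unfolding R_def sum_bord_mult by linarith
        qed
        thus ?thesis using a'(1) \<omega> by (auto simp: B'_def)
      qed auto
    qed
    \<comment> \<open>Conversely, here \<open>a\<close> already lies in \<open>P\<close> and only
      \<open>b\<close> has to be moved.\<close>
    have sub2: "?Y \<subseteq> U \<union> T"
    proof
      fix \<omega> assume \<omega>: "\<omega> \<in> ?Y"
      show "\<omega> \<in> U \<union> T"
      proof (cases "\<omega> \<in> T")
        case False
        hence S: "(\<Sum>r\<in>R. \<bar>\<omega> r\<bar>) < real N / 4" using \<omega> by (auto simp: T_def)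
        obtain a where a: "a \<in> P'" "\<And>b. b \<in> Q' \<Longrightarrow> (\<Sum>r\<in>R. bord_add m n (a, b) r * \<omega> r) \<le> - (1/4)"
          using \<omega> by auto
        have "\<omega> \<in> U"
        proof (rule U(2))
          fix b assume "b \<in> Q"
          then obtain b' where b': "b' \<in> Q'" "\<And>j. \<bar>b' j - b j\<bar> \<le> 1 / real N" using Q'(3) by blast
          have "(\<Sum>i<m. b i * \<omega> (i, n)) \<le> (\<Sum>i<m. b' i * \<omega> (i, n) + 1 / real N * \<bar>\<omega> (i, n)\<bar>)"
          proof (intro sum_mono)
            fix i
            have "\<bar>(b' i - b i) * \<omega> (i, n)\<bar> \<le> 1 / real N * \<bar>\<omega> (i, n)\<bar>"
              unfolding abs_mult using b'(2) by (intro mult_mono) auto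
            thus "b i * \<omega> (i, n) \<le> b' i * \<omega> (i, n) + 1 / real N * \<bar>\<omega> (i, n)\<bar>"
              by (simp add: algebra_simps)
          qed
          also have "\<dots> = (\<Sum>i<m. b' i * \<omega> (i, n)) + 1 / real N * (\<Sum>i<m. \<bar>\<omega> (i, n)\<bar>)"
            by (simp add: sum.distrib sum_distrib_left)
          also have "\<dots> \<le> (\<Sum>i<m. b' i * \<omega> (i, n)) + 1 / real N * (real N / 4)"
          proof (intro add_left_mono mult_left_mono)
            have "(\<Sum>i<m. \<bar>\<omega> (i, n)\<bar>) \<le> (\<Sum>r\<in>R. \<bar>\<omega> r\<bar>)"
              unfolding R_def sum_bordered_matrix by (simp add: sum_nonneg add_nonneg_nonneg)
            thus "(\<Sum>i<m. \<bar>\<omega> (i, n)\<bar>) \<le> real N / 4" using S by simp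
          qed simp
          finally have "(\<Sum>i<m. b i * \<omega> (i, n)) \<le> (\<Sum>i<m. b' i * \<omega> (i, n)) + 1 / 4"
            using N by simp
          moreover have "(\<Sum>i<m. b' i * \<omega> (i, n)) + (\<Sum>j<n. a j * \<omega> (m, j)) \<le> - (1/4)"
            using a(2)[OF b'(1)] unfolding R_def sum_bord_add .
          ultimately show "(\<Sum>i<m. b i * \<omega> (i, n)) + (\<Sum>j<n. a j * \<omega> (m, j)) \<le> 0" by linarith
        qed (use a \<omega> P'(1) gM in auto)
        thus ?thesis by simp
      qed auto
    qed
    have "measure M B' \<le> measure M (?X \<union> T)" using sub1 XY T by (intro PM.finite_measure_mono) auto
    also have "\<dots> \<le> measure M ?X + measure M T" using XY T by (intro measure_Un_le)
    also note \<open>measure M ?X \<le> measure M ?Y\<close>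
    also have "measure M ?Y \<le> measure M (U \<union> T)" using sub2 U(1) gM T by (intro PM.finite_measure_mono) auto
    also have "\<dots> \<le> measure M U + measure M T" using U(1) gM T by (intro measure_Un_le) auto
    finally show ?thesis using mT by linarith
  qed
  have "measure M B' \<le> measure M U"
  proof (rule LIMSEQ_le[OF tendsto_const])
    have "(\<lambda>N. measure M U + 8 * C * (1 / real N)) \<longlonglongrightarrow> measure M U + 8 * C * 0"
      by (intro tendsto_intros lim_1_over_n)
    thus "(\<lambda>N. measure M U + 8 * C * (1 / real N)) \<longlonglongrightarrow> measure M U" by simp
    show "\<exists>N0. \<forall>N\<ge>N0. measure M B' \<le> measure M U + 8 * C * (1 / real N)"
    proof (intro exI[of _ 1] allI impI)
      fix N :: nat assume "1 \<le> N"
      hence "measure M B' \<le> measure M U + 2 * (C / (real N / 4))" by (intro main) simp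
      thus "measure M B' \<le> measure M U + 8 * C * (1 / real N)" by simp
    qed
  qed
  thus ?thesis using B'(2) gM by simp
qed

section \<open>The descent cone\<close>

text \<open>The one-sided directional derivative of the l1 norm in direction \<open>w\<close>, at
  any point supported on \<open>S\<close> with signs \<sigma>. It depends on the point only through
  its signs, which is why one cone serves all these vectors.\<close>

definition descent :: "nat \<Rightarrow> nat set \<Rightarrow> (nat \<Rightarrow> real) \<Rightarrow> (nat \<Rightarrow> real) \<Rightarrow> real" where
  "descent n S \<sigma> w = (\<Sum>j\<in>S. \<sigma> j * w j) + (\<Sum>j\<in>{..<n} - S. \<bar>w j\<bar>)"

definition descent_sphere :: "nat \<Rightarrow> nat set \<Rightarrow> (nat \<Rightarrow> real) \<Rightarrow> (nat \<Rightarrow> real) set" where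
  "descent_sphere n S \<sigma> = {w \<in> unit_vecs n. descent n S \<sigma> w \<le> 0}"

definition hits_kernel :: "nat \<Rightarrow> nat \<Rightarrow> nat set \<Rightarrow> (nat \<Rightarrow> real) \<Rightarrow> (nat \<times> nat \<Rightarrow> real) \<Rightarrow> bool" where
  "hits_kernel m n S \<sigma> A \<longleftrightarrow> (\<exists>w\<in>descent_sphere n S \<sigma>. \<forall>i<m. matvec n A w i = 0)"

lemma descent_scale: "0 \<le> c \<Longrightarrow> descent n S \<sigma> (\<lambda>j. c * w j) = c * descent n S \<sigma> w"
  by (simp add: descent_def abs_mult sum_distrib_left algebra_simps)

lemma descent_add_le: "descent n S \<sigma> (\<lambda>j. v j + w j) \<le> descent n S \<sigma> v + descent n S \<sigma> w"
proof -
  have "(\<Sum>j\<in>{..<n} - S. \<bar>v j + w j\<bar>) \<le> (\<Sum>j\<in>{..<n} - S. \<bar>v j\<bar> + \<bar>w j\<bar>)"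
    by (intro sum_mono abs_triangle_ineq)
  thus ?thesis by (simp add: descent_def sum.distrib algebra_simps)
qed

lemma matvec_scale: "matvec n A (\<lambda>j. c * w j) i = c * matvec n A w i"
  by (simp add: matvec_def sum_distrib_left mult_ac)

lemma matvec_add: "matvec n A (\<lambda>j. v j + w j) i = matvec n A v i + matvec n A w i"
  by (simp add: matvec_def sum.distrib algebra_simps)

lemma unit_vecs_normalize:
  assumes "w \<in> vecs n" "w \<noteq> (\<lambda>_. 0)"
  obtains r where "0 < r" "r\<^sup>2 = (\<Sum>j<n. (w j)\<^sup>2)" "(\<lambda>j. (1 / r) * w j) \<in> unit_vecs n"
proof -
  define r where "r = sqrt (\<Sum>j<n. (w j)\<^sup>2)"
  obtain j where j: "w j \<noteq> 0" using assms(2) by auto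
  hence "j < n" using assms(1) by (auto simp: vecs_def not_le[symmetric])
  hence "(w j)\<^sup>2 \<le> (\<Sum>j<n. (w j)\<^sup>2)" by (intro member_le_sum) auto
  hence pos: "0 < (\<Sum>j<n. (w j)\<^sup>2)" using j by (smt (verit) zero_less_power2)
  hence r: "0 < r" "r\<^sup>2 = (\<Sum>j<n. (w j)\<^sup>2)" by (auto simp: r_def)
  have "(\<Sum>j<n. ((1 / r) * w j)\<^sup>2) = (\<Sum>j<n. (w j)\<^sup>2) / r\<^sup>2"
    by (simp add: power_mult_distrib power_divide sum_divide_distrib)
  hence "(\<lambda>j. (1 / r) * w j) \<in> unit_vecs n"
    using assms(1) r pos by (simp add: unit_vecs_def vecs_def)
  thus ?thesis using r that by blast
qed

lemma no_hit_descent_pos: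
  assumes "\<not> hits_kernel m n S \<sigma> A" "w \<in> vecs n" "w \<noteq> (\<lambda>_. 0)" "\<And>i. i < m \<Longrightarrow> matvec n A w i = 0"
  shows "0 < descent n S \<sigma> w"
proof (rule ccontr)
  assume neg: "\<not> 0 < descent n S \<sigma> w"
  obtain r where r: "0 < r" "(\<lambda>j. (1 / r) * w j) \<in> unit_vecs n" using unit_vecs_normalize[OF assms(2,3)] by blast
  have "descent n S \<sigma> (\<lambda>j. (1 / r) * w j) = (1 / r) * descent n S \<sigma> w" using r(1) by (intro descent_scale) simp
  also have "\<dots> \<le> 0" using neg r(1) by (simp add: divide_le_0_iff)
  finally have "(\<lambda>j. (1 / r) * w j) \<in> descent_sphere n S \<sigma>" using r by (simp add: descent_sphere_def)
  moreover have "matvec n A (\<lambda>j. (1 / r) * w j) i = 0" if "i < m" for i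
    unfolding matvec_scale using assms(4)[OF that] by simp
  ultimately show False using assms(1) unfolding hits_kernel_def by blast
qed

lemma l1norm_split:
  assumes "S \<subseteq> {..<n}"
  shows "l1norm n u = (\<Sum>j\<in>S. \<bar>u j\<bar>) + (\<Sum>j\<in>{..<n} - S. \<bar>u j\<bar>)"
  unfolding l1norm_def using sum.subset_diff[OF assms, of "\<lambda>j. \<bar>u j\<bar>"] by (simp add: add.commute)

text \<open>By convexity the norm grows at least by the directional derivative, so a trivial
  intersection gives uniqueness for every x. For the converse an x is built for which the norm is
  exactly linear along the given kernel vector.\<close>

lemma all_unique_iff_no_hit:
  assumes S: "S \<subseteq> {..<n}" and \<sigma>: "\<And>j. j \<in> S \<Longrightarrow> \<sigma> j \<in> {-1, 1}"
  shows "(\<forall>x\<in>sign_vecs S \<sigma>. unique_l1_min m n A x) \<longleftrightarrow> \<not> hits_kernel m n S \<sigma> A"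
proof
  assume nh: "\<not> hits_kernel m n S \<sigma> A"
  show "\<forall>x\<in>sign_vecs S \<sigma>. unique_l1_min m n A x"
  proof
    fix x assume x: "x \<in> sign_vecs S \<sigma>"
    have xv: "x \<in> vecs n" using x S by (auto simp: sign_vecs_def vecs_def)
    have "l1norm n x < l1norm n u"
      if u: "u \<in> vecs n" "u \<noteq> x" "\<forall>i<m. matvec n A u i = matvec n A x i" for u
    proof -
      define w where "w = (\<lambda>j. u j - x j)"
      have "w \<in> vecs n" using u xv by (auto simp: vecs_def w_def)
      moreover have "w \<noteq> (\<lambda>_. 0)" using u(2) by (auto simp: w_def fun_eq_iff)
      moreover have "matvec n A w i = 0" if "i < m" for i
        using u(3) that by (simp add: w_def matvec_def sum_subtractf right_diff_distrib)
      ultimately have pos: "0 < descent n S \<sigma> w" using nh by (intro no_hit_descent_pos) auto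
      have "(\<Sum>j\<in>S. \<bar>x j\<bar> + \<sigma> j * w j) \<le> (\<Sum>j\<in>S. \<bar>u j\<bar>)"
      proof (rule sum_mono)
        fix j assume j: "j \<in> S"
        have "\<sigma> j = sgn (x j)" using x j by (simp add: sign_vecs_def)
        hence "\<bar>x j\<bar> = \<sigma> j * x j" by (simp add: sgn_mult_self_eq abs_sgn mult.commute)
        hence "\<bar>x j\<bar> + \<sigma> j * w j = \<sigma> j * u j" by (simp add: w_def algebra_simps)
        also have "\<dots> \<le> \<bar>u j\<bar>" using \<sigma>[OF j] by auto
        finally show "\<bar>x j\<bar> + \<sigma> j * w j \<le> \<bar>u j\<bar>" .
      qed
      moreover have "(\<Sum>j\<in>{..<n} - S. \<bar>x j\<bar>) = 0" using x by (auto simp: sign_vecs_def)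
      moreover have "(\<Sum>j\<in>{..<n} - S. \<bar>u j\<bar>) = (\<Sum>j\<in>{..<n} - S. \<bar>w j\<bar>)"
        using x by (intro sum.cong refl) (auto simp: sign_vecs_def w_def)
      ultimately show ?thesis
        using pos by (simp add: l1norm_split[OF S] descent_def sum.distrib)
    qed
    thus "unique_l1_min m n A x" using xv by (auto simp: unique_l1_min_def)
  qed
next
  assume all: "\<forall>x\<in>sign_vecs S \<sigma>. unique_l1_min m n A x"
  show "\<not> hits_kernel m n S \<sigma> A"
  proof
    assume "hits_kernel m n S \<sigma> A"
    then obtain w where w: "w \<in> unit_vecs n" "descent n S \<sigma> w \<le> 0" "\<And>i. i < m \<Longrightarrow> matvec n A w i = 0"
      by (auto simp: hits_kernel_def descent_sphere_def)
    \<comment> \<open>The size |w j| + 1 prevents any sign change on \<open>S\<close> when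
      \<open>w\<close> is added, so the norm changes by exactly
      \<open>descent n S \<sigma> w\<close>.\<close>
    define x where "x = (\<lambda>j. if j \<in> S then \<sigma> j * (\<bar>w j\<bar> + 1) else 0)"
    define u where "u = (\<lambda>j. x j + w j)"
    have x: "x \<in> sign_vecs S \<sigma>"
      using \<sigma> by (force simp: sign_vecs_def x_def sgn_mult)
    have "x \<in> vecs n" using S by (auto simp: vecs_def x_def)
    hence "u \<in> vecs n" using w(1) by (auto simp: u_def vecs_def unit_vecs_def)
    moreover have "u \<noteq> x"
    proof
      assume "u = x"
      hence "w j = 0" for j by (simp add: u_def fun_eq_iff)
      thus False using w(1) by (simp add: unit_vecs_def)
    qed
    moreover have "\<forall>i<m. matvec n A u i = matvec n A x i" unfolding u_def matvec_add using w(3) by simp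
    ultimately have "l1norm n x < l1norm n u" using all x by (auto simp: unique_l1_min_def)
    moreover have "l1norm n u = l1norm n x + descent n S \<sigma> w"
    proof -
      have "(\<Sum>j\<in>S. \<bar>u j\<bar>) = (\<Sum>j\<in>S. \<bar>x j\<bar> + \<sigma> j * w j)"
      proof (rule sum.cong[OF refl])
        fix j assume j: "j \<in> S"
        show "\<bar>u j\<bar> = \<bar>x j\<bar> + \<sigma> j * w j" using \<sigma>[OF j] j by (auto simp: u_def x_def)
      qed
      thus ?thesis by (simp add: l1norm_split[OF S] descent_def sum.distrib u_def x_def)
    qed
    ultimately show False using w(2) by simp
  qed
qed

section \<open>Compactness and measurability\<close>

lemma compact_bounded_vecs:
  assumes "closed C" "\<And>v j. v \<in> C \<Longrightarrow> \<bar>v j\<bar> \<le> (r::real)"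
  shows "compact (C :: (nat \<Rightarrow> real) set)"
proof -
  \<comment> \<open>Tychonoff's theorem for the box; vectors are functions on all naturals with the
    product topology.\<close>
  have "compactin (product_topology (\<lambda>_. euclidean) UNIV) (PiE UNIV (\<lambda>_::nat. {-r..r}))"
    by (subst compactin_PiE) (auto simp: compactin_euclidean_iff)
  hence "compact (PiE UNIV (\<lambda>_::nat. {-r..r}))"
    by (simp add: euclidean_product_topology compactin_euclidean_iff)
  moreover have "C \<subseteq> PiE UNIV (\<lambda>_::nat. {-r..r})"
    using assms(2) by (force simp: abs_le_iff)
  ultimately show ?thesis using assms(1) by (metis compact_Int_closed inf.absorb_iff2 inf_commute)
qed

lemma continuous_on_coord [continuous_intros]: "continuous_on UNIV (\<lambda>v :: nat \<Rightarrow> real. v j)"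
  by (rule continuous_on_product_coordinates)

lemma closed_vecs: "closed (vecs n)"
  unfolding vecs_def by (intro closed_Collect_all closed_Collect_imp closed_Collect_eq open_Collect_const continuous_intros)

lemma continuous_descent: "continuous_on UNIV (descent n S \<sigma>)"
  unfolding descent_def by (intro continuous_intros)

lemma continuous_matvec: "continuous_on UNIV (\<lambda>w. matvec n A w i)"
  unfolding matvec_def by (intro continuous_intros)

lemma compact_descent_sphere: "compact (descent_sphere n S \<sigma>)"
proof (rule compact_bounded_vecs[where r = 1])
  have "descent_sphere n S \<sigma> = vecs n \<inter> {w. (\<Sum>j<n. (w j)\<^sup>2) = 1} \<inter> {w. descent n S \<sigma> w \<le> 0}"
    by (auto simp: descent_sphere_def unit_vecs_def)
  also have "closed \<dots>"
    by (intro closed_Int closed_vecs closed_Collect_eq closed_Collect_le continuous_intros continuous_descent)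
  finally show "closed (descent_sphere n S \<sigma>)" .
qed (auto simp: descent_sphere_def unit_vecs_abs_le)

text \<open>The squared length of A w attains its minimum on a compact set. This positive gap is the
  quantitative form of missing the kernel.\<close>

lemma descent_sphere_kernel_gap:
  assumes "\<not> hits_kernel m n S \<sigma> A"
  obtains \<mu> where "0 < \<mu>" "\<And>w. w \<in> descent_sphere n S \<sigma> \<Longrightarrow> \<mu> \<le> (\<Sum>i<m. (matvec n A w i)\<^sup>2)"
proof (cases "descent_sphere n S \<sigma> = {}")
  case True thus ?thesis using that[of 1] by simp
next
  case False
  have "continuous_on (descent_sphere n S \<sigma>) (\<lambda>w. \<Sum>i<m. (matvec n A w i)\<^sup>2)"
    by (rule continuous_on_subset[OF _ subset_UNIV]) (intro continuous_intros continuous_matvec)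
  from continuous_attains_inf[OF compact_descent_sphere False this]
  obtain v where v: "v \<in> descent_sphere n S \<sigma>"
    "\<And>w. w \<in> descent_sphere n S \<sigma> \<Longrightarrow> (\<Sum>i<m. (matvec n A v i)\<^sup>2) \<le> (\<Sum>i<m. (matvec n A w i)\<^sup>2)" by blast
  have "(\<Sum>i<m. (matvec n A v i)\<^sup>2) \<noteq> 0"
    using assms v(1) by (auto simp: hits_kernel_def sum_nonneg_eq_0_iff)
  moreover have "0 \<le> (\<Sum>i<m. (matvec n A v i)\<^sup>2)" by (intro sum_nonneg) auto
  ultimately show ?thesis using that[of "\<Sum>i<m. (matvec n A v i)\<^sup>2"] v(2) by simp
qed

text \<open>The existential over uncountably many \<open>w\<close> is replaced by finite nets of
  mesh 1/(N+1) for every N. A kernel vector has net neighbours that are nearly in the kernel; if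
  there is none, the gap contradicts such neighbours for large N.\<close>

lemma hits_kernel_measurable:
  "{A \<in> space (gauss_mat m n). hits_kernel m n S \<sigma> A} \<in> sets (gauss_mat m n)"
proof -
  have "\<exists>P'\<subseteq>descent_sphere n S \<sigma>. finite P' \<and> (\<forall>a\<in>descent_sphere n S \<sigma>. \<exists>a'\<in>P'. \<forall>j. \<bar>a' j - a j\<bar> \<le> 1 / real (Suc N))" for N
  proof -
    have "descent_sphere n S \<sigma> \<subseteq> unit_vecs n" by (auto simp: descent_sphere_def)
    from unit_vecs_finite_net[OF this, of "real (Suc N)"] show ?thesis by (metis of_nat_0_less_iff zero_less_Suc)
  qed
  then obtain F where F: "\<And>N. F N \<subseteq> descent_sphere n S \<sigma>" "\<And>N. finite (F N)"
    "\<And>N a. a \<in> descent_sphere n S \<sigma> \<Longrightarrow> \<exists>a'\<in>F N. \<forall>j. \<bar>a' j - a j\<bar> \<le> 1 / real (Suc N)" by metis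
  \<comment> \<open>Bounds how far one component of A w moves per unit of coordinatewise change in
    w.\<close>
  define T where "T = (\<lambda>A :: nat \<times> nat \<Rightarrow> real. \<Sum>i<m. \<Sum>j<n. \<bar>A (i, j)\<bar>)"
  have eq: "hits_kernel m n S \<sigma> A \<longleftrightarrow> (\<forall>N. \<exists>w\<in>F N. \<forall>i<m. \<bar>matvec n A w i\<bar> \<le> T A / real (Suc N))" for A
  proof
    assume "hits_kernel m n S \<sigma> A"
    then obtain w where w: "w \<in> descent_sphere n S \<sigma>" "\<And>i. i < m \<Longrightarrow> matvec n A w i = 0" by (auto simp: hits_kernel_def)
    show "\<forall>N. \<exists>w\<in>F N. \<forall>i<m. \<bar>matvec n A w i\<bar> \<le> T A / real (Suc N)"
    proof
      fix N
      obtain w' where w': "w' \<in> F N" "\<And>j. \<bar>w' j - w j\<bar> \<le> 1 / real (Suc N)" using F(3)[OF w(1)] by blast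
      have "\<bar>matvec n A w' i\<bar> \<le> T A / real (Suc N)" if i: "i < m" for i
      proof -
        have "\<bar>matvec n A w' i\<bar> = \<bar>matvec n A w' i - matvec n A w i\<bar>" using w(2)[OF i] by simp
        also have "\<dots> = \<bar>\<Sum>j<n. A (i, j) * (w' j - w j)\<bar>" by (simp add: matvec_def sum_subtractf right_diff_distrib)
        also have "\<dots> \<le> (\<Sum>j<n. \<bar>A (i, j)\<bar> * (1 / real (Suc N)))"
          by (rule order_trans[OF sum_abs sum_mono]) (unfold abs_mult, intro mult_left_mono w'(2), simp)
        also have "\<dots> = (\<Sum>j<n. \<bar>A (i, j)\<bar>) / real (Suc N)" by (simp add: sum_divide_distrib)
        also have "\<dots> \<le> T A / real (Suc N)"
          unfolding T_def using i by (intro divide_right_mono member_le_sum) (auto intro!: sum_nonneg)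
        finally show ?thesis .
      qed
      thus "\<exists>w\<in>F N. \<forall>i<m. \<bar>matvec n A w i\<bar> \<le> T A / real (Suc N)" using w'(1) by blast
    qed
  next
    assume *: "\<forall>N. \<exists>w\<in>F N. \<forall>i<m. \<bar>matvec n A w i\<bar> \<le> T A / real (Suc N)"
    show "hits_kernel m n S \<sigma> A"
    proof (rule ccontr)
      assume "\<not> hits_kernel m n S \<sigma> A"
      then obtain \<mu> where \<mu>: "0 < \<mu>" "\<And>w. w \<in> descent_sphere n S \<sigma> \<Longrightarrow> \<mu> \<le> (\<Sum>i<m. (matvec n A w i)\<^sup>2)"
        using descent_sphere_kernel_gap by blast
      have bd: "\<mu> \<le> real m * (T A / real (Suc N))\<^sup>2" for N
      proof -
        obtain w where w: "w \<in> F N" "\<And>i. i < m \<Longrightarrow> \<bar>matvec n A w i\<bar> \<le> T A / real (Suc N)" using * by blast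
        have "\<mu> \<le> (\<Sum>i<m. (matvec n A w i)\<^sup>2)" using \<mu>(2) F(1) w(1) by blast
        also have "\<dots> \<le> (\<Sum>i<m. (T A / real (Suc N))\<^sup>2)"
        proof (rule sum_mono)
          fix i assume "i \<in> {..<m}"
          hence "\<bar>matvec n A w i\<bar> ^ 2 \<le> (T A / real (Suc N))\<^sup>2" using w(2) by (intro power_mono) auto
          thus "(matvec n A w i)\<^sup>2 \<le> (T A / real (Suc N))\<^sup>2" by simp
        qed
        finally show ?thesis by simp
      qed
      have "(\<lambda>N. real m * (T A * (1 / real (Suc N)))\<^sup>2) \<longlonglongrightarrow> real m * (T A * 0)\<^sup>2"
        by (intro tendsto_intros LIMSEQ_Suc[OF lim_1_over_n])
      hence "(\<lambda>N. real m * (T A / real (Suc N))\<^sup>2) \<longlonglongrightarrow> 0" by simp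
      hence "\<mu> \<le> 0" by (rule LIMSEQ_le_const) (use bd in auto)
      thus False using \<mu>(1) by simp
    qed
  qed
  have [measurable]: "(\<lambda>A. A (i, j)) \<in> borel_measurable (gauss_mat m n)" if "i < m" "j < n" for i j
    using measurable_component_singleton[of "(i, j)" "{..<m} \<times> {..<n}" "\<lambda>_. stdn"] that
    by (simp add: gauss_mat_def)
  have T: "T \<in> borel_measurable (gauss_mat m n)"
    unfolding T_def by (intro borel_measurable_sum borel_measurable_abs) auto
  have mv: "(\<lambda>A. matvec n A w i) \<in> borel_measurable (gauss_mat m n)" if "i < m" for w i
    unfolding matvec_def using that by (intro borel_measurable_sum borel_measurable_times) auto
  have "{A \<in> space (gauss_mat m n). hits_kernel m n S \<sigma> A} =
     (\<Inter>N. \<Union>w\<in>F N. {A \<in> space (gauss_mat m n). \<forall>i\<in>{..<m}. \<bar>matvec n A w i\<bar> \<le> T A / real (Suc N)})"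
    unfolding eq by (auto simp: Ball_def simp del: of_nat_Suc)
  also have "\<dots> \<in> sets (gauss_mat m n)"
  proof (rule sets.countable_INT, rule image_subsetI, rule sets.finite_UN[OF F(2)])
    fix N w
    show "{A \<in> space (gauss_mat m n). \<forall>i\<in>{..<m}. \<bar>matvec n A w i\<bar> \<le> T A / real (Suc N)} \<in> sets (gauss_mat m n)"
      using T mv by (intro sets.sets_Collect_finite_All borel_measurable_le borel_measurable_abs borel_measurable_divide) auto
  qed simp
  finally show ?thesis .
qed

text \<open>On the cone itself |A v|^2 is minimal at 0 and yields no direction. The cone is
  therefore translated by a vector of negative \<open>descent\<close>, which exists because
  \<open>S\<close> is nonempty: the translate stays inside the cone but misses 0. The minimizer over
  it supplies y through its first order condition.\<close>

lemma no_hit_dual: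
  assumes S: "S \<subseteq> {..<n}" "S \<noteq> {}" and \<sigma>: "\<And>j. j \<in> S \<Longrightarrow> \<sigma> j \<in> {-1, 1}"
    and nh: "\<not> hits_kernel m n S \<sigma> A"
  shows "\<exists>y\<in>unit_vecs m. \<forall>w\<in>descent_sphere n S \<sigma>. (\<Sum>i<m. y i * matvec n A w i) \<le> 0"
proof -
  have finS: "finite S" using S(1) finite_subset by blast
  obtain \<mu> where \<mu>: "0 < \<mu>" "\<And>w. w \<in> descent_sphere n S \<sigma> \<Longrightarrow> \<mu> \<le> (\<Sum>i<m. (matvec n A w i)\<^sup>2)"
    using descent_sphere_kernel_gap[OF nh] by blast
  define G where "G = (\<lambda>v. \<Sum>i<m. (matvec n A v i)\<^sup>2)"
  define q where "q = (\<lambda>v :: nat \<Rightarrow> real. \<Sum>j<n. (v j)\<^sup>2)"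
  \<comment> \<open>The gap on the sphere, extended to the cone by homogeneity; it replaces
    compactness of the unbounded set \<open>V\<close>.\<close>
  have coer: "\<mu> * q w \<le> G w" if w: "w \<in> vecs n" "descent n S \<sigma> w \<le> 0" for w
  proof (cases "w = (\<lambda>_. 0)")
    case True thus ?thesis by (simp add: q_def G_def matvec_def)
  next
    case False
    obtain r where r: "0 < r" "r\<^sup>2 = q w" "(\<lambda>j. (1 / r) * w j) \<in> unit_vecs n"
      using unit_vecs_normalize[OF w(1) False] unfolding q_def by blast
    have "descent n S \<sigma> (\<lambda>j. (1 / r) * w j) \<le> 0"
      using r(1) w(2) by (subst descent_scale) (auto simp: divide_le_0_iff)
    hence "\<mu> \<le> (\<Sum>i<m. (matvec n A (\<lambda>j. (1 / r) * w j) i)\<^sup>2)" using r(3) by (intro \<mu>(2)) (simp add: descent_sphere_def)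
    also have "\<dots> = G w / r\<^sup>2"
      unfolding matvec_scale G_def by (simp add: power_mult_distrib power_divide sum_divide_distrib)
    finally show ?thesis using r(1) unfolding r(2)[symmetric] by (simp add: pos_le_divide_eq)
  qed
  \<comment> \<open>A point strictly inside the cone: its \<open>descent\<close> is - card S, and
    that of its negative is card S, so 0 is not in the translate.\<close>
  define w0 where "w0 = (\<lambda>j. if j \<in> S then - \<sigma> j else 0)"
  have w0v: "w0 \<in> vecs n" using S(1) by (auto simp: w0_def vecs_def)
  have \<sigma>2: "\<sigma> j * \<sigma> j = 1" if "j \<in> S" for j using \<sigma>[OF that] by auto
  have d0: "descent n S \<sigma> w0 = - real (card S)"
    using \<sigma>2 by (simp add: descent_def w0_def sum_negf)
  have d1: "descent n S \<sigma> (\<lambda>j. - w0 j) = real (card S)"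
    using \<sigma>2 by (simp add: descent_def w0_def)
  have cS: "0 < card S" using finS S(2) by (simp add: card_gt_0_iff)
  define V where "V = {v \<in> vecs n. descent n S \<sigma> (\<lambda>j. v j - w0 j) \<le> 0}"
  have VD: "descent n S \<sigma> v \<le> 0" if "v \<in> V" for v
    using descent_add_le[of n S \<sigma> "\<lambda>j. v j - w0 j" w0] that d0 by (simp add: V_def)
  \<comment> \<open>Outside \<open>K\<close> coercivity pushes \<open>G\<close> above its value at
    \<open>w0\<close>, so minimizing over this compact part amounts to minimizing over
    \<open>V\<close>.\<close>
  define K where "K = V \<inter> {v. q v \<le> G w0 / \<mu>}"
  have cq: "continuous_on UNIV q" unfolding q_def by (intro continuous_intros)
  have cd: "continuous_on UNIV (\<lambda>v. descent n S \<sigma> (\<lambda>j. v j - w0 j))"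
    unfolding descent_def by (intro continuous_intros)
  have "compact K"
  proof (rule compact_bounded_vecs)
    have "K = vecs n \<inter> {v. descent n S \<sigma> (\<lambda>j. v j - w0 j) \<le> 0} \<inter> {v. q v \<le> G w0 / \<mu>}"
      by (auto simp: K_def V_def)
    also have "closed \<dots>"
      by (intro closed_Int closed_vecs closed_Collect_le cq cd continuous_intros)
    finally show "closed K" .
    fix v j assume v: "v \<in> K"
    show "\<bar>v j\<bar> \<le> sqrt (G w0 / \<mu>)"
    proof (cases "j < n")
      case True
      hence "(v j)\<^sup>2 \<le> q v" unfolding q_def by (intro member_le_sum) auto
      also have "\<dots> \<le> G w0 / \<mu>" using v by (simp add: K_def)
      finally show ?thesis by (simp add: real_le_rsqrt)
    next
      case False
      hence "v j = 0" using v by (auto simp: K_def V_def vecs_def)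
      moreover have "0 \<le> G w0 / \<mu>" using \<mu>(1) by (simp add: G_def sum_nonneg)
      ultimately show ?thesis by simp
    qed
  qed
  moreover have w0K: "w0 \<in> K"
    using coer[OF w0v] d0 \<mu>(1) w0v by (simp add: K_def V_def pos_le_divide_eq mult.commute descent_def)
  moreover have "continuous_on K G"
    by (rule continuous_on_subset[OF _ subset_UNIV]) (unfold G_def, intro continuous_intros continuous_matvec)
  ultimately obtain v where v: "v \<in> K" "\<And>u. u \<in> K \<Longrightarrow> G v \<le> G u"
    using continuous_attains_inf[of K G] by blast
  have vmin: "G v \<le> G u" if u: "u \<in> V" for u
  proof (cases "u \<in> K")
    case False
    hence "G w0 / \<mu> < q u" using u by (simp add: K_def)
    hence "G w0 < \<mu> * q u" using \<mu>(1) by (simp add: pos_divide_less_eq mult.commute)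
    also have "\<dots> \<le> G u" using u VD[OF u] by (intro coer) (auto simp: V_def)
    finally show ?thesis using v(2)[OF w0K] by simp
  qed (use v in auto)
  have vV: "v \<in> V" using v(1) by (simp add: K_def)
  have "v \<noteq> (\<lambda>_. 0)" using vV d1 cS by (auto simp: V_def)
  then obtain r0 where "0 < r0" "r0\<^sup>2 = q v"
    using unit_vecs_normalize[of v n] vV unfolding q_def V_def by blast
  hence "0 < q v" by (metis zero_less_power)
  hence "0 < \<mu> * q v" using \<mu>(1) by simp
  also have "\<dots> \<le> G v" using vV VD[OF vV] by (intro coer) (auto simp: V_def)
  finally have Gv: "0 < G v" .
  \<comment> \<open>The normalized negative image of the minimizer.\<close>
  define y where "y = (\<lambda>i. if i < m then - matvec n A v i / sqrt (G v) else 0)"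
  have "(\<Sum>i<m. (y i)\<^sup>2) = (\<Sum>i<m. (matvec n A v i)\<^sup>2 / G v)"
    using Gv by (intro sum.cong refl) (auto simp: y_def power_divide)
  also have "\<dots> = 1" using Gv by (simp add: sum_divide_distrib[symmetric] G_def)
  finally have yu: "y \<in> unit_vecs m" by (simp add: unit_vecs_def vecs_def y_def)
  have "(\<Sum>i<m. y i * matvec n A w i) \<le> 0" if w: "w \<in> descent_sphere n S \<sigma>" for w
  proof -
    define H where "H = (\<Sum>i<m. matvec n A v i * matvec n A w i)"
    \<comment> \<open>\<open>V\<close> is stable under adding cone vectors, so moving from
      \<open>v\<close> along \<open>w\<close> cannot decrease \<open>G\<close>; the inequality is
      this divided by \<open>t\<close>.\<close>
    have ineq: "0 \<le> 2 * H + t * G w" if t: "0 < t" for t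
    proof -
      have "(\<lambda>j. v j + t * w j) \<in> V"
      proof -
        have "descent n S \<sigma> (\<lambda>j. (v j - w0 j) + t * w j) \<le> descent n S \<sigma> (\<lambda>j. v j - w0 j) + t * descent n S \<sigma> w"
          using descent_add_le[of n S \<sigma> "\<lambda>j. v j - w0 j" "\<lambda>j. t * w j"] descent_scale[of t n S \<sigma> w] t by simp
        also have "\<dots> \<le> 0"
          using vV w t by (intro add_nonpos_nonpos mult_nonneg_nonpos) (auto simp: V_def descent_sphere_def)
        finally show ?thesis using vV w by (simp add: V_def descent_sphere_def unit_vecs_def vecs_def algebra_simps)
      qed
      hence "G v \<le> G (\<lambda>j. v j + t * w j)" by (rule vmin)
      also have "\<dots> = (\<Sum>i<m. (matvec n A v i)\<^sup>2 + t * (2 * (matvec n A v i * matvec n A w i)) + t * t * (matvec n A w i)\<^sup>2)"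
        unfolding G_def matvec_add matvec_scale by (simp add: power2_eq_square algebra_simps)
      also have "\<dots> = G v + t * (2 * H + t * G w)"
        unfolding G_def H_def sum.distrib sum_distrib_left[symmetric] by (simp add: algebra_simps)
      finally have "0 \<le> t * (2 * H + t * G w)" by simp
      thus ?thesis using t by (simp add: zero_le_mult_iff)
    qed
    have "0 \<le> H"
    proof (rule ccontr)
      assume "\<not> 0 \<le> H"
      hence H: "H < 0" by simp
      have Gw: "0 \<le> G w" by (simp add: G_def sum_nonneg)
      \<comment> \<open>With this step length the quadratic part is at most - H, so
        \<open>ineq\<close> would give 0 \<le> H.\<close>
      have "- H / (G w + 1) * G w \<le> - H * 1"
        unfolding times_divide_eq_left times_divide_eq_right[symmetric] using H Gw
        by (intro mult_left_mono) auto
      moreover have "0 < - H / (G w + 1)" using H Gw by (intro divide_pos_pos) auto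
      ultimately show False using ineq[of "- H / (G w + 1)"] H by linarith
    qed
    moreover have "(\<Sum>i<m. y i * matvec n A w i) = - (H / sqrt (G v))"
      by (simp add: y_def H_def sum_divide_distrib sum_negf)
    ultimately show ?thesis using Gv by simp
  qed
  thus ?thesis using yu by blast
qed

section \<open>Sums over a bordered Gaussian matrix\<close>

lemma abs_quadratic_le:
  fixes p q r x y :: real
  assumes "\<bar>y\<bar> \<le> \<bar>x\<bar>"
  shows "\<bar>p * x\<^sup>2 + q * y + r\<bar> \<le> (\<bar>p\<bar> + \<bar>q\<bar> + \<bar>r\<bar>) * (1 + x\<^sup>2)"
proof -
  have "\<bar>x\<bar> \<le> 1 + x\<^sup>2"
    using sum_squares_bound[of "\<bar>x\<bar>" 1] zero_le_power2[of x] by (simp add: power2_eq_square)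
  hence y: "\<bar>y\<bar> \<le> 1 + x\<^sup>2" using assms by linarith
  have "\<bar>p * x\<^sup>2 + q * y + r\<bar> \<le> \<bar>p * x\<^sup>2\<bar> + \<bar>q * y\<bar> + \<bar>r\<bar>" by linarith
  also have "\<dots> \<le> \<bar>p\<bar> * (1 + x\<^sup>2) + \<bar>q\<bar> * (1 + x\<^sup>2) + \<bar>r\<bar> * (1 + x\<^sup>2)"
    unfolding abs_mult using y
    by (intro add_mono mult_left_mono) (auto simp: mult_le_cancel_left1 algebra_simps)
  finally show ?thesis by (simp add: algebra_simps)
qed

lemma stdn_mean: "has_bochner_integral stdn (\<lambda>x. x) 0"
proof -
  have "has_bochner_integral lborel (\<lambda>x. std_normal_density x *\<^sub>R x) 0"
    using std_normal_moment_odd[of 0] by simp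
  thus ?thesis by (rule has_bochner_integral_density[rotated 3]) auto
qed

lemma stdn_second_moment: "has_bochner_integral stdn (\<lambda>x. x\<^sup>2) 1"
proof -
  have "has_bochner_integral lborel (\<lambda>x. std_normal_density x *\<^sub>R x\<^sup>2) 1"
    using std_normal_moment_even[of 1] by simp
  thus ?thesis by (rule has_bochner_integral_density[rotated 3]) auto
qed

text \<open>With \<open>tail1\<close> and \<open>tail2\<close>: the moments of order 0, 1 and 2 of
  |g| restricted to |g| > \<tau>, for standard normal g.\<close>

definition tail0 :: "real \<Rightarrow> real" where "tail0 \<tau> = 1 - erf (\<tau> / sqrt 2)"
definition tail1 :: "real \<Rightarrow> real" where "tail1 \<tau> = 2 * std_normal_density \<tau>"
definition tail2 :: "real \<Rightarrow> real" where "tail2 \<tau> = tail0 \<tau> + \<tau> * tail1 \<tau>"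

text \<open>The contribution of one coordinate in \<open>S\<close>, with \<open>s\<close> its sign;
  \<open>off_stat\<close> is the contribution of one coordinate outside \<open>S\<close>, cut at
  \<tau>. Leaving the coefficients free lets one tail bound serve all the sums that occur.\<close>

definition on_stat :: "real \<Rightarrow> real \<Rightarrow> real \<Rightarrow> real \<Rightarrow> real \<Rightarrow> real" where
  "on_stat p q r s x = p * x\<^sup>2 + q * (s * x) + r"

definition off_stat :: "real \<Rightarrow> real \<Rightarrow> real \<Rightarrow> real \<Rightarrow> real \<Rightarrow> real \<Rightarrow> real" where
  "off_stat \<tau> p q r t x = (p * x\<^sup>2 + q * \<bar>x\<bar> + r) * indicator {x. \<tau> < \<bar>x\<bar>} x + t"

lemma on_stat_mean: "(\<integral>x. on_stat p q r s x \<partial>stdn) = p + r"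
proof -
  interpret prob_space stdn by (rule prob_space_stdn)
  have "has_bochner_integral stdn (\<lambda>x. p * x\<^sup>2 + q * (s * x) + r) (p * 1 + q * (s * 0) + r)"
    using prob_space
    by (intro has_bochner_integral_add has_bochner_integral_mult_right stdn_mean stdn_second_moment)
       (simp add: has_bochner_integral_iff)
  thus ?thesis unfolding on_stat_def[abs_def] by (simp add: has_bochner_integral_iff)
qed

lemma off_stat_mean:
  assumes "0 \<le> \<tau>"
  shows "(\<integral>x. off_stat \<tau> p q r t x \<partial>stdn) = p * tail2 \<tau> + q * tail1 \<tau> + r * tail0 \<tau> + t"
proof -
  interpret prob_space stdn by (rule prob_space_stdn)
  note m = normal_tail_moments[OF assms]
  have "has_bochner_integral stdn
    (\<lambda>x. p * (x\<^sup>2 * indicator {x. \<tau> < \<bar>x\<bar>} x) + q * (\<bar>x\<bar> * indicator {x. \<tau> < \<bar>x\<bar>} x) + r * indicator {x. \<tau> < \<bar>x\<bar>} x + t)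
    (p * tail2 \<tau> + q * tail1 \<tau> + r * tail0 \<tau> + t)"
    unfolding tail0_def tail1_def tail2_def using prob_space m
    by (intro has_bochner_integral_add has_bochner_integral_mult_right)
       (simp_all add: has_bochner_integral_iff mult_ac)
  also have "(\<lambda>x. p * (x\<^sup>2 * indicator {x. \<tau> < \<bar>x\<bar>} x) + q * (\<bar>x\<bar> * indicator {x. \<tau> < \<bar>x\<bar>} x) + r * indicator {x. \<tau> < \<bar>x\<bar>} x + t)
     = off_stat \<tau> p q r t"
    by (auto simp: off_stat_def fun_eq_iff algebra_simps)
  finally show ?thesis by (simp add: has_bochner_integral_iff)
qed

text \<open>\<open>fg\<close> and \<open>fh\<close> select the cells of the index set that hold the
  two independent Gaussian vectors. They are kept abstract because the border is laid out
  differently for the matrix and for its transpose. The tolerance 1 accounts for rounding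
  \<open>m\<close> and \<open>card S\<close> to integers.\<close>

definition two_block ::
  "real \<Rightarrow> real \<Rightarrow> nat \<Rightarrow> nat \<Rightarrow> nat set \<Rightarrow> (nat \<Rightarrow> real) \<Rightarrow> 'r set \<Rightarrow> (nat \<Rightarrow> 'r) \<Rightarrow> (nat \<Rightarrow> 'r) \<Rightarrow> bool" where
  "two_block \<alpha> \<beta> n m S \<sigma> R fg fh \<longleftrightarrow>
     m \<le> n \<and> \<bar>real m - \<alpha> * real n\<bar> \<le> 1 \<and> \<bar>real (card S) - \<beta> * real n\<bar> \<le> 1 \<and> S \<subseteq> {..<n} \<and>
     (\<forall>j\<in>S. \<sigma> j \<in> {-1, 1}) \<and> inj_on fg {..<m} \<and> inj_on fh {..<n} \<and>
     fg ` {..<m} \<subseteq> R \<and> fh ` {..<n} \<subseteq> R \<and> fg ` {..<m} \<inter> fh ` {..<n} = {}"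

definition block_event ::
  "'r set \<Rightarrow> nat \<Rightarrow> nat \<Rightarrow> nat set \<Rightarrow> (nat \<Rightarrow> real) \<Rightarrow> (nat \<Rightarrow> 'r) \<Rightarrow> (nat \<Rightarrow> 'r) \<Rightarrow> real \<Rightarrow>
   (real \<Rightarrow> real \<Rightarrow> real) \<Rightarrow> (real \<Rightarrow> real) \<Rightarrow> ('r \<Rightarrow> real) set" where
  "block_event R m n S \<sigma> fg fh pg qS qO = {\<omega> \<in> space (gaussian R).
     0 \<le> (\<Sum>i<m. pg * (\<omega> (fg i))\<^sup>2) + (\<Sum>j\<in>S. qS (\<sigma> j) (\<omega> (fh j))) + (\<Sum>j\<in>{..<n} - S. qO (\<omega> (fh j)))}"

text \<open>\<open>neg\<close> says that the limiting mean per dimension is negative. One exponent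
  works for all sets, signs and placements, because the underlying tail bound sees only a growth
  constant and a drift.\<close>

lemma two_block_chernoff:
  fixes pg p q r p' q' r' t' \<tau> \<alpha> \<beta> :: real
  assumes \<tau>: "0 \<le> \<tau>"
    and neg: "\<alpha> * pg + \<beta> * (p + r) + (1 - \<beta>) * (p' * tail2 \<tau> + q' * tail1 \<tau> + r' * tail0 \<tau> + t') < 0"
  shows "\<exists>c>0. \<exists>N0. \<forall>n m S \<sigma> (R :: 'r set) fg fh. N0 \<le> n \<longrightarrow> two_block \<alpha> \<beta> n m S \<sigma> R fg fh \<longrightarrow>
      block_event R m n S \<sigma> fg fh pg (on_stat p q r) (off_stat \<tau> p' q' r' t') \<in> sets (gaussian R) \<and>
      measure (gaussian R)
        (block_event R m n S \<sigma> fg fh pg (on_stat p q r) (off_stat \<tau> p' q' r' t')) \<le> exp (- c * real n)"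
proof -
  define eO where "eO = p' * tail2 \<tau> + q' * tail1 \<tau> + r' * tail0 \<tau> + t'"
  define e where "e = \<alpha> * pg + \<beta> * (p + r) + (1 - \<beta>) * eO"
  \<comment> \<open>Half of the available drift; the other half pays for rounding.\<close>
  define \<delta> where "\<delta> = - e / 2"
  have \<delta>: "0 < \<delta>" using neg by (simp add: \<delta>_def e_def eO_def)
  define a where "a = 1 + \<bar>pg\<bar> + (\<bar>p\<bar> + \<bar>q\<bar> + \<bar>r\<bar>) + (\<bar>p'\<bar> + \<bar>q'\<bar> + \<bar>r'\<bar>) + \<bar>t'\<bar>"
  have a: "0 < a" by (simp add: a_def)
  have two: "(0::real) < 2" by simp
  show ?thesis
  proof (rule stdn_chernoff[OF a \<delta> two, where 'r = "nat + nat"])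
    fix c :: real
    assume c: "0 < c"
      "\<And>(R :: (nat + nat) set) q N. finite R \<Longrightarrow> (\<And>r. r \<in> R \<Longrightarrow> q r \<in> borel_measurable borel) \<Longrightarrow>
        (\<And>r x. r \<in> R \<Longrightarrow> \<bar>q r x\<bar> \<le> a * (1 + x\<^sup>2)) \<Longrightarrow> real (card R) \<le> 2 * N \<Longrightarrow>
        (\<Sum>r\<in>R. \<integral>x. q r x \<partial>stdn) \<le> - \<delta> * N \<Longrightarrow>
        measure (gaussian R)
          {\<omega> \<in> space (gaussian R). 0 \<le> (\<Sum>r\<in>R. q r (\<omega> r))} \<le> exp (- c * N)"
    \<comment> \<open>Rounding shifts the total mean by at most the numerator, and from
      \<open>N0\<close> on this is at most \<open>\<delta> * real n\<close>.\<close>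
    define N0 where "N0 = nat \<lceil>(\<bar>pg\<bar> + \<bar>p + r - eO\<bar>) / \<delta>\<rceil>"
    show ?thesis
    proof (intro exI[of _ c] exI[of _ N0] conjI[OF c(1)] allI impI)
      fix n m :: nat and S :: "nat set" and \<sigma> :: "nat \<Rightarrow> real" and R :: "'r set" and fg fh :: "nat \<Rightarrow> 'r"
      assume n: "N0 \<le> n" and "two_block \<alpha> \<beta> n m S \<sigma> R fg fh"
      hence m: "m \<le> n" "\<bar>real m - \<alpha> * real n\<bar> \<le> 1"
        and k: "\<bar>real (card S) - \<beta> * real n\<bar> \<le> 1" and S: "S \<subseteq> {..<n}"
        and \<sigma>: "\<And>j. j \<in> S \<Longrightarrow> \<sigma> j \<in> {-1, 1}"
        and f: "inj_on fg {..<m}" "inj_on fh {..<n}" "fg ` {..<m} \<subseteq> R" "fh ` {..<n} \<subseteq> R" "fg ` {..<m} \<inter> fh ` {..<n} = {}"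
        unfolding two_block_def by auto
      let ?R = "gaussian R"
      let ?ev = "block_event R m n S \<sigma> fg fh pg (on_stat p q r) (off_stat \<tau> p' q' r' t')"
      \<comment> \<open>The two blocks as a disjoint union. The estimate is made on this index set
        and carried to \<open>R\<close> along the injection \<open>case_sum fg fh\<close>.\<close>
      define L where "L = {..<m} <+> {..<n}"
      define Q where "Q = case_sum (\<lambda>(i::nat) x. pg * x\<^sup>2) (\<lambda>j. if j \<in> S then on_stat p q r (\<sigma> j) else off_stat \<tau> p' q' r' t')"
      let ?L = "gaussian L"
      define E where "E = {\<omega> \<in> space ?L. 0 \<le> (\<Sum>l\<in>L. Q l (\<omega> l))}"
      have finL: "finite L" by (simp add: L_def)
      have split: "sum h {..<n} = sum h S + sum h ({..<n} - S)" for h :: "nat \<Rightarrow> real"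
        using sum.subset_diff[OF S finite_lessThan, of h] by simp
      have sumL: "(\<Sum>l\<in>L. Q l (x l)) = (\<Sum>i<m. pg * (x (Inl i))\<^sup>2) + (\<Sum>j\<in>S. on_stat p q r (\<sigma> j) (x (Inr j)))
             + (\<Sum>j\<in>{..<n} - S. off_stat \<tau> p' q' r' t' (x (Inr j)))" for x
        by (simp add: L_def sum.Plus Q_def split)
      have Qm: "Q l \<in> borel_measurable borel" for l
        unfolding Q_def on_stat_def[abs_def] off_stat_def[abs_def] by (cases l) simp_all
      have Qb: "\<bar>Q l x\<bar> \<le> a * (1 + x\<^sup>2)" if "l \<in> L" for l x
      proof -
        have x: "0 \<le> 1 + x\<^sup>2" "1 \<le> 1 + x\<^sup>2" by simp_all
        consider i where "l = Inl i" | j where "l = Inr j" "j \<in> S" | j where "l = Inr j" "j \<notin> S" by (cases l) auto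
        thus ?thesis
        proof cases
          case 1
          have "\<bar>Q l x\<bar> \<le> (\<bar>pg\<bar> + \<bar>0\<bar> + \<bar>0\<bar>) * (1 + x\<^sup>2)"
            using abs_quadratic_le[of x x pg 0 0] 1 by (simp add: Q_def)
          also have "\<dots> \<le> a * (1 + x\<^sup>2)" using x by (intro mult_right_mono) (auto simp: a_def)
          finally show ?thesis .
        next
          case 2
          have "\<bar>\<sigma> j * x\<bar> \<le> \<bar>x\<bar>" using \<sigma>[OF 2(2)] by auto
          hence "\<bar>Q l x\<bar> \<le> (\<bar>p\<bar> + \<bar>q\<bar> + \<bar>r\<bar>) * (1 + x\<^sup>2)"
            using abs_quadratic_le[of "\<sigma> j * x" x p q r] 2 by (simp add: Q_def on_stat_def)
          also have "\<dots> \<le> a * (1 + x\<^sup>2)" using x by (intro mult_right_mono) (auto simp: a_def)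
          finally show ?thesis .
        next
          case 3
          have "\<bar>(p' * x\<^sup>2 + q' * \<bar>x\<bar> + r') * indicator {x. \<tau> < \<bar>x\<bar>} x\<bar> \<le> \<bar>p' * x\<^sup>2 + q' * \<bar>x\<bar> + r'\<bar>"
            by (auto simp: indicator_def)
          also have "\<dots> \<le> (\<bar>p'\<bar> + \<bar>q'\<bar> + \<bar>r'\<bar>) * (1 + x\<^sup>2)" by (rule abs_quadratic_le) simp
          finally have "\<bar>Q l x\<bar> \<le> (\<bar>p'\<bar> + \<bar>q'\<bar> + \<bar>r'\<bar>) * (1 + x\<^sup>2) + \<bar>t'\<bar>"
            using 3 by (simp add: Q_def off_stat_def) linarith
          also have "\<bar>t'\<bar> \<le> \<bar>t'\<bar> * (1 + x\<^sup>2)" using x by (simp add: mult_le_cancel_left1)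
          also have "(\<bar>p'\<bar> + \<bar>q'\<bar> + \<bar>r'\<bar>) * (1 + x\<^sup>2) + \<bar>t'\<bar> * (1 + x\<^sup>2) = (\<bar>p'\<bar> + \<bar>q'\<bar> + \<bar>r'\<bar> + \<bar>t'\<bar>) * (1 + x\<^sup>2)"
            by (simp add: algebra_simps)
          also have "\<dots> \<le> a * (1 + x\<^sup>2)" using x by (intro mult_right_mono) (auto simp: a_def)
          finally show ?thesis by simp
        qed
      qed
      have "(\<Sum>l\<in>L. \<integral>x. Q l x \<partial>stdn) = real m * pg + real (card S) * (p + r) + real (n - card S) * eO"
      proof -
        have "(\<integral>x. pg * x\<^sup>2 \<partial>stdn) = pg"
          using stdn_second_moment by (simp add: has_bochner_integral_iff)
        moreover have "card ({..<n} - S) = n - card S" using S by (simp add: card_Diff_subset finite_subset)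
        ultimately show ?thesis
          by (simp add: L_def sum.Plus Q_def split on_stat_mean off_stat_mean[OF \<tau>] eO_def)
      qed
      also have "real (n - card S) = real n - real (card S)"
        using S card_mono[OF finite_lessThan S] by simp
      also have "real m * pg + real (card S) * (p + r) + (real n - real (card S)) * eO
          = real n * (\<alpha> * pg + \<beta> * (p + r) + (1 - \<beta>) * eO) + (real m - \<alpha> * real n) * pg + (real (card S) - \<beta> * real n) * (p + r - eO)"
        by (simp add: algebra_simps)
      also have "\<dots> = - (2 * \<delta>) * real n + (real m - \<alpha> * real n) * pg + (real (card S) - \<beta> * real n) * (p + r - eO)"
      proof -
        have "\<alpha> * pg + \<beta> * (p + r) + (1 - \<beta>) * eO = - (2 * \<delta>)" unfolding e_def[symmetric] by (simp add: \<delta>_def)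
        thus ?thesis by (simp add: mult.commute)
      qed
      also have "\<dots> \<le> - (2 * \<delta>) * real n + 1 * \<bar>pg\<bar> + 1 * \<bar>p + r - eO\<bar>"
      proof (intro add_mono order_refl)
        show "(real m - \<alpha> * real n) * pg \<le> 1 * \<bar>pg\<bar>"
          by (rule order_trans[OF abs_ge_self]) (unfold abs_mult, intro mult_right_mono m(2), simp)
        show "(real (card S) - \<beta> * real n) * (p + r - eO) \<le> 1 * \<bar>p + r - eO\<bar>"
          by (rule order_trans[OF abs_ge_self]) (unfold abs_mult, intro mult_right_mono k, simp)
      qed
      also have "\<dots> \<le> - \<delta> * real n"
      proof -
        have "(\<bar>pg\<bar> + \<bar>p + r - eO\<bar>) / \<delta> \<le> real n" using n unfolding N0_def by linarith
        hence "\<bar>pg\<bar> + \<bar>p + r - eO\<bar> \<le> real n * \<delta>" using \<delta> by (simp add: pos_divide_le_eq)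
        thus ?thesis by (simp add: algebra_simps)
      qed
      finally have mean: "(\<Sum>l\<in>L. \<integral>x. Q l x \<partial>stdn) \<le> - \<delta> * real n" .
      have cardL: "real (card L) \<le> 2 * real n" using m(1) by (simp add: L_def card_Plus)
      have bnd: "measure ?L E \<le> exp (- c * real n)"
        unfolding E_def by (rule c(2)[OF finL Qm Qb cardL mean])
      have E: "E \<in> sets ?L"
      proof -
        have "(\<lambda>\<omega>. Q l (\<omega> l)) \<in> borel_measurable ?L" if "l \<in> L" for l
          using measurable_compose[OF measurable_component_singleton[OF that, of "\<lambda>_. stdn"], of "Q l" borel] Qm
          by simp
        hence "(\<lambda>\<omega>. \<Sum>l\<in>L. Q l (\<omega> l)) \<in> borel_measurable ?L" by (rule borel_measurable_sum)
        thus ?thesis unfolding E_def by measurable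
      qed
      have inj: "inj_on (case_sum fg fh) L"
        using f unfolding L_def inj_on_def by (auto simp: disjoint_iff) blast+
      have maps: "case_sum fg fh \<in> L \<rightarrow> R" using f(3,4) by (auto simp: L_def)
      have "?ev = {\<omega> \<in> space ?R. (\<lambda>l\<in>L. \<omega> (case_sum fg fh l)) \<in> E}"
        unfolding block_event_def
      proof (intro Collect_cong conj_cong refl)
        fix \<omega> assume \<omega>: "\<omega> \<in> space ?R"
        have sp: "(\<lambda>l\<in>L. \<omega> (case_sum fg fh l)) \<in> space ?L" by (auto simp: space_PiM)
        have "(\<Sum>l\<in>L. Q l ((\<lambda>l\<in>L. \<omega> (case_sum fg fh l)) l)) = (\<Sum>l\<in>L. Q l (\<omega> (case_sum fg fh l)))"
          by (intro sum.cong refl) simp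
        also have "\<dots> = (\<Sum>i<m. pg * (\<omega> (fg i))\<^sup>2) + (\<Sum>j\<in>S. on_stat p q r (\<sigma> j) (\<omega> (fh j)))
             + (\<Sum>j\<in>{..<n} - S. off_stat \<tau> p' q' r' t' (\<omega> (fh j)))" by (simp add: sumL)
        finally show "(0 \<le> (\<Sum>i<m. pg * (\<omega> (fg i))\<^sup>2) + (\<Sum>j\<in>S. on_stat p q r (\<sigma> j) (\<omega> (fh j)))
             + (\<Sum>j\<in>{..<n} - S. off_stat \<tau> p' q' r' t' (\<omega> (fh j)))) \<longleftrightarrow> (\<lambda>l\<in>L. \<omega> (case_sum fg fh l)) \<in> E"
          using sp by (simp add: E_def)
      qed
      thus "?ev \<in> sets ?R \<and> measure ?R ?ev \<le> exp (- c * real n)"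
        using measure_PiM_stdn_reindex[OF inj maps E] bnd by simp
    qed
  qed
qed

section \<open>Recovery above the threshold\<close>

text \<open>The normal density is positive everywhere, so a null half line would make an interval
  Lebesgue null.\<close>

lemma stdn_below_pos: "0 < measure stdn {..<-1}"
proof (rule ccontr)
  interpret prob_space stdn by (rule prob_space_stdn)
  assume "\<not> 0 < measure stdn {..<-1}"
  hence "measure stdn {..<-1} = 0" using measure_nonneg[of stdn "{..<-1}"] by linarith
  hence "{..<-1} \<in> null_sets stdn" by (simp add: null_sets_def emeasure_eq_measure)
  hence "AE x in lborel. x \<in> {..<-1::real} \<longrightarrow> ennreal (std_normal_density x) = 0"
    by (simp add: null_sets_density_iff)
  moreover have "\<not> std_normal_density x \<le> 0" for x
    using normal_density_pos[of 1 0 x] by simp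
  ultimately have "AE x in lborel. x \<notin> {..<-1::real}"
    by (simp add: ennreal_eq_0_iff)
  hence "{..<-1::real} \<in> null_sets lborel" by (subst (asm) AE_iff_null_sets[symmetric]) auto
  hence "{-3..-2::real} \<in> null_sets lborel" by (rule null_sets_subset) auto
  thus False by (simp add: null_sets_def)
qed

section \<open>From the comparison to overwhelming probability\<close>

lemma eventually_exp_absorb:
  fixes K c p :: real
  assumes "0 < c" "0 < p"
  shows "\<forall>\<^sub>F n in sequentially. \<forall>x. p * x \<le> K * exp (- c * real n) \<longrightarrow> x \<le> exp (- (c / 2) * real n)"
proof -
  have "filterlim (\<lambda>n. exp ((c / 2) * real n)) at_top sequentially"
    using assms(1)
    by (intro filterlim_compose[OF exp_at_top] filterlim_tendsto_pos_mult_at_top[OF tendsto_const] filterlim_real_sequentially) auto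
  hence "\<forall>\<^sub>F n in sequentially. K / p \<le> exp ((c / 2) * real n)" by (simp add: filterlim_at_top)
  thus ?thesis
  proof eventually_elim
    case (elim n)
    have "x \<le> exp (- (c / 2) * real n)" if "p * x \<le> K * exp (- c * real n)" for x
    proof -
      have "x \<le> K / p * exp (- c * real n)" using that assms(2) by (simp add: pos_le_divide_eq mult.commute)
      also have "\<dots> \<le> exp ((c / 2) * real n) * exp (- c * real n)" using elim by (intro mult_right_mono) auto
      also have "\<dots> = exp (- (c / 2) * real n)" by (simp add: exp_add[symmetric] algebra_simps)
      finally show ?thesis .
    qed
    thus ?case by blast
  qed
qed

lemma prob_space_gauss_mat: "prob_space (gauss_mat m n)"
  unfolding gauss_mat_def by (intro prob_space_PiM prob_space_stdn)

text \<open>The comparison bounds the exceptional event only up to the probability of the corner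
  event and a constant \<open>K\<close>; both are absorbed by passing from \<open>c\<close> to
  \<open>c / 2\<close>.\<close>

lemma overwhelmingI:
  assumes "0 < c"
    and ev: "\<forall>\<^sub>F n in sequentially. {A \<in> space (gauss_mat (m n) n). \<not> E n A} \<in> sets (gauss_mat (m n) n) \<and>
      measure (gauss_mat (m n) n) {A \<in> space (gauss_mat (m n) n). \<not> E n A} * measure stdn {..<-1}
        \<le> K * exp (- c * real n)"
  shows "overwhelming (\<lambda>n. gauss_mat (m n) n) E"
  unfolding overwhelming_def
proof (intro exI[of _ "c / 2"] conjI)
  show "\<forall>\<^sub>F n in sequentially. 1 - exp (- (c / 2) * real n) \<le> measure (gauss_mat (m n) n) {A \<in> space (gauss_mat (m n) n). E n A}"
    using ev eventually_exp_absorb[OF assms(1) stdn_below_pos, of K]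
  proof eventually_elim
    case (elim n)
    interpret prob_space "gauss_mat (m n) n" by (rule prob_space_gauss_mat)
    let ?B = "{A \<in> space (gauss_mat (m n) n). \<not> E n A}"
    have "{A \<in> space (gauss_mat (m n) n). E n A} = space (gauss_mat (m n) n) - ?B" by auto
    hence "prob {A \<in> space (gauss_mat (m n) n). E n A} = 1 - prob ?B" using elim(1) prob_compl[of ?B] by simp
    moreover have "prob ?B \<le> exp (- (c / 2) * real n)" using elim by (auto simp: mult.commute)
    ultimately show ?case by simp
  qed
qed (use assms in simp)

lemma two_block_bordered:
  assumes "0 < \<alpha>" "\<alpha> < 1" "0 < \<beta>" "m = nat \<lfloor>\<alpha> * real n\<rfloor>" "card S = nat \<lfloor>\<beta> * real n\<rfloor>" "S \<subseteq> {..<n}"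
    "\<And>i. i \<in> S \<Longrightarrow> \<sigma> i \<in> {-1, 1}"
  shows "two_block \<alpha> \<beta> n m S \<sigma> ({..<Suc m} \<times> {..<Suc n}) (\<lambda>i. (i, n)) (\<lambda>j. (m, j))"
    and "two_block \<alpha> \<beta> n m S \<sigma> ({..<Suc n} \<times> {..<Suc m}) (\<lambda>i. (n, i)) (\<lambda>j. (j, m))"
proof -
  have "0 \<le> \<alpha> * real n" "0 \<le> \<beta> * real n" "\<alpha> * real n \<le> 1 * real n"
    using assms(1-3) by (simp, simp, intro mult_right_mono) auto
  hence m: "\<bar>real m - \<alpha> * real n\<bar> \<le> 1" "\<bar>real (card S) - \<beta> * real n\<bar> \<le> 1" "real m \<le> real n"
    unfolding assms(4,5) by linarith+
  show "two_block \<alpha> \<beta> n m S \<sigma> ({..<Suc m} \<times> {..<Suc n}) (\<lambda>i. (i, n)) (\<lambda>j. (m, j))"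
    "two_block \<alpha> \<beta> n m S \<sigma> ({..<Suc n} \<times> {..<Suc m}) (\<lambda>i. (n, i)) (\<lambda>j. (j, m))"
    using m assms(6,7) unfolding two_block_def by (auto simp: inj_on_def)
qed

text \<open>Weak duality. Testing with b = g/|g| gives |g| \<le> -<a,h>. Since \<mu> times
  \<open>descent\<close> of \<open>a\<close> is nonpositive, its negative can be added on the right,
  and Cauchy-Schwarz then compares |g| with the length of the residual \<open>z\<close>.\<close>

lemma dual_norm_bound:
  fixes g h :: "nat \<Rightarrow> real"
  assumes S: "S \<subseteq> {..<n}" and \<sigma>: "\<And>i. i \<in> S \<Longrightarrow> \<sigma> i \<in> {-1, 1}" and \<mu>: "0 \<le> \<mu>" "\<tau> \<le> \<mu>"
    and a: "a \<in> descent_sphere n S \<sigma>"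
    and le: "\<And>b. b \<in> unit_vecs m \<Longrightarrow> (\<Sum>i<m. b i * g i) + (\<Sum>j<n. a j * h j) \<le> 0"
  shows "(\<Sum>i<m. (g i)\<^sup>2) \<le> (\<Sum>j\<in>S. on_stat 1 (2 * \<mu>) (\<mu>\<^sup>2) (\<sigma> j) (h j))
      + (\<Sum>j\<in>{..<n} - S. off_stat \<tau> 1 (- 2 * \<mu>) (\<mu>\<^sup>2) 0 (h j))"
proof -
  \<comment> \<open>What the multiplier \<mu> leaves of h. Off \<open>S\<close> the cut is at \<tau>
    rather than \<mu>, so \<open>z j\<close> can be negative for |h j| between them. Only |h j|
    \<le> z j + \<mu> is needed, and the squares have the truncated moments at \<tau> as
    means.\<close>
  define z where "z = (\<lambda>j. if j \<in> S then \<bar>h j + \<mu> * \<sigma> j\<bar> else (\<bar>h j\<bar> - \<mu>) * indicator {x. \<tau> < \<bar>x\<bar>} (h j))"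
  have split: "sum f {..<n} = sum f S + sum f ({..<n} - S)" for f :: "nat \<Rightarrow> real"
    using sum.subset_diff[OF S finite_lessThan, of f] by simp
  have z2: "(\<Sum>j\<in>S. on_stat 1 (2 * \<mu>) (\<mu>\<^sup>2) (\<sigma> j) (h j)) + (\<Sum>j\<in>{..<n} - S. off_stat \<tau> 1 (- 2 * \<mu>) (\<mu>\<^sup>2) 0 (h j)) = (\<Sum>j<n. (z j)\<^sup>2)"
  proof -
    have "on_stat 1 (2 * \<mu>) (\<mu>\<^sup>2) (\<sigma> j) (h j) = (z j)\<^sup>2" if "j \<in> S" for j
      using that \<sigma>[OF that] by (auto simp: on_stat_def z_def power2_eq_square algebra_simps)
    moreover have "off_stat \<tau> 1 (- 2 * \<mu>) (\<mu>\<^sup>2) 0 (h j) = (z j)\<^sup>2" if "j \<notin> S" for j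
      using that by (auto simp: off_stat_def z_def power2_eq_square indicator_def algebra_simps)
    ultimately show ?thesis unfolding split by (intro arg_cong2[of _ _ _ _ "(+)"] sum.cong) auto
  qed
  define G where "G = (\<Sum>i<m. (g i)\<^sup>2)"
  have "G \<le> (\<Sum>j<n. (z j)\<^sup>2)"
  proof (cases "G = 0")
    case True thus ?thesis by (simp add: sum_nonneg)
  next
    case False
    hence G: "0 < G" using sum_nonneg[of "{..<m}" "\<lambda>i. (g i)\<^sup>2"] by (simp add: G_def less_le)
    define b where "b = (\<lambda>i. if i < m then g i / sqrt G else 0)"
    have "(\<Sum>i<m. (b i)\<^sup>2) = (\<Sum>i<m. (g i)\<^sup>2 / G)" using G by (intro sum.cong refl) (auto simp: b_def power_divide)
    also have "\<dots> = 1" using G by (simp add: sum_divide_distrib[symmetric] G_def)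
    finally have "b \<in> unit_vecs m" by (simp add: unit_vecs_def vecs_def b_def)
    moreover have "(\<Sum>i<m. b i * g i) = sqrt G"
    proof -
      have "(\<Sum>i<m. b i * g i) = (\<Sum>i<m. (g i)\<^sup>2 / sqrt G)" by (intro sum.cong refl) (auto simp: b_def power2_eq_square)
      also have "\<dots> = G / sqrt G" by (simp add: sum_divide_distrib[symmetric] G_def)
      finally show ?thesis using G by (simp add: real_div_sqrt)
    qed
    ultimately have "sqrt G \<le> - (\<Sum>j<n. a j * h j)" using le[of b] by linarith
    also have "\<dots> \<le> (\<Sum>j<n. \<bar>a j\<bar> * z j)"
    proof -
      have "(\<Sum>j\<in>S. - (a j * h j)) \<le> (\<Sum>j\<in>S. \<bar>a j\<bar> * z j + \<mu> * (\<sigma> j * a j))"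
      proof (rule sum_mono)
        fix j assume j: "j \<in> S"
        have "- (a j * (h j + \<mu> * \<sigma> j)) \<le> \<bar>a j\<bar> * \<bar>h j + \<mu> * \<sigma> j\<bar>" by (simp add: abs_mult[symmetric])
        thus "- (a j * h j) \<le> \<bar>a j\<bar> * z j + \<mu> * (\<sigma> j * a j)" using j by (simp add: z_def algebra_simps)
      qed
      moreover have "(\<Sum>j\<in>{..<n} - S. - (a j * h j)) \<le> (\<Sum>j\<in>{..<n} - S. \<bar>a j\<bar> * z j + \<mu> * \<bar>a j\<bar>)"
      proof (rule sum_mono)
        fix j assume j: "j \<in> {..<n} - S"
        have "- (a j * h j) \<le> \<bar>a j\<bar> * \<bar>h j\<bar>" by (simp add: abs_mult[symmetric])
        \<comment> \<open>Above the cut this is an equality; below it z j = 0 and |h j| \<le> \<tau>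
          \<le> \<mu>.\<close>
        also have "\<dots> \<le> \<bar>a j\<bar> * (z j + \<mu>)" using j \<mu> by (intro mult_left_mono) (auto simp: z_def indicator_def)
        finally show "- (a j * h j) \<le> \<bar>a j\<bar> * z j + \<mu> * \<bar>a j\<bar>" by (simp add: algebra_simps)
      qed
      moreover have "\<mu> * descent n S \<sigma> a \<le> 0"
        using a \<mu>(1) by (intro mult_nonneg_nonpos) (auto simp: descent_sphere_def)
      ultimately show ?thesis
        unfolding split sum.distrib descent_def by (simp add: sum_negf sum_distrib_left algebra_simps)
    qed
    finally have "(sqrt G)\<^sup>2 \<le> (\<Sum>j<n. \<bar>a j\<bar> * z j)\<^sup>2" using G by (intro power_mono) auto
    also have "\<dots> \<le> (\<Sum>j<n. \<bar>a j\<bar>\<^sup>2) * (\<Sum>j<n. (z j)\<^sup>2)" by (rule Cauchy_Schwarz_ineq_sum)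
    finally show ?thesis using G a by (simp add: descent_sphere_def unit_vecs_def)
  qed
  thus ?thesis unfolding z2 G_def .
qed

text \<open>\<open>less\<close> states that |z|^2 - |g|^2 has negative mean per dimension, where z
  is the residual of the duality bound. A kernel vector in the cone would force this difference to
  be nonnegative in the bordered model.\<close>

lemma recovery_overwhelming:
  assumes \<alpha>: "0 < \<alpha>" "\<alpha> < 1" and \<beta>: "0 < \<beta>"
    and m_def: "\<And>n. m n = nat \<lfloor>\<alpha> * real n\<rfloor>"
    and S: "\<And>n. S n \<subseteq> {..<n} \<and> card (S n) = nat \<lfloor>\<beta> * real n\<rfloor>"
    and sigma: "\<And>n i. i \<in> S n \<Longrightarrow> \<sigma> n i \<in> {-1, 1}"
    and \<tau>: "0 \<le> \<tau>" "\<tau> \<le> \<mu>"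
    and less: "\<beta> * (1 + \<mu>\<^sup>2) + (1 - \<beta>) * (tail2 \<tau> - 2 * \<mu> * tail1 \<tau> + \<mu>\<^sup>2 * tail0 \<tau>) < \<alpha>"
  shows "overwhelming (\<lambda>n. gauss_mat (m n) n) (\<lambda>n A. \<forall>x \<in> sign_vecs (S n) (\<sigma> n). unique_l1_min (m n) n A x)"
proof -
  have neg: "\<alpha> * (- 1) + \<beta> * (1 + \<mu>\<^sup>2) + (1 - \<beta>) * (1 * tail2 \<tau> + (- 2 * \<mu>) * tail1 \<tau> + \<mu>\<^sup>2 * tail0 \<tau> + 0) < 0"
    using less by simp
  obtain c N0 where c: "0 < c" and cE: "\<And>n m S \<sigma> (R :: (nat \<times> nat) set) fg fh. N0 \<le> n \<Longrightarrow> two_block \<alpha> \<beta> n m S \<sigma> R fg fh \<Longrightarrow>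
      block_event R m n S \<sigma> fg fh (- 1) (on_stat 1 (2 * \<mu>) (\<mu>\<^sup>2)) (off_stat \<tau> 1 (- 2 * \<mu>) (\<mu>\<^sup>2) 0) \<in> sets (gaussian R) \<and>
      measure (gaussian R)
        (block_event R m n S \<sigma> fg fh (- 1) (on_stat 1 (2 * \<mu>) (\<mu>\<^sup>2)) (off_stat \<tau> 1 (- 2 * \<mu>) (\<mu>\<^sup>2) 0)) \<le> exp (- c * real n)"
    using two_block_chernoff[OF \<tau>(1) neg, where 'r = "nat \<times> nat" and q = "2 * \<mu>"] by blast
  show ?thesis
  proof (rule overwhelmingI[OF c, where K = 1])
    show "\<forall>\<^sub>F n in sequentially. {A \<in> space (gauss_mat (m n) n). \<not> (\<forall>x \<in> sign_vecs (S n) (\<sigma> n). unique_l1_min (m n) n A x)} \<in> sets (gauss_mat (m n) n) \<and>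
      measure (gauss_mat (m n) n) {A \<in> space (gauss_mat (m n) n). \<not> (\<forall>x \<in> sign_vecs (S n) (\<sigma> n). unique_l1_min (m n) n A x)} * measure stdn {..<-1}
        \<le> 1 * exp (- c * real n)"
      using eventually_ge_at_top[of N0]
    proof eventually_elim
      case (elim n)
      have Sn: "S n \<subseteq> {..<n}" "card (S n) = nat \<lfloor>\<beta> * real n\<rfloor>" using S by auto
      have eq: "{A \<in> space (gauss_mat (m n) n). \<not> (\<forall>x \<in> sign_vecs (S n) (\<sigma> n). unique_l1_min (m n) n A x)}
        = {A \<in> space (gauss_mat (m n) n). hits_kernel (m n) n (S n) (\<sigma> n) A}" (is "_ = ?B")
        using all_unique_iff_no_hit[OF Sn(1), of "\<sigma> n"] sigma by auto
      define U where "U = block_event ({..<Suc (m n)} \<times> {..<Suc n}) (m n) n (S n) (\<sigma> n) (\<lambda>i. (i, n)) (\<lambda>j. (m n, j))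
         (- 1) (on_stat 1 (2 * \<mu>) (\<mu>\<^sup>2)) (off_stat \<tau> 1 (- 2 * \<mu>) (\<mu>\<^sup>2) 0)"
      have U: "U \<in> sets (gauss_mat (Suc (m n)) (Suc n))" "measure (gauss_mat (Suc (m n)) (Suc n)) U \<le> exp (- c * real n)"
        using cE[OF elim two_block_bordered(1)[OF \<alpha> \<beta> m_def Sn(2,1) sigma]] by (auto simp: U_def gauss_mat_def)
      have "measure (gauss_mat (m n) n) ?B * measure stdn {..<-1} \<le> measure (gauss_mat (Suc (m n)) (Suc n)) U"
      proof (rule gordon_comparison[of "descent_sphere n (S n) (\<sigma> n)" n "unit_vecs (m n)" "m n"])
        show "descent_sphere n (S n) (\<sigma> n) \<subseteq> unit_vecs n" by (auto simp: descent_sphere_def)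
        show "\<exists>a\<in>descent_sphere n (S n) (\<sigma> n). \<forall>b\<in>unit_vecs (m n). (\<Sum>i<m n. \<Sum>j<n. b i * a j * A (i, j)) \<le> 0" if A: "A \<in> ?B" for A
        proof -
          obtain a where a: "a \<in> descent_sphere n (S n) (\<sigma> n)" "\<And>i. i < m n \<Longrightarrow> matvec n A a i = 0"
            using A by (auto simp: hits_kernel_def)
          have "(\<Sum>i<m n. \<Sum>j<n. b i * a j * A (i, j)) = (\<Sum>i<m n. b i * matvec n A a i)" for b
            by (simp add: matvec_def sum_distrib_left mult_ac)
          thus ?thesis using a by (intro bexI[OF _ a(1)]) simp
        qed
        fix \<omega> a
        assume \<omega>: "\<omega> \<in> space (gauss_mat (Suc (m n)) (Suc n))" "a \<in> descent_sphere n (S n) (\<sigma> n)"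
          "\<And>b. b \<in> unit_vecs (m n) \<Longrightarrow> (\<Sum>i<m n. b i * \<omega> (i, n)) + (\<Sum>j<n. a j * \<omega> (m n, j)) \<le> 0"
        have "(\<Sum>i<m n. (\<omega> (i, n))\<^sup>2) \<le> (\<Sum>j\<in>S n. on_stat 1 (2 * \<mu>) (\<mu>\<^sup>2) (\<sigma> n j) (\<omega> (m n, j)))
          + (\<Sum>j\<in>{..<n} - S n. off_stat \<tau> 1 (- 2 * \<mu>) (\<mu>\<^sup>2) 0 (\<omega> (m n, j)))"
          by (rule dual_norm_bound[OF Sn(1) _ _ \<tau>(2) \<omega>(2,3)]) (use sigma \<tau> in auto)
        thus "\<omega> \<in> U" using \<omega>(1) by (simp add: U_def block_event_def gauss_mat_def sum_negf)
      qed (auto intro: hits_kernel_measurable U(1))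
      thus ?case unfolding eq using U(2) hits_kernel_measurable by simp
    qed
  qed
qed

section \<open>Failure below the threshold\<close>

text \<open>If all four sums were negative, an explicit w would lie in the cone with <w,h> > n a,
  |w|^2 < n b and |g|^2 < n d. The hypothesis gives <w,h> \<le> |w| |g|, whence a^2 < b d. Four
  linear statistics thus replace the quotient <w,h>/|w|, which is not a sum of independent
  terms.\<close>

lemma dual_vector_cases:
  fixes g h :: "nat \<Rightarrow> real"
  assumes S: "S \<subseteq> {..<n}" and \<sigma>: "\<And>i. i \<in> S \<Longrightarrow> \<sigma> i \<in> {-1, 1}" and \<mu>: "0 \<le> \<tau>" "\<mu> \<le> \<tau>"
    and abd: "0 < a" "b * d \<le> a\<^sup>2"
    and y: "y \<in> unit_vecs m"
    and le: "\<And>w. w \<in> descent_sphere n S \<sigma> \<Longrightarrow> (\<Sum>i<n. w i * h i) + (\<Sum>j<m. y j * g j) \<le> 0"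
  shows "0 \<le> (\<Sum>j\<in>S. on_stat 0 1 (- \<mu>) (\<sigma> j) (h j)) + (\<Sum>j\<in>{..<n} - S. off_stat \<tau> 0 1 (- \<mu>) 0 (h j)) \<or>
    0 \<le> (\<Sum>j\<in>S. on_stat (- 1) \<mu> a (\<sigma> j) (h j)) + (\<Sum>j\<in>{..<n} - S. off_stat \<tau> (- 1) \<mu> 0 a (h j)) \<or>
    0 \<le> (\<Sum>j\<in>S. on_stat 1 (- 2 * \<mu>) (\<mu>\<^sup>2 - b) (\<sigma> j) (h j)) + (\<Sum>j\<in>{..<n} - S. off_stat \<tau> 1 (- 2 * \<mu>) (\<mu>\<^sup>2) (- b) (h j)) \<or>
    0 \<le> (\<Sum>j<m. (g j)\<^sup>2) + (\<Sum>j\<in>S. on_stat 0 0 (- d) (\<sigma> j) (h j)) + (\<Sum>j\<in>{..<n} - S. off_stat \<tau> 0 0 0 (- d) (h j))"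
    (is "0 \<le> ?E1 \<or> 0 \<le> ?E2 \<or> 0 \<le> ?E3 \<or> 0 \<le> ?E4")
proof (rule ccontr)
  assume "\<not> (0 \<le> ?E1 \<or> 0 \<le> ?E2 \<or> 0 \<le> ?E3 \<or> 0 \<le> ?E4)"
  hence E: "?E1 < 0" "?E2 < 0" "?E3 < 0" "?E4 < 0" by (auto simp only: not_le de_Morgan_disj)
  have split: "sum f {..<n} = sum f S + sum f ({..<n} - S)" for f :: "nat \<Rightarrow> real"
    using sum.subset_diff[OF S finite_lessThan, of f] by simp
  \<comment> \<open>The near-optimal direction: h minus \<mu> times the sign on \<open>S\<close>;
    elsewhere coordinates above \<tau> are shrunk by \<mu> and the rest are dropped. Because \<mu>
    \<le> \<tau> no kept coordinate changes its sign.\<close>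
  define w where "w = (\<lambda>j. if j \<in> S then h j - \<mu> * \<sigma> j
      else if j < n \<and> \<tau> < \<bar>h j\<bar> then sgn (h j) * (\<bar>h j\<bar> - \<mu>) else 0)"
  have wv: "w \<in> vecs n" using S by (auto simp: w_def vecs_def)
  have on: "\<sigma> j * w j = on_stat 0 1 (- \<mu>) (\<sigma> j) (h j)" "a - w j * h j = on_stat (- 1) \<mu> a (\<sigma> j) (h j)"
    "(w j)\<^sup>2 - b = on_stat 1 (- 2 * \<mu>) (\<mu>\<^sup>2 - b) (\<sigma> j) (h j)" if "j \<in> S" for j
    using that \<sigma>[OF that] by (auto simp: w_def on_stat_def power2_eq_square algebra_simps)
  have off: "\<bar>w j\<bar> = off_stat \<tau> 0 1 (- \<mu>) 0 (h j)" "a - w j * h j = off_stat \<tau> (- 1) \<mu> 0 a (h j)"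
    "(w j)\<^sup>2 - b = off_stat \<tau> 1 (- 2 * \<mu>) (\<mu>\<^sup>2) (- b) (h j)" if "j \<in> {..<n} - S" for j
  proof -
    have "\<bar>w j\<bar> = off_stat \<tau> 0 1 (- \<mu>) 0 (h j) \<and> a - w j * h j = off_stat \<tau> (- 1) \<mu> 0 a (h j) \<and>
      (w j)\<^sup>2 - b = off_stat \<tau> 1 (- 2 * \<mu>) (\<mu>\<^sup>2) (- b) (h j)"
    proof (cases "\<tau> < \<bar>h j\<bar>")
      case True
      hence nz: "h j \<noteq> 0" "0 \<le> \<bar>h j\<bar> - \<mu>" using \<mu> by auto
      have w: "w j = sgn (h j) * (\<bar>h j\<bar> - \<mu>)" using that True by (simp add: w_def)
      have "\<bar>w j\<bar> = \<bar>h j\<bar> - \<mu>" using nz by (simp add: w abs_mult abs_sgn_eq)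
      moreover have "w j * h j = (h j)\<^sup>2 - \<mu> * \<bar>h j\<bar>"
      proof -
        have "w j * h j = (\<bar>h j\<bar> - \<mu>) * \<bar>h j\<bar>" by (simp add: w abs_sgn[of "h j"] mult_ac)
        thus ?thesis by (simp add: power2_eq_square left_diff_distrib)
      qed
      moreover from calculation(1) have "(w j)\<^sup>2 = (\<bar>h j\<bar> - \<mu>)\<^sup>2" by (metis power2_abs)
      ultimately show ?thesis using True
        by (simp add: off_stat_def power2_diff mult_ac)
    next
      case False
      thus ?thesis using that by (simp add: w_def off_stat_def)
    qed
    thus "\<bar>w j\<bar> = off_stat \<tau> 0 1 (- \<mu>) 0 (h j)" "a - w j * h j = off_stat \<tau> (- 1) \<mu> 0 a (h j)"
      "(w j)\<^sup>2 - b = off_stat \<tau> 1 (- 2 * \<mu>) (\<mu>\<^sup>2) (- b) (h j)" by auto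
  qed
  have "descent n S \<sigma> w = ?E1" unfolding descent_def using on(1) off(1) by (intro arg_cong2[of _ _ _ _ "(+)"] sum.cong) auto
  hence D: "descent n S \<sigma> w < 0" using E(1) by simp
  have "(\<Sum>j<n. a - w j * h j) = ?E2" unfolding split using on(2) off(2) by (intro arg_cong2[of _ _ _ _ "(+)"] sum.cong) auto
  hence H: "real n * a < (\<Sum>j<n. w j * h j)" using E(2) by (simp add: sum_subtractf)
  have "(\<Sum>j<n. (w j)\<^sup>2 - b) = ?E3" unfolding split using on(3) off(3) by (intro arg_cong2[of _ _ _ _ "(+)"] sum.cong) auto
  hence W: "(\<Sum>j<n. (w j)\<^sup>2) < real n * b" using E(3) by (simp add: sum_subtractf)
  have "(\<Sum>j<n. - d) = (\<Sum>j\<in>S. on_stat 0 0 (- d) (\<sigma> j) (h j)) + (\<Sum>j\<in>{..<n} - S. off_stat \<tau> 0 0 0 (- d) (h j))"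
    unfolding split by (simp add: on_stat_def off_stat_def)
  hence G: "(\<Sum>j<m. (g j)\<^sup>2) < real n * d" using E(4) by simp
  have "w \<noteq> (\<lambda>_. 0)"
  proof
    assume "w = (\<lambda>_. 0)"
    hence "real n * a < 0" using H by simp
    thus False using abd(1) by (simp add: mult_less_0_iff)
  qed
  then obtain r where r: "0 < r" "r\<^sup>2 = (\<Sum>j<n. (w j)\<^sup>2)" "(\<lambda>j. (1 / r) * w j) \<in> unit_vecs n"
    using unit_vecs_normalize[OF wv] by blast
  have "descent n S \<sigma> (\<lambda>j. (1 / r) * w j) \<le> 0"
    using r(1) D by (subst descent_scale) (auto simp: divide_le_0_iff)
  hence "(\<Sum>i<n. (1 / r) * w i * h i) + (\<Sum>j<m. y j * g j) \<le> 0" using r(3) by (intro le) (simp add: descent_sphere_def)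
  moreover have "(\<Sum>i<n. (1 / r) * w i * h i) = (\<Sum>i<n. w i * h i) / r" by (simp add: sum_divide_distrib)
  ultimately have "(\<Sum>i<n. w i * h i) / r \<le> \<bar>\<Sum>j<m. y j * g j\<bar>" by linarith
  hence *: "(\<Sum>i<n. w i * h i) \<le> r * \<bar>\<Sum>j<m. y j * g j\<bar>" using r(1) by (simp add: pos_divide_le_eq mult.commute)
  have na: "0 \<le> real n * a" using abd(1) by simp
  \<comment> \<open>The strict inequality for <w,h> survives squaring and contradicts
    \<open>b * d \<le> a\<^sup>2\<close> at the end of the chain.\<close>
  have "(real n * a)\<^sup>2 < (\<Sum>j<n. w j * h j)\<^sup>2" using H na by (intro power_strict_mono) auto
  also have "\<dots> \<le> (r * \<bar>\<Sum>j<m. y j * g j\<bar>)\<^sup>2" using * H na by (intro power_mono) linarith+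
  also have "\<dots> = r\<^sup>2 * (\<Sum>j<m. y j * g j)\<^sup>2" by (simp add: power_mult_distrib)
  also have "\<dots> \<le> r\<^sup>2 * ((\<Sum>j<m. (y j)\<^sup>2) * (\<Sum>j<m. (g j)\<^sup>2))"
    by (intro mult_left_mono Cauchy_Schwarz_ineq_sum) simp
  also have "\<dots> = (\<Sum>j<n. (w j)\<^sup>2) * (\<Sum>j<m. (g j)\<^sup>2)" using y r(2) by (simp add: unit_vecs_def)
  also have "\<dots> \<le> (real n * b) * (real n * d)"
  proof (intro mult_mono)
    have "0 \<le> (\<Sum>j<n. (w j)\<^sup>2)" by (simp add: sum_nonneg)
    thus "0 \<le> real n * b" using W by linarith
  qed (use W G in \<open>auto simp: sum_nonneg\<close>)
  also have "\<dots> = (real n)\<^sup>2 * (b * d)" by (simp add: power2_eq_square)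
  also have "\<dots> \<le> (real n)\<^sup>2 * a\<^sup>2" using abd(2) by (intro mult_left_mono) auto
  finally show False by (simp add: power_mult_distrib)
qed

text \<open>The inequalities in \<open>neg\<close> are the negative mean conditions of the four
  statistics: w in the cone, <w,h> large, |w| small, |g| small. The dual vector y exists before w is
  chosen, so y takes the place of the minimizing side of the comparison.\<close>

lemma no_recovery_overwhelming:
  assumes \<alpha>: "0 < \<alpha>" "\<alpha> < 1" and \<beta>: "0 < \<beta>"
    and m_def: "\<And>n. m n = nat \<lfloor>\<alpha> * real n\<rfloor>"
    and S: "\<And>n. S n \<subseteq> {..<n} \<and> card (S n) = nat \<lfloor>\<beta> * real n\<rfloor>"
    and sigma: "\<And>n i. i \<in> S n \<Longrightarrow> \<sigma> n i \<in> {-1, 1}"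
    and \<tau>: "0 \<le> \<tau>" "\<mu> \<le> \<tau>" and abd: "0 < a" "b * d \<le> a\<^sup>2"
    and neg: "(1 - \<beta>) * tail1 \<tau> < \<mu> * (\<beta> + (1 - \<beta>) * tail0 \<tau>)"
      "a < \<beta> + (1 - \<beta>) * (tail2 \<tau> - \<mu> * tail1 \<tau>)"
      "\<beta> * (1 + \<mu>\<^sup>2) + (1 - \<beta>) * (tail2 \<tau> - 2 * \<mu> * tail1 \<tau> + \<mu>\<^sup>2 * tail0 \<tau>) < b"
      "\<alpha> < d"
  shows "overwhelming (\<lambda>n. gauss_mat (m n) n) (\<lambda>n A. \<exists>x \<in> sign_vecs (S n) (\<sigma> n). \<not> unique_l1_min (m n) n A x)"
proof -
  define ev where "ev = (\<lambda>n pg p q r p' q' r' t'. block_event ({..<Suc n} \<times> {..<Suc (m n)}) (m n) n (S n) (\<sigma> n)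
     (\<lambda>i. (n, i)) (\<lambda>j. (j, m n)) pg (on_stat p q r) (off_stat \<tau> p' q' r' t'))"
  have Sn: "S n \<subseteq> {..<n}" "card (S n) = nat \<lfloor>\<beta> * real n\<rfloor>" for n using S by auto
  have tb: "two_block \<alpha> \<beta> n (m n) (S n) (\<sigma> n) ({..<Suc n} \<times> {..<Suc (m n)}) (\<lambda>i. (n, i)) (\<lambda>j. (j, m n))" for n
    by (rule two_block_bordered(2)[OF \<alpha> \<beta> m_def Sn(2,1) sigma])
  have chern: "\<exists>c>0. \<exists>N0. \<forall>n\<ge>N0. ev n pg p q r p' q' r' t' \<in> sets (gauss_mat (Suc n) (Suc (m n))) \<and>
      measure (gauss_mat (Suc n) (Suc (m n))) (ev n pg p q r p' q' r' t') \<le> exp (- c * real n)"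
    if "\<alpha> * pg + \<beta> * (p + r) + (1 - \<beta>) * (p' * tail2 \<tau> + q' * tail1 \<tau> + r' * tail0 \<tau> + t') < 0" for pg p q r p' q' r' t'
    using two_block_chernoff[OF \<tau>(1) that, where 'r = "nat \<times> nat" and q = q] tb unfolding ev_def gauss_mat_def by blast
  obtain c1 N1 where 1: "0 < c1" "\<And>n. N1 \<le> n \<Longrightarrow> ev n 0 0 1 (- \<mu>) 0 1 (- \<mu>) 0 \<in> sets (gauss_mat (Suc n) (Suc (m n))) \<and>
      measure (gauss_mat (Suc n) (Suc (m n))) (ev n 0 0 1 (- \<mu>) 0 1 (- \<mu>) 0) \<le> exp (- c1 * real n)"
    using chern[of 0 0 "- \<mu>" 0 1 "- \<mu>" 0 1] neg(1) by (auto simp: algebra_simps)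
  obtain c2 N2 where 2: "0 < c2" "\<And>n. N2 \<le> n \<Longrightarrow> ev n 0 (- 1) \<mu> a (- 1) \<mu> 0 a \<in> sets (gauss_mat (Suc n) (Suc (m n))) \<and>
      measure (gauss_mat (Suc n) (Suc (m n))) (ev n 0 (- 1) \<mu> a (- 1) \<mu> 0 a) \<le> exp (- c2 * real n)"
    using chern[of 0 "- 1" a "- 1" \<mu> 0 a \<mu>] neg(2) by (auto simp: algebra_simps)
  obtain c3 N3 where 3: "0 < c3" "\<And>n. N3 \<le> n \<Longrightarrow> ev n 0 1 (- 2 * \<mu>) (\<mu>\<^sup>2 - b) 1 (- 2 * \<mu>) (\<mu>\<^sup>2) (- b) \<in> sets (gauss_mat (Suc n) (Suc (m n))) \<and>
      measure (gauss_mat (Suc n) (Suc (m n))) (ev n 0 1 (- 2 * \<mu>) (\<mu>\<^sup>2 - b) 1 (- 2 * \<mu>) (\<mu>\<^sup>2) (- b)) \<le> exp (- c3 * real n)"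
    using chern[of 0 1 "\<mu>\<^sup>2 - b" 1 "- 2 * \<mu>" "\<mu>\<^sup>2" "- b" "- 2 * \<mu>"] neg(3) by (auto simp: algebra_simps)
  obtain c4 N4 where 4: "0 < c4" "\<And>n. N4 \<le> n \<Longrightarrow> ev n 1 0 0 (- d) 0 0 0 (- d) \<in> sets (gauss_mat (Suc n) (Suc (m n))) \<and>
      measure (gauss_mat (Suc n) (Suc (m n))) (ev n 1 0 0 (- d) 0 0 0 (- d)) \<le> exp (- c4 * real n)"
    using chern[of 1 0 "- d" 0 0 0 "- d" 0] neg(4) by (auto simp: algebra_simps)
  define c where "c = min (min c1 c2) (min c3 c4)"
  have c: "0 < c" "c \<le> c1" "c \<le> c2" "c \<le> c3" "c \<le> c4" using 1 2 3 4 by (auto simp: c_def)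
  \<comment> \<open>The last summand makes \<open>S n\<close> nonempty, as the dual vector
    requires.\<close>
  define N where "N = N1 + N2 + N3 + N4 + nat \<lceil>1 / \<beta>\<rceil>"
  have N: "N1 \<le> N" "N2 \<le> N" "N3 \<le> N" "N4 \<le> N" "nat \<lceil>1 / \<beta>\<rceil> \<le> N" unfolding N_def by linarith+
  show ?thesis
  proof (rule overwhelmingI[OF c(1), where K = 4])
    show "\<forall>\<^sub>F n in sequentially. {A \<in> space (gauss_mat (m n) n). \<not> (\<exists>x \<in> sign_vecs (S n) (\<sigma> n). \<not> unique_l1_min (m n) n A x)} \<in> sets (gauss_mat (m n) n) \<and>
      measure (gauss_mat (m n) n) {A \<in> space (gauss_mat (m n) n). \<not> (\<exists>x \<in> sign_vecs (S n) (\<sigma> n). \<not> unique_l1_min (m n) n A x)} * measure stdn {..<-1}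
        \<le> 4 * exp (- c * real n)"
      using eventually_ge_at_top[of N]
    proof eventually_elim
      case (elim n)
      let ?M = "gauss_mat (Suc n) (Suc (m n))"
      define B where "B = {A \<in> space (gauss_mat (m n) n). \<not> hits_kernel (m n) n (S n) (\<sigma> n) A}"
      have eq: "{A \<in> space (gauss_mat (m n) n). \<not> (\<exists>x \<in> sign_vecs (S n) (\<sigma> n). \<not> unique_l1_min (m n) n A x)} = B"
        using all_unique_iff_no_hit[OF Sn(1), of n "\<sigma> n"] sigma by (auto simp: B_def)
      have "B = space (gauss_mat (m n) n) - {A \<in> space (gauss_mat (m n) n). hits_kernel (m n) n (S n) (\<sigma> n) A}"
        by (auto simp: B_def)
      hence B: "B \<in> sets (gauss_mat (m n) n)" using hits_kernel_measurable by auto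
      \<comment> \<open>The same event for the transposed matrix, whose entries have the same joint
        law.\<close>
      define B' where "B' = {A \<in> space (gauss_mat n (m n)). (\<lambda>p\<in>{..<m n} \<times> {..<n}. A (prod.swap p)) \<in> B}"
      have B': "B' \<in> sets (gauss_mat n (m n))" "measure (gauss_mat n (m n)) B' = measure (gauss_mat (m n) n) B"
      proof -
        have "inj_on prod.swap ({..<m n} \<times> {..<n})" "prod.swap \<in> {..<m n} \<times> {..<n} \<rightarrow> {..<n} \<times> {..<m n}" by auto
        from measure_PiM_stdn_reindex[OF this B[unfolded gauss_mat_def]]
        show "B' \<in> sets (gauss_mat n (m n))" "measure (gauss_mat n (m n)) B' = measure (gauss_mat (m n) n) B"
          unfolding B'_def gauss_mat_def by simp_all
      qed
      have "S n \<noteq> {}"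
      proof
        assume "S n = {}"
        hence "nat \<lfloor>\<beta> * real n\<rfloor> = 0" using Sn(2)[of n] by simp
        hence "\<beta> * real n < 1" by linarith
        moreover have "1 / \<beta> \<le> real n" using N(5) elim by linarith
        ultimately show False using \<beta> by (simp add: pos_divide_le_eq mult.commute)
      qed
      define U where "U = ev n 0 0 1 (- \<mu>) 0 1 (- \<mu>) 0 \<union> (ev n 0 (- 1) \<mu> a (- 1) \<mu> 0 a \<union>
        (ev n 0 1 (- 2 * \<mu>) (\<mu>\<^sup>2 - b) 1 (- 2 * \<mu>) (\<mu>\<^sup>2) (- b) \<union> ev n 1 0 0 (- d) 0 0 0 (- d)))"
      note evs = 1(2)[of n] 2(2)[of n] 3(2)[of n] 4(2)[of n]
      have U: "U \<in> sets ?M" unfolding U_def using evs N elim by (intro sets.Un) auto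
      have mono: "exp (- c' * real n) \<le> exp (- c * real n)" if "c \<le> c'" for c' using that by (simp add: mult_right_mono)
      have "measure ?M U \<le> exp (- c1 * real n) + (exp (- c2 * real n) + (exp (- c3 * real n) + exp (- c4 * real n)))"
        unfolding U_def using evs N elim
        by (intro order_trans[OF measure_Un_le] add_mono sets.Un) auto
      also have "\<dots> \<le> 4 * exp (- c * real n)" using mono[OF c(2)] mono[OF c(3)] mono[OF c(4)] mono[OF c(5)] by linarith
      finally have mU: "measure ?M U \<le> 4 * exp (- c * real n)" .
      have "measure (gauss_mat n (m n)) B' * measure stdn {..<-1} \<le> measure ?M U"
      proof (rule gordon_comparison[of "unit_vecs (m n)" "m n" "descent_sphere n (S n) (\<sigma> n)" n])
        show "descent_sphere n (S n) (\<sigma> n) \<subseteq> unit_vecs n" by (auto simp: descent_sphere_def)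
        show "\<exists>a\<in>unit_vecs (m n). \<forall>b\<in>descent_sphere n (S n) (\<sigma> n). (\<Sum>i<n. \<Sum>j<m n. b i * a j * A (i, j)) \<le> 0" if A: "A \<in> B'" for A
        proof -
          define A' where "A' = (\<lambda>p\<in>{..<m n} \<times> {..<n}. A (prod.swap p))"
          have "\<not> hits_kernel (m n) n (S n) (\<sigma> n) A'" using A by (simp add: B'_def B_def A'_def)
          from no_hit_dual[OF Sn(1) \<open>S n \<noteq> {}\<close> _ this] sigma
          obtain y where y: "y \<in> unit_vecs (m n)" "\<And>w. w \<in> descent_sphere n (S n) (\<sigma> n) \<Longrightarrow> (\<Sum>i<m n. y i * matvec n A' w i) \<le> 0"
            by blast
          have "(\<Sum>i<n. \<Sum>j<m n. w i * y j * A (i, j)) = (\<Sum>j<m n. y j * matvec n A' w j)" for w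
          proof -
            have "(\<Sum>i<n. \<Sum>j<m n. w i * y j * A (i, j)) = (\<Sum>j<m n. \<Sum>i<n. w i * y j * A (i, j))" by (rule sum.swap)
            also have "\<dots> = (\<Sum>j<m n. y j * matvec n A' w j)"
              by (intro sum.cong refl) (auto simp: matvec_def sum_distrib_left A'_def intro!: sum.cong)
            finally show ?thesis .
          qed
          thus ?thesis using y by (intro bexI[OF _ y(1)]) simp
        qed
        fix \<omega> y
        assume \<omega>: "\<omega> \<in> space ?M" "y \<in> unit_vecs (m n)"
          "\<And>w. w \<in> descent_sphere n (S n) (\<sigma> n) \<Longrightarrow> (\<Sum>i<n. w i * \<omega> (i, m n)) + (\<Sum>j<m n. y j * \<omega> (n, j)) \<le> 0"
        from dual_vector_cases[OF Sn(1) sigma \<tau> abd \<omega>(2), where h = "\<lambda>i. \<omega> (i, m n)" and g = "\<lambda>j. \<omega> (n, j)", OF _ \<omega>(3)]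
        show "\<omega> \<in> U" using \<omega>(1) unfolding U_def ev_def block_event_def gauss_mat_def by simp
      qed (auto intro: B'(1) U)
      thus ?case unfolding eq using B mU B'(2) by simp
    qed
  qed
qed

section \<open>The two thresholds\<close>

lemma erfinv_mono:
  assumes "0 \<le> y" "y \<le> z" "z < 1"
  shows "erfinv y \<le> erfinv z"
proof (rule ccontr)
  assume "\<not> erfinv y \<le> erfinv z"
  hence "erf (erfinv z) < erf (erfinv y)" by (intro erf_strict_mono) simp
  thus False using assms erf_erfinv(1)[of y] erf_erfinv(1)[of z] by simp
qed

text \<open>A translation between the error function and truncated moments. \<theta> is the limiting
  fraction of coordinates that are kept: all of \<open>S\<close>, and those outside \<open>S\<close>
  whose Gaussian exceeds \<tau> in modulus.\<close>

lemma threshold_constants: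
  fixes \<beta> \<theta> :: real
  assumes \<beta>: "0 < \<beta>" "\<beta> < 1" and \<theta>: "\<theta> \<in> {\<beta>..1}" and \<rho>: "\<bar>(1 - \<theta>) / (1 - \<beta>)\<bar> < 1"
  defines "e \<equiv> erfinv ((1 - \<theta>) / (1 - \<beta>))"
  defines "\<tau> \<equiv> sqrt 2 * e"
  shows "0 \<le> \<tau>" "0 < tail1 \<tau>" "\<beta> + (1 - \<beta>) * tail0 \<tau> = \<theta>" "tail1 \<tau> = sqrt (2 / pi) * exp (- (e ^ 2))"
    and "sqrt (2 * e ^ 2) = \<tau>"
    and "2 / sqrt (2 * pi) / exp (e ^ 2) = tail1 \<tau>"
proof -
  have r: "0 \<le> (1 - \<theta>) / (1 - \<beta>)" "(1 - \<theta>) / (1 - \<beta>) < 1" using assms by auto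
  have e: "erf e = (1 - \<theta>) / (1 - \<beta>)" "0 \<le> e" unfolding e_def using erf_erfinv[OF r] by auto
  show "0 \<le> \<tau>" using e by (simp add: \<tau>_def)
  have "\<tau> / sqrt 2 = e" by (simp add: \<tau>_def)
  thus "\<beta> + (1 - \<beta>) * tail0 \<tau> = \<theta>" using \<beta> by (simp add: tail0_def e field_simps)
  have "\<tau>\<^sup>2 = 2 * e\<^sup>2" by (simp add: \<tau>_def power_mult_distrib)
  hence t1: "tail1 \<tau> = 2 * (exp (- (e\<^sup>2)) / sqrt (2 * pi))" by (simp add: tail1_def std_normal_density_eq)
  thus "0 < tail1 \<tau>" by simp
  have "2 / sqrt (2 * pi) = sqrt (2 / pi)"
    by (simp add: real_sqrt_mult real_sqrt_divide field_simps)
  moreover have "tail1 \<tau> = 2 / sqrt (2 * pi) * exp (- (e\<^sup>2))" using t1 by simp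
  ultimately show "tail1 \<tau> = sqrt (2 / pi) * exp (- (e ^ 2))" by (simp only:)
  show "sqrt (2 * e ^ 2) = \<tau>" using e by (simp add: \<tau>_def real_sqrt_mult)
  show "2 / sqrt (2 * pi) / exp (e ^ 2) = tail1 \<tau>" using t1 by (simp add: exp_minus field_simps)
qed

lemma isCont_eventually_pos:
  fixes f :: "real \<Rightarrow> real"
  assumes "isCont f 0" "0 < f 0"
  shows "\<forall>\<^sub>F x in at_right 0. 0 < f x"
proof -
  have "(f \<longlongrightarrow> f 0) (at_right 0)"
    using assms(1) unfolding isCont_def by (rule tendsto_mono[OF at_le, rotated]) simp
  thus ?thesis using assms(2) by (rule order_tendstoD(1))
qed

theorem theorem3:
  fixes \<alpha> \<beta> :: real
    and m k :: "nat \<Rightarrow> nat"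
    and S :: "nat \<Rightarrow> nat set" and \<sigma> :: "nat \<Rightarrow> nat \<Rightarrow> real"
    and \<epsilon>c1 \<epsilon>c2 \<epsilon>m1 \<epsilon>g1 \<epsilon>g3 :: real
    and \<theta>1 \<theta>2 :: real
  assumes "0 < \<alpha>" "\<alpha> < 1" "0 < \<beta>" "\<beta> < 1"
    and m_def: "\<And>n. m n = nat \<lfloor>\<alpha> * real n\<rfloor>"
    and k_def: "\<And>n. k n = nat \<lfloor>\<beta> * real n\<rfloor>"
    and S: "\<And>n. S n \<subseteq> {..<n} \<and> card (S n) = k n"
    and sigma: "\<And>n i. i \<in> S n \<Longrightarrow> \<sigma> n i \<in> {-1, 1}"
    and "0 < \<epsilon>c1" "\<epsilon>c1 < 1" "0 < \<epsilon>c2" "\<epsilon>c2 < 1" "0 < \<epsilon>m1"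
        "0 < \<epsilon>g1" "\<epsilon>g1 < 1" "0 < \<epsilon>g3"
  shows
    "(\<theta>1 \<in> {\<beta>..1} \<and> eq1 \<epsilon>c1 \<beta> \<theta>1 \<and> (\<forall>\<theta>\<in>{\<beta>..1}. eq1 \<epsilon>c1 \<beta> \<theta> \<longrightarrow> \<theta> = \<theta>1)
       \<and> \<alpha> > thr1 \<beta> \<theta>1
      \<longrightarrow> overwhelming (\<lambda>n. gauss_mat (m n) n)
            (\<lambda>n A. \<forall>x \<in> sign_vecs (S n) (\<sigma> n). unique_l1_min (m n) n A x))
   \<and>
    (\<theta>2 \<in> {\<beta>..1} \<and> eq2 \<epsilon>c2 \<beta> \<theta>2 \<and> (\<forall>\<theta>\<in>{\<beta>..1}. eq2 \<epsilon>c2 \<beta> \<theta> \<longrightarrow> \<theta> = \<theta>2)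
       \<and> \<alpha> < thr2 \<epsilon>m1 \<epsilon>g1 \<epsilon>g3 \<beta> \<theta>2
      \<longrightarrow> overwhelming (\<lambda>n. gauss_mat (m n) n)
            (\<lambda>n A. \<exists>x \<in> sign_vecs (S n) (\<sigma> n). \<not> unique_l1_min (m n) n A x))"
proof (intro conjI impI; elim conjE)
  have Sk: "S n \<subseteq> {..<n} \<and> card (S n) = nat \<lfloor>\<beta> * real n\<rfloor>" for n using S k_def by simp
  {
    assume \<theta>: "\<theta>1 \<in> {\<beta>..1}" and eq: "eq1 \<epsilon>c1 \<beta> \<theta>1" and thr: "thr1 \<beta> \<theta>1 < \<alpha>"
    define e where "e = erfinv ((1 - \<theta>1) / (1 - \<beta>))"
    define \<tau> where "\<tau> = sqrt 2 * e"
    have rho: "\<bar>(1 - \<theta>1) / (1 - \<beta>)\<bar> < 1" "\<bar>(1 + \<epsilon>c1) * ((1 - \<theta>1) / (1 - \<beta>))\<bar> < 1" using eq by (auto simp: eq1_def)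
    note c = threshold_constants[OF \<open>0 < \<beta>\<close> \<open>\<beta> < 1\<close> \<theta> rho(1), folded e_def, folded \<tau>_def]
    have \<theta>0: "0 < \<theta>1" using \<theta> \<open>0 < \<beta>\<close> by simp
    define C where "C = (1 - \<beta>) * tail1 \<tau>"
    \<comment> \<open>The minimizer over \<mu> of \<open>\<theta>1 + \<tau> * C - 2 * \<mu> * C +
      \<mu>\<^sup>2 * \<theta>1\<close>; the minimum
      \<open>\<theta>1 + \<tau> * C - C\<^sup>2 / \<theta>1\<close> is \<open>thr1\<close>.\<close>
    define \<mu> where "\<mu> = C / \<theta>1"
    have C: "0 < C" using c(2) \<open>\<beta> < 1\<close> by (simp add: C_def)
    \<comment> \<open>In the equation \<epsilon>c1 enlarges the argument of \<open>erfinv\<close>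
      and shrinks the other side; both effects push towards \<tau> \<le> \<mu>.\<close>
    have "(1 - \<epsilon>c1) * \<mu> = sqrt 2 * erfinv ((1 + \<epsilon>c1) * ((1 - \<theta>1) / (1 - \<beta>)))"
      using eq c(4) by (simp add: eq1_def e_def[symmetric] \<mu>_def C_def mult_ac)
    also have "\<dots> \<ge> \<tau>"
    proof -
      have r0: "0 \<le> (1 - \<theta>1) / (1 - \<beta>)" using \<theta> \<open>\<beta> < 1\<close> by simp
      have "1 * ((1 - \<theta>1) / (1 - \<beta>)) \<le> (1 + \<epsilon>c1) * ((1 - \<theta>1) / (1 - \<beta>))"
        using r0 \<open>0 < \<epsilon>c1\<close> by (intro mult_right_mono) auto
      hence "e \<le> erfinv ((1 + \<epsilon>c1) * ((1 - \<theta>1) / (1 - \<beta>)))"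
        unfolding e_def using r0 rho(2) by (intro erfinv_mono) linarith+
      thus ?thesis by (simp add: \<tau>_def)
    qed
    finally have "\<tau> \<le> (1 - \<epsilon>c1) * \<mu>" .
    also have "\<dots> \<le> 1 * \<mu>" using \<open>0 < \<epsilon>c1\<close> C \<theta>0 by (intro mult_right_mono) (auto simp: \<mu>_def)
    finally have tm: "\<tau> \<le> \<mu>" by simp
    have "thr1 \<beta> \<theta>1 = (1 - \<beta>) * (1 - (1 - \<theta>1) / (1 - \<beta>)) + (1 - \<beta>) * (\<tau> * (2 / sqrt (2 * pi) / exp (e\<^sup>2))) + \<beta>
        - ((1 - \<beta>) * (sqrt (2 / pi) * exp (- (e ^ 2))))\<^sup>2 / \<theta>1"
      by (simp add: thr1_def Let_def e_def[symmetric] c(5) field_simps)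
    also have "(1 - \<beta>) * (1 - (1 - \<theta>1) / (1 - \<beta>)) = \<theta>1 - \<beta>" using \<open>\<beta> < 1\<close> by (simp add: field_simps)
    also have "\<theta>1 - \<beta> + (1 - \<beta>) * (\<tau> * (2 / sqrt (2 * pi) / exp (e\<^sup>2))) + \<beta> - ((1 - \<beta>) * (sqrt (2 / pi) * exp (- (e ^ 2))))\<^sup>2 / \<theta>1
        = \<theta>1 + \<tau> * C - C\<^sup>2 / \<theta>1"
      unfolding c(6) c(4)[symmetric] C_def by simp
    finally have thr': "\<theta>1 + \<tau> * C - C\<^sup>2 / \<theta>1 < \<alpha>" using thr by simp
    have "\<beta> * (1 + \<mu>\<^sup>2) + (1 - \<beta>) * (tail2 \<tau> - 2 * \<mu> * tail1 \<tau> + \<mu>\<^sup>2 * tail0 \<tau>)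
        = (\<beta> + (1 - \<beta>) * tail0 \<tau>) + \<tau> * C - 2 * \<mu> * C + \<mu>\<^sup>2 * (\<beta> + (1 - \<beta>) * tail0 \<tau>)"
      by (simp add: tail2_def C_def algebra_simps)
    also have "\<dots> = \<theta>1 + \<tau> * C - C\<^sup>2 / \<theta>1"
      unfolding c(3) \<mu>_def using \<theta>0 by (simp add: power2_eq_square field_simps)
    finally have "\<beta> * (1 + \<mu>\<^sup>2) + (1 - \<beta>) * (tail2 \<tau> - 2 * \<mu> * tail1 \<tau> + \<mu>\<^sup>2 * tail0 \<tau>) < \<alpha>" using thr' by simp
    from recovery_overwhelming[OF \<open>0 < \<alpha>\<close> \<open>\<alpha> < 1\<close> \<open>0 < \<beta>\<close> m_def Sk sigma c(1) tm this]
    show "overwhelming (\<lambda>n. gauss_mat (m n) n)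
            (\<lambda>n A. \<forall>x \<in> sign_vecs (S n) (\<sigma> n). unique_l1_min (m n) n A x)" .
  next
    assume \<theta>: "\<theta>2 \<in> {\<beta>..1}" and eq: "eq2 \<epsilon>c2 \<beta> \<theta>2" and thr: "\<alpha> < thr2 \<epsilon>m1 \<epsilon>g1 \<epsilon>g3 \<beta> \<theta>2"
    define e where "e = erfinv ((1 - \<theta>2) / (1 - \<beta>))"
    define \<tau> where "\<tau> = sqrt 2 * e"
    have rho: "\<bar>(1 - \<theta>2) / (1 - \<beta>)\<bar> < 1" using eq by (auto simp: eq2_def)
    note c = threshold_constants[OF \<open>0 < \<beta>\<close> \<open>\<beta> < 1\<close> \<theta> rho, folded e_def, folded \<tau>_def]
    have \<theta>0: "0 < \<theta>2" using \<theta> \<open>0 < \<beta>\<close> by simp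
    define C where "C = (1 - \<beta>) * tail1 \<tau>"
    define \<mu>0 where "\<mu>0 = C / \<theta>2"
    have C: "0 < C" using c(2) \<open>\<beta> < 1\<close> by (simp add: C_def)
    have \<mu>0: "0 < \<mu>0" using C \<theta>0 by (simp add: \<mu>0_def)
    \<comment> \<open>The equation for the second part gives the opposite order, and strictly, which
      leaves room above \<mu>0.\<close>
    have "1 * \<mu>0 < (1 + \<epsilon>c2) * \<mu>0" using \<open>0 < \<epsilon>c2\<close> \<mu>0 by (intro mult_strict_right_mono) auto
    also have "(1 + \<epsilon>c2) * \<mu>0 = sqrt 2 * erfinv ((1 - \<epsilon>c2) * ((1 - \<theta>2) / (1 - \<beta>)))"
      using eq c(4) by (simp add: eq2_def e_def[symmetric] \<mu>0_def C_def mult_ac)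
    also have "\<dots> \<le> \<tau>"
    proof -
      have r0: "0 \<le> (1 - \<theta>2) / (1 - \<beta>)" using \<theta> \<open>\<beta> < 1\<close> by simp
      have "(1 - \<epsilon>c2) * ((1 - \<theta>2) / (1 - \<beta>)) \<le> 1 * ((1 - \<theta>2) / (1 - \<beta>))"
        using r0 \<open>0 < \<epsilon>c2\<close> by (intro mult_right_mono) auto
      moreover have "0 \<le> (1 - \<epsilon>c2) * ((1 - \<theta>2) / (1 - \<beta>))"
        using r0 \<open>\<epsilon>c2 < 1\<close> by (intro mult_nonneg_nonneg) auto
      ultimately have "erfinv ((1 - \<epsilon>c2) * ((1 - \<theta>2) / (1 - \<beta>))) \<le> e"
        unfolding e_def using rho by (intro erfinv_mono) linarith+
      thus ?thesis by (simp add: \<tau>_def)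
    qed
    finally have tm: "\<mu>0 < \<tau>" by simp
    define X where "X = \<theta>2 + \<tau> * C"
    have X: "0 < X" using \<theta>0 c(1) C by (simp add: X_def add_pos_nonneg)
    define Y where "Y = C\<^sup>2 / \<theta>2"
    have Y: "0 < Y" using C \<theta>0 by (simp add: Y_def)
    have "thr2 \<epsilon>m1 \<epsilon>g1 \<epsilon>g3 \<beta> \<theta>2 = 1 / (1 + \<epsilon>m1)\<^sup>2 *
        ((1 - \<epsilon>g1) * (\<theta>2 + (1 - \<beta>) * (\<tau> * (2 / sqrt (2 * pi) / exp (e\<^sup>2))))
         - (1 + \<epsilon>g3)\<^sup>2 * ((1 - \<beta>) * (sqrt (2 / pi) * exp (- (e ^ 2))))\<^sup>2 / \<theta>2)"
      by (simp add: thr2_def Let_def e_def[symmetric] c(5) mult_ac)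
    also have "\<dots> = 1 / (1 + \<epsilon>m1)\<^sup>2 * ((1 - \<epsilon>g1) * X - (1 + \<epsilon>g3)\<^sup>2 * Y)"
      unfolding c(6) c(4)[symmetric] X_def Y_def C_def by (simp add: mult_ac)
    finally have t2: "\<alpha> < 1 / (1 + \<epsilon>m1)\<^sup>2 * ((1 - \<epsilon>g1) * X - (1 + \<epsilon>g3)\<^sup>2 * Y)" using thr by simp
    have V: "\<alpha> < X - Y"
    proof -
      define W where "W = (1 - \<epsilon>g1) * X - (1 + \<epsilon>g3)\<^sup>2 * Y"
      have sq: "1 \<le> (1 + \<epsilon>m1)\<^sup>2" "1 \<le> (1 + \<epsilon>g3)\<^sup>2" using \<open>0 < \<epsilon>m1\<close> \<open>0 < \<epsilon>g3\<close> by (auto intro!: one_le_power)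
      have "0 < W / (1 + \<epsilon>m1)\<^sup>2" using t2 \<open>0 < \<alpha>\<close> by (simp add: W_def)
      hence "0 < W" using sq by (simp add: zero_less_divide_iff)
      hence "W / (1 + \<epsilon>m1)\<^sup>2 \<le> W / 1" using sq by (intro divide_left_mono) auto
      moreover have "(1 - \<epsilon>g1) * X \<le> 1 * X" using X \<open>0 < \<epsilon>g1\<close> by (intro mult_right_mono) auto
      moreover have "1 * Y \<le> (1 + \<epsilon>g3)\<^sup>2 * Y" using Y sq by (intro mult_right_mono) auto
      ultimately show ?thesis using t2 by (simp add: W_def)
    qed
    \<comment> \<open>At \<mu>0 the mean of <w,h> and that of |w|^2, per dimension, are both X - Y,
      so the optimal squared ratio is X - Y as well.\<close>
    have id1: "X - \<mu>0 * C = X - Y" by (simp add: \<mu>0_def Y_def power2_eq_square)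
    have id2: "X - 2 * \<mu>0 * C + \<mu>0\<^sup>2 * \<theta>2 = X - Y"
      using \<theta>0 by (simp add: \<mu>0_def Y_def power2_eq_square field_simps)
    \<comment> \<open>At \<mu>0 the mean of \<open>descent\<close> is exactly 0, because C = \<mu>0
      \<theta>2. A slightly larger multiplier makes it negative, and the remaining strict conditions
      persist by continuity. The same \<eta> serves as slack in a, b and d.\<close>
    have "\<forall>\<^sub>F \<eta> in at_right 0. 0 < \<tau> - (\<mu>0 + \<eta>)"
      by (rule isCont_eventually_pos) (use tm in \<open>auto intro!: continuous_intros\<close>)
    moreover have "\<forall>\<^sub>F \<eta> in at_right 0. 0 < X - (\<mu>0 + \<eta>) * C - \<eta>"
      by (rule isCont_eventually_pos) (use V id1 \<open>0 < \<alpha>\<close> in \<open>auto intro!: continuous_intros\<close>)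
    moreover have "\<forall>\<^sub>F \<eta> in at_right 0. 0 < (X - (\<mu>0 + \<eta>) * C - \<eta>)\<^sup>2 - (X - 2 * (\<mu>0 + \<eta>) * C + (\<mu>0 + \<eta>)\<^sup>2 * \<theta>2 + \<eta>) * (\<alpha> + \<eta>)"
    proof (rule isCont_eventually_pos)
      \<comment> \<open>For \<eta> = 0 the expression equals (X - Y)(X - Y - \<alpha>).\<close>
      have "\<alpha> * (X - Y) < (X - Y) * (X - Y)" using V \<open>0 < \<alpha>\<close> by (intro mult_strict_right_mono) auto
      thus "0 < (X - (\<mu>0 + 0) * C - 0)\<^sup>2 - (X - 2 * (\<mu>0 + 0) * C + (\<mu>0 + 0)\<^sup>2 * \<theta>2 + 0) * (\<alpha> + 0)"
        unfolding add_0_right diff_0_right id1 id2 power2_eq_square[of "X - Y"] by (simp add: mult.commute)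
    qed (intro continuous_intros)
    moreover have "\<forall>\<^sub>F \<eta> in at_right (0::real). 0 < \<eta>" by (rule eventually_at_right_less)
    ultimately have "\<forall>\<^sub>F \<eta> in at_right (0::real). 0 < \<eta> \<and> 0 < \<tau> - (\<mu>0 + \<eta>) \<and> 0 < X - (\<mu>0 + \<eta>) * C - \<eta> \<and>
        0 < (X - (\<mu>0 + \<eta>) * C - \<eta>)\<^sup>2 - (X - 2 * (\<mu>0 + \<eta>) * C + (\<mu>0 + \<eta>)\<^sup>2 * \<theta>2 + \<eta>) * (\<alpha> + \<eta>)"
      by eventually_elim simp
    then obtain \<eta> where \<eta>: "0 < \<eta>" "0 < \<tau> - (\<mu>0 + \<eta>)" "0 < X - (\<mu>0 + \<eta>) * C - \<eta>"
        "0 < (X - (\<mu>0 + \<eta>) * C - \<eta>)\<^sup>2 - (X - 2 * (\<mu>0 + \<eta>) * C + (\<mu>0 + \<eta>)\<^sup>2 * \<theta>2 + \<eta>) * (\<alpha> + \<eta>)"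
      using eventually_happens'[OF trivial_limit_at_right_real] by blast
    define \<mu> where "\<mu> = \<mu>0 + \<eta>"
    have t0: "(1 - \<beta>) * tail0 \<tau> = \<theta>2 - \<beta>" using c(3) by linarith
    have t2: "(1 - \<beta>) * tail2 \<tau> = \<theta>2 - \<beta> + \<tau> * C" using t0 by (simp add: tail2_def C_def algebra_simps)
    show "overwhelming (\<lambda>n. gauss_mat (m n) n)
            (\<lambda>n A. \<exists>x \<in> sign_vecs (S n) (\<sigma> n). \<not> unique_l1_min (m n) n A x)"
    proof (rule no_recovery_overwhelming[OF \<open>0 < \<alpha>\<close> \<open>\<alpha> < 1\<close> \<open>0 < \<beta>\<close> m_def Sk sigma c(1)])
      show "\<mu> \<le> \<tau>" using \<eta>(2) by (simp add: \<mu>_def)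
      show "0 < X - \<mu> * C - \<eta>" using \<eta>(3) by (simp add: \<mu>_def)
      show "(X - 2 * \<mu> * C + \<mu>\<^sup>2 * \<theta>2 + \<eta>) * (\<alpha> + \<eta>) \<le> (X - \<mu> * C - \<eta>)\<^sup>2" using \<eta>(4) by (simp add: \<mu>_def)
      have "C < (\<mu>0 + \<eta>) * \<theta>2" using \<theta>0 \<eta>(1) by (simp add: \<mu>0_def algebra_simps)
      thus "(1 - \<beta>) * tail1 \<tau> < \<mu> * (\<beta> + (1 - \<beta>) * tail0 \<tau>)" unfolding c(3) by (simp add: C_def \<mu>_def)
      have "\<beta> + (1 - \<beta>) * (tail2 \<tau> - \<mu> * tail1 \<tau>) = \<beta> + (1 - \<beta>) * tail2 \<tau> - \<mu> * C" by (simp add: C_def algebra_simps)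
      thus "X - \<mu> * C - \<eta> < \<beta> + (1 - \<beta>) * (tail2 \<tau> - \<mu> * tail1 \<tau>)" using \<eta>(1) t2 by (simp add: X_def)
      have "\<beta> * (1 + \<mu>\<^sup>2) + (1 - \<beta>) * (tail2 \<tau> - 2 * \<mu> * tail1 \<tau> + \<mu>\<^sup>2 * tail0 \<tau>)
          = \<beta> + (1 - \<beta>) * tail2 \<tau> - 2 * \<mu> * C + \<mu>\<^sup>2 * (\<beta> + (1 - \<beta>) * tail0 \<tau>)" by (simp add: C_def algebra_simps)
      thus "\<beta> * (1 + \<mu>\<^sup>2) + (1 - \<beta>) * (tail2 \<tau> - 2 * \<mu> * tail1 \<tau> + \<mu>\<^sup>2 * tail0 \<tau>) < X - 2 * \<mu> * C + \<mu>\<^sup>2 * \<theta>2 + \<eta>"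
        unfolding c(3) using \<eta>(1) t2 by (simp add: X_def)
      show "\<alpha> < \<alpha> + \<eta>" using \<eta>(1) by simp
    qed
  }
qed

end
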